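(* Let $d\in\mathbb{N}$, $\alpha\in(0,1)$, $\beta\in(0,2)$, and let the spectral measure $\nu$ satisfy the standing assumption stated in the context. Let $q\in[1,\infty)$, and let $f:[0,\infty)\to[0,\infty)$ be locally Lipschitz continuous and non-decreasing, with $f(0)=0$ and $f>0$ on $(0,\infty)$, and of Osgood-type with exponent $k$ for some $k>q\left(1+\frac{\beta}{\alpha d}\right)$. Then there exists a non-negative function $u_0\in L_q(\mathbb{R}^d)$ such that the problem $$\partial_t^{\alpha}(u-u_0)+\Psi_\beta(-i\nabla)u=f(u),\quad t>0,\ x\in\mathbb{R}^d,$$ possesses no local integral solution, i.e. for no $T>0$ does there exist an integral solution $u:[0,T)\times\mathbb{R}^d\to[0,\infty]$. Moreover, for this $u_0$ and any $T>0$, any measurable $u:[0,T)\times\mathbb{R}^d\to[0,\infty]$ that satisfies $$u(t,x)=\int_{\mathbb{R}^d}Z(t,x-y)u_0(y)\,dy+\int_0^t\int_{\mathbb{R}^d}Y(t-s,x-y)f(u(s,y))\,dy\,ds$$ for every $t\in(0,T)$ and almost every $x\in\mathbb{R}^d$ has the property that $u(t,\cdot)\notin L_{1,\mathrm{loc}}(\mathbb{R}^d)$ for every $t\in(0,T)$.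
   Context: Notation: $g_\rho(t)=\frac{1}{\Gamma(\rho)}t^{\rho-1}$ for $\rho>0$, $t>0$; $\partial_t^\alpha v=\frac{d}{dt}\int_0^t g_{1-\alpha}(t-s)v(s)\,ds$ is the Riemann–Liouville derivative. $\Psi_\beta(-i\nabla)$ is the pseudo-differential operator with symbol $\psi_\beta(\xi)=|\xi|^\beta\omega_\nu(\xi/|\xi|)$, where $\omega_\nu(\theta)=\int_{\mathbb{S}^{d-1}}|\theta\cdot\eta|^\beta\,\nu(d\eta)$ for $\theta\in\mathbb{S}^{d-1}$ and $\nu$ is a (spectral) measure on $\mathbb{S}^{d-1}$. Standing assumption on $\nu$: $\nu$ has a strictly positive density, such that $\omega_\nu$ is strictly positive and $(d+1+[\beta])$-times continuously differentiable on $\mathbb{S}^{d-1}$, where $[\beta]$ is the integer part of $\beta$. Kernels: $G(t,x)=(2\pi)^{-d}\int_{\mathbb{R}^d}e^{ix\cdot\xi}e^{-t\psi_\beta(\xi)}\,d\xi$ is the Green function of $\partial_t v+\Psi_\beta(-i\nabla)v=0$ with $G(0,\cdot)=\delta_0$. $G_\alpha(t,s)$ is the Green function of $\partial_t v(t,s)+\frac{d^\alpha}{ds^\alpha}v(t,s)=0$ with $G_\alpha(0,\cdot)=\delta_0$, where $\frac{d^\alpha}{ds^\alpha}h(s)=\frac{1}{\Gamma(-\alpha)}\int_0^\infty\frac{h(s-\tau)-h(s)}{\tau^{1+\alpha}}\,d\tau$; that is, $G_\alpha(t,\cdot)$ is the density on $(0,\infty)$ with $\int_0^\infty e^{-\lambda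 s}G_\alpha(t,s)\,ds=e^{-t\lambda^\alpha}$, $\lambda\ge0$. Then $$Z(t,x)=\frac1\alpha\int_0^\infty G(t^\alpha s,x)\,s^{-1-\frac1\alpha}\,G_\alpha(1,s^{-\frac1\alpha})\,ds,$$ and $Y$ is the unique solution of $Z(t,x)=\int_0^t g_{1-\alpha}(t-s)Y(s,x)\,ds$. Integral solution: given non-negative $u_0,f$, a function $u:[0,T)\times\mathbb{R}^d\to[0,\infty]$ is an integral solution of the problem if it is measurable, finite almost everywhere, and for almost every $(t,x)\in(0,T)\times\mathbb{R}^d$ satisfies $u(t,x)=\int_{\mathbb{R}^d}Z(t,x-y)u_0(y)\,dy+\int_0^t\int_{\mathbb{R}^d}Y(t-s,x-y)f(u(s,y))\,dy\,ds$. Where $u=\infty$, $f(u)$ is read as $\lim_{s\to\infty}f(s)$. Osgood-type functions: for $k>1$ and a fixed $\phi_0>2^{1/(k-1)}$ put $\phi_i=\phi_{i-1}^k$ for $i\ge1$, and define $f^{[k]}:[0,\infty)\to[0,\infty)$ by $f^{[k]}(s)=(1-\phi_0^{1-k})s^k$ for $s\in[0,\phi_0]$; $f^{[k]}(s)=\phi_i-\phi_{i-1}$ for $s\in[\phi_{i-1},\phi_i/2]$, $i\ge1$; and, for $s\in(\phi_i/2,\phi_i)$, $i\ge1$, $f^{[k]}(s)$ is the affine interpolation between the values of $f^{[k]}$ at $\phi_i/2$ and $\phi_i$. A continuous $f:[0,\infty)\to[0,\infty)$ is of Osgood-type with exponent $k>1$ if (for such an $f^{[k]}$) there are constants $c,C>0$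 with $c\,f^{[k]}(s)\le f(s)\le C\,f^{[k]}(s)$ for all $s\ge0$. *)

theory Defs
  imports "HOL-Analysis.Analysis"
begin

subsection \<open>Spectral measures on the unit sphere\<close>

text \<open>
  Surface measure on the unit sphere of a \<open>d\<close>-dimensional space, by polar coordinates: the measure
  of \<open>A\<close> is \<open>d\<close> times the volume of the cone over \<open>A\<close> in the unit ball. Note that \<open>sgn x = x / norm x\<close>.
  For \<open>d = 1\<close> this is counting measure on the two unit vectors.
\<close>

definition sphere_measure :: "'a::euclidean_space measure" where
  "sphere_measure =
     scale_measure (of_nat DIM('a))
       (distr (restrict_space lborel (cball 0 1 - {0})) (restrict_space borel (sphere 0 1)) sgn)"

primrec Ck_on :: "nat \<Rightarrow> 'a::euclidean_space set \<Rightarrow> ('a \<Rightarrow> real) \<Rightarrow> bool" where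
  "Ck_on 0 U F \<longleftrightarrow> continuous_on U F"
| "Ck_on (Suc m) U F \<longleftrightarrow> (\<forall>x\<in>U. F differentiable (at x)) \<and>
     (\<forall>b\<in>Basis. Ck_on m U (\<lambda>x. frechet_derivative F (at x) b))"

text \<open>
  \<^const>\<open>Ck_on\<close> is meant for open sets. On the sphere, a function is of class \<open>C\<^sup>m\<close> in the sense of
  submanifolds: locally it is the restriction of a \<open>C\<^sup>m\<close> function on an open set of the ambient space.
\<close>

definition Ck_on_sphere :: "nat \<Rightarrow> ('a::euclidean_space \<Rightarrow> real) \<Rightarrow> bool" where
  "Ck_on_sphere m w \<longleftrightarrow>
     (\<forall>\<theta>\<in>sphere 0 1. \<exists>U F. open U \<and> \<theta> \<in> U \<and> Ck_on m U F \<and> (\<forall>x\<in>U \<inter> sphere 0 1. F x = w x))"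

definition omega :: "real \<Rightarrow> 'a::euclidean_space measure \<Rightarrow> 'a \<Rightarrow> real" where
  "omega \<beta> \<nu> \<theta> = (\<integral>\<eta>. \<bar>\<theta> \<bullet> \<eta>\<bar> powr \<beta> \<partial>\<nu>)"

definition psi :: "real \<Rightarrow> 'a::euclidean_space measure \<Rightarrow> 'a \<Rightarrow> real" where
  "psi \<beta> \<nu> \<xi> = norm \<xi> powr \<beta> * omega \<beta> \<nu> (sgn \<xi>)"

definition admissible_spectral_measure :: "real \<Rightarrow> 'a::euclidean_space measure \<Rightarrow> bool" where
  "admissible_spectral_measure \<beta> \<nu> \<longleftrightarrow>
     finite_measure \<nu> \<and>
     (\<exists>h::'a \<Rightarrow> real. h \<in> borel_measurable borel \<and> (\<forall>\<eta>\<in>sphere 0 1. 0 < h \<eta>) \<and>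
        \<nu> = density sphere_measure (\<lambda>\<eta>. ennreal (h \<eta>))) \<and>
     (\<forall>\<theta>\<in>sphere 0 1. 0 < omega \<beta> \<nu> \<theta>) \<and>
     Ck_on_sphere (DIM('a) + 1 + nat \<lfloor>\<beta>\<rfloor>) (omega \<beta> \<nu>)"

subsection \<open>Kernels\<close>

definition g_kernel :: "real \<Rightarrow> real \<Rightarrow> real" where
  "g_kernel \<rho> t = t powr (\<rho> - 1) / Gamma \<rho>"

text \<open>The symbol is even, so the Fourier integral is real and \<^const>\<open>Re\<close> only changes the type.\<close>

definition G_kernel :: "real \<Rightarrow> 'a::euclidean_space measure \<Rightarrow> real \<Rightarrow> 'a \<Rightarrow> real" where
  "G_kernel \<beta> \<nu> t x =
     Re (\<integral>\<xi>. exp (\<i> * complex_of_real (x \<bullet> \<xi>)) * complex_of_real (exp (- t * psi \<beta> \<nu> \<xi>)) \<partial>lborel)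
       / (2 * pi) ^ DIM('a)"

text \<open>
  The kernel \<open>G\<^sub>\<alpha>(t,s)\<close>. The Laplace transform determines it up to a null set of \<open>s\<close> for each \<open>t\<close>;
  below it only occurs under an integral in \<open>s\<close>, so the choice of version is immaterial.
\<close>

definition stable_subordinator_density :: "real \<Rightarrow> (real \<Rightarrow> real \<Rightarrow> real) \<Rightarrow> bool" where
  "stable_subordinator_density \<alpha> G\<alpha> \<longleftrightarrow>
     (\<forall>t>0. G\<alpha> t \<in> borel_measurable (restrict_space borel {0<..}) \<and>
        (\<forall>s>0. 0 \<le> G\<alpha> t s) \<and>
        (\<forall>r\<ge>0. (\<integral>\<^sup>+ s\<in>{0<..}. ennreal (exp (- r * s) * G\<alpha> t s) \<partial>lborel) =
                 ennreal (exp (- t * r powr \<alpha>))))"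

text \<open>
  \<open>Z\<close> takes values in \<open>[0,\<infinity>]\<close>: the integrand is non-negative because \<open>G\<close> is a transition density of
  a stable process, and the integral diverges at \<open>x = 0\<close> if \<open>d \<ge> \<beta>\<close>.
\<close>

definition Z_kernel ::
  "real \<Rightarrow> real \<Rightarrow> 'a::euclidean_space measure \<Rightarrow> (real \<Rightarrow> real \<Rightarrow> real) \<Rightarrow> real \<Rightarrow> 'a \<Rightarrow> ennreal" where
  "Z_kernel \<alpha> \<beta> \<nu> G\<alpha> t x =
     ennreal (1 / \<alpha>) *
     (\<integral>\<^sup>+ s\<in>{0<..}. ennreal (G_kernel \<beta> \<nu> (t powr \<alpha> * s) x * s powr (- 1 - 1 / \<alpha>)
                           * G\<alpha> 1 (s powr (- 1 / \<alpha>))) \<partial>lborel)"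

text \<open>
  \<open>Y\<close> solves \<open>Z(t,x) = \<integral>\<^sub>0\<^sup>t g\<^sub>1\<^sub>-\<^sub>\<alpha>(t-s) Y(s,x) ds\<close>. Where \<open>Z\<close> is finite, in particular for \<open>x \<noteq> 0\<close>,
  this determines \<open>Y(s,x)\<close> for almost every \<open>s\<close>; joint measurability makes \<open>Y\<close> unique almost
  everywhere in \<open>(s,x)\<close>, hence uniquely determines the Duhamel term below.
\<close>

definition Y_kernel_of :: "real \<Rightarrow> (real \<Rightarrow> 'a::euclidean_space \<Rightarrow> ennreal) \<Rightarrow> (real \<Rightarrow> 'a \<Rightarrow> ennreal) \<Rightarrow> bool" where
  "Y_kernel_of \<alpha> Z Y \<longleftrightarrow>
     (\<lambda>(t, x). Y t x) \<in> borel_measurable (restrict_space borel ({0<..} \<times> UNIV)) \<and>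
     (\<forall>t>0. \<forall>x. Z t x = (\<integral>\<^sup>+ s\<in>{0<..<t}. ennreal (g_kernel (1 - \<alpha>) (t - s)) * Y s x \<partial>lborel))"

subsection \<open>Integral solutions\<close>

definition ext_at_top :: "(real \<Rightarrow> real) \<Rightarrow> ennreal \<Rightarrow> ennreal" where
  "ext_at_top f w = (if w = \<infinity> then Lim at_top (\<lambda>s. ennreal (f s)) else ennreal (f (enn2real w)))"

definition mild_rhs ::
  "(real \<Rightarrow> 'a::euclidean_space \<Rightarrow> ennreal) \<Rightarrow> (real \<Rightarrow> 'a \<Rightarrow> ennreal) \<Rightarrow> (real \<Rightarrow> real) \<Rightarrow> ('a \<Rightarrow> real) \<Rightarrow>
     (real \<Rightarrow> 'a \<Rightarrow> ennreal) \<Rightarrow> real \<Rightarrow> 'a \<Rightarrow> ennreal" where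
  "mild_rhs Z Y f u0 u t x =
     (\<integral>\<^sup>+ y. Z t (x - y) * ennreal (u0 y) \<partial>lebesgue) +
     (\<integral>\<^sup>+ s\<in>{0<..<t}. (\<integral>\<^sup>+ y. Y (t - s) (x - y) * ext_at_top f (u s y) \<partial>lebesgue) \<partial>lebesgue)"

definition measurable_upto :: "real \<Rightarrow> (real \<Rightarrow> 'a::euclidean_space \<Rightarrow> ennreal) \<Rightarrow> bool" where
  "measurable_upto T u \<longleftrightarrow> (\<lambda>(t, x). u t x) \<in> borel_measurable (lebesgue_on ({0..<T} \<times> UNIV))"

definition integral_solution ::
  "(real \<Rightarrow> 'a::euclidean_space \<Rightarrow> ennreal) \<Rightarrow> (real \<Rightarrow> 'a \<Rightarrow> ennreal) \<Rightarrow> (real \<Rightarrow> real) \<Rightarrow> ('a \<Rightarrow> real) \<Rightarrow>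
     real \<Rightarrow> (real \<Rightarrow> 'a \<Rightarrow> ennreal) \<Rightarrow> bool" where
  "integral_solution Z Y f u0 T u \<longleftrightarrow>
     measurable_upto T u \<and>
     (AE (t, x) in lebesgue_on ({0..<T} \<times> UNIV). u t x < \<infinity>) \<and>
     (AE (t, x) in lebesgue_on ({0<..<T} \<times> UNIV). u t x = mild_rhs Z Y f u0 u t x)"

definition in_Lq :: "real \<Rightarrow> ('a::euclidean_space \<Rightarrow> real) \<Rightarrow> bool" where
  "in_Lq q v \<longleftrightarrow> v \<in> borel_measurable lebesgue \<and> integrable lebesgue (\<lambda>x. \<bar>v x\<bar> powr q)"

definition in_L1_loc :: "('a::euclidean_space \<Rightarrow> ennreal) \<Rightarrow> bool" where
  "in_L1_loc v \<longleftrightarrow>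
     v \<in> borel_measurable lebesgue \<and> (\<forall>K. compact K \<longrightarrow> (\<integral>\<^sup>+ x\<in>K. v x \<partial>lebesgue) < \<infinity>)"

subsection \<open>Osgood-type functions\<close>

primrec osgood_phi :: "real \<Rightarrow> real \<Rightarrow> nat \<Rightarrow> real" where
  "osgood_phi k \<phi>0 0 = \<phi>0"
| "osgood_phi k \<phi>0 (Suc i) = osgood_phi k \<phi>0 i powr k"

text \<open>
  \<open>F\<close> is \<open>f\<^sup>[\<^sup>k\<^sup>]\<close> on \<open>[0,\<infinity>)\<close>; the three clauses are consistent and determine it there.
\<close>

definition is_osgood_model :: "real \<Rightarrow> real \<Rightarrow> (real \<Rightarrow> real) \<Rightarrow> bool" where
  "is_osgood_model k \<phi>0 F \<longleftrightarrow>
     (let \<phi> = osgood_phi k \<phi>0 in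
       (\<forall>s\<in>{0..\<phi>0}. F s = (1 - \<phi>0 powr (1 - k)) * s powr k) \<and>
       (\<forall>i\<ge>1. \<forall>s\<in>{\<phi> (i - 1)..\<phi> i / 2}. F s = \<phi> i - \<phi> (i - 1)) \<and>
       (\<forall>i\<ge>1. \<forall>s\<in>{\<phi> i / 2<..<\<phi> i}.
          F s = F (\<phi> i / 2) + (s - \<phi> i / 2) / (\<phi> i - \<phi> i / 2) * (F (\<phi> i) - F (\<phi> i / 2))))"

definition osgood_type :: "real \<Rightarrow> (real \<Rightarrow> real) \<Rightarrow> bool" where
  "osgood_type k f \<longleftrightarrow>
     1 < k \<and> continuous_on {0..} f \<and> (\<forall>s\<ge>0. 0 \<le> f s) \<and>
     (\<exists>\<phi>0 F. 2 powr (1 / (k - 1)) < \<phi>0 \<and> is_osgood_model k \<phi>0 F \<and>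
        (\<exists>c C. 0 < c \<and> 0 < C \<and> (\<forall>s\<ge>0. c * F s \<le> f s \<and> f s \<le> C * F s)))"

end

theory Submission
  imports Defs "HOL-Probability.Levy"
begin

text \<open>
  Pick \<open>\<phi>\<^sub>i \<ge> 2\<^sup>i\<close> with \<open>f(\<phi>\<^sub>i) \<ge> c \<phi>\<^sub>i\<^sup>k\<close>: at the left end of each plateau of the Osgood model, \<open>f\<close> is as
  large as a power. Let \<open>\<rho>\<^sub>i\<close> satisfy \<open>\<rho>\<^sub>i\<^sup>d = \<phi>\<^sub>i\<close> to the power \<open>-q-\<epsilon>\<close> and let \<open>u\<^sub>0\<close> exceed a large multiple
  of \<open>\<phi>\<^sub>i\<close> on the ball of radius \<open>2 \<rho>\<^sub>i\<close>; this is possible in \<open>L\<^sub>q\<close>. By parabolic scaling the linear part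
  keeps every solution above \<open>\<phi>\<^sub>i\<close> for \<open>|x| \<le> \<rho>\<^sub>i\<close> up to a time \<open>\<tau>\<^sub>i\<close> comparable to \<open>\<rho>\<^sub>i\<close> to the power \<open>\<beta>/\<alpha>\<close>,
  so at a later time \<open>t\<close> the Duhamel term is at least a constant times \<open>\<phi>\<^sub>i\<^sup>k \<tau>\<^sub>i \<rho>\<^sub>i\<^sup>d\<close> on a fixed ball around
  the origin. For small \<open>\<epsilon>\<close> this is a positive power of \<open>\<phi>\<^sub>i\<close>, so the right-hand side is infinite there.

  The Duhamel estimate needs \<open>Y(\<cdot>,x)\<close> to have integral at least \<open>c \<tau>\<close> over \<open>(t-\<tau>,t)\<close>. Convolving the equation
  for \<open>Y\<close> with \<open>g\<^sub>\<alpha>\<close> expresses the integral of \<open>Y\<close> over \<open>(0,t)\<close> through \<open>Z\<close>, that is, through \<open>G\<close> and the stable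
  subordinator. Increments in \<open>t\<close> can be formed because this integral is finite for almost every \<open>x\<close>,
  which follows from \<open>G \<ge> 0\<close> and \<open>\<integral> G(t,x) dx \<le> 1\<close>.
\<close>

subsection \<open>Substitutions and uniqueness for Laplace transforms\<close>

text \<open>The threshold for k balances two counts. In L_q, height \<phi> on a ball of radius
  \<rho> costs \<phi>^q \<rho>^d, which for \<rho>^d = \<phi>^(-q-\<epsilon>) is summable along a
  sequence growing at least like 2^i. Diffusion preserves the height for a time of order
  \<rho>^(\<beta>/\<alpha>), and the gain \<phi>^k \<rho>^(d + \<beta>/\<alpha>) is unbounded
  exactly if k > (q + \<epsilon>)(1 + \<beta>/(\<alpha> d)). A lower bound of power type for f is
  available at the \<phi>_i only, the model being flat on long intervals beyond them; monotonicity
  carries it to larger values, and so the datum is built from this very sequence. The obstacle is Y,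
  given only by an integral equation and hence only for almost every time. No pointwise bound on Y
  is sought; every estimate goes through its time integrals. A second obstacle is the sign of G: it
  is not visible from the Fourier integral, and \<open>Z_kernel\<close> would cut negative values
  off through \<open>ennreal\<close>. Positive definiteness of exp (- t \<psi>) is therefore proved
  by hand, with compound Poisson approximations.\<close>

lemma nn_integral_Ioi_exp:
  fixes f :: "real \<Rightarrow> ennreal"
  assumes [measurable]: "f \<in> borel_measurable borel"
  shows "(\<integral>\<^sup>+ s\<in>{0<..}. f s \<partial>lborel) = (\<integral>\<^sup>+ y. f (exp y) * ennreal (exp y) \<partial>lborel)"
proof -
  \<comment> \<open>The substitution rule is applied on compact intervals; these images of
    [-(n+1), n+1] under exp exhaust the half-line.\<close>
  define I where "I n = {exp (- real (Suc n)) .. exp (real (Suc n))}" for n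
  have I_mono: "I m \<subseteq> I n" if "m \<le> n" for m n
    using that by (auto simp: I_def intro: order_trans)
  have ind: "(SUP n. f s * indicator (I n) s) = f s * indicator {0<..} s" for s
  proof (cases "s > 0")
    case True
    obtain n where n: "\<bar>ln s\<bar> \<le> real n" using real_arch_simple by blast
    have "ln s \<le> real (Suc n)" "- real (Suc n) \<le> ln s" using n by auto
    then have "exp (ln s) \<le> exp (real (Suc n))" "exp (- real (Suc n)) \<le> exp (ln s)"
      by (simp_all only: exp_le_cancel_iff)
    then have "s \<in> I n" using True by (simp add: I_def)
    then have "f s \<le> (SUP n. f s * indicator (I n) s)"
      by (intro SUP_upper2[of n]) auto
    moreover have "(SUP n. f s * indicator (I n) s) \<le> f s"
      by (intro SUP_least) (auto split: split_indicator)
    ultimately show ?thesis using True by simp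
  next
    case False
    have "s \<notin> I n" for n using False exp_gt_zero[of "- real (Suc n)"] unfolding I_def atLeastAtMost_iff by linarith
    then show ?thesis using False by simp
  qed
  have ind2: "(SUP n. g y * indicator {- real (Suc n) .. real (Suc n)} y) = g y"
    for y and g :: "real \<Rightarrow> ennreal"
  proof -
    obtain n where n: "\<bar>y\<bar> \<le> real n" using real_arch_simple by blast
    then have "y \<in> {- real (Suc n) .. real (Suc n)}" by auto
    then have "g y \<le> (SUP n. g y * indicator {- real (Suc n) .. real (Suc n)} y)"
      by (intro SUP_upper2[of n]) auto
    moreover have "(SUP n. g y * indicator {- real (Suc n) .. real (Suc n)} y) \<le> g y"
      by (intro SUP_least) (auto split: split_indicator)
    ultimately show ?thesis by simp
  qed
  have "(\<integral>\<^sup>+ s\<in>{0<..}. f s \<partial>lborel) = (\<integral>\<^sup>+ s. (SUP n. f s * indicator (I n) s) \<partial>lborel)"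
    by (simp add: ind)
  also have "\<dots> = (SUP n. \<integral>\<^sup>+ s. f s * indicator (I n) s \<partial>lborel)"
    by (rule nn_integral_monotone_convergence_SUP)
       (auto simp: incseq_def le_fun_def I_def dest: subsetD[OF I_mono, unfolded I_def] intro!: mult_left_mono split: split_indicator)
  also have "\<dots> = (SUP n. \<integral>\<^sup>+ y. f (exp y) * ennreal (exp y) * indicator {- real (Suc n) .. real (Suc n)} y \<partial>lborel)"
    unfolding I_def
    by (intro SUP_cong refl nn_integral_substitution_aux)
       (auto intro!: derivative_eq_intros continuous_intros)
  also have "\<dots> = (\<integral>\<^sup>+ y. (SUP n. f (exp y) * ennreal (exp y) * indicator {- real (Suc n) .. real (Suc n)} y) \<partial>lborel)"
    by (rule nn_integral_monotone_convergence_SUP[symmetric])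
       (auto simp: incseq_def le_fun_def intro!: mult_left_mono split: split_indicator)
  also have "\<dots> = (\<integral>\<^sup>+ y. f (exp y) * ennreal (exp y) \<partial>lborel)"
    by (subst ind2) simp
  finally show ?thesis .
qed

text \<open>In the logarithmic variable a power map is linear, so positive and negative exponents
  \<open>c\<close> are covered by one affine substitution on the whole line.\<close>

lemma nn_integral_Ioi_powr:
  fixes f :: "real \<Rightarrow> ennreal" and c :: real
  assumes [measurable]: "f \<in> borel_measurable borel" and c: "c \<noteq> 0"
  shows "(\<integral>\<^sup>+ s\<in>{0<..}. f s \<partial>lborel) =
    (\<integral>\<^sup>+ v\<in>{0<..}. f (v powr c) * ennreal (\<bar>c\<bar> * v powr (c - 1)) \<partial>lborel)"
proof -
  have *: "exp ((c - 1) * y) * exp y = exp (c * y)" for y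
    by (simp add: exp_add[symmetric] algebra_simps)
  have "(\<integral>\<^sup>+ v\<in>{0<..}. f (v powr c) * ennreal (\<bar>c\<bar> * v powr (c - 1)) \<partial>lborel)
      = (\<integral>\<^sup>+ y. f (exp y powr c) * ennreal (\<bar>c\<bar> * exp y powr (c - 1)) * ennreal (exp y) \<partial>lborel)"
    by (rule nn_integral_Ioi_exp) measurable
  also have "\<dots> = (\<integral>\<^sup>+ y. ennreal \<bar>c\<bar> * (f (exp (0 + c * y)) * ennreal (exp (0 + c * y))) \<partial>lborel)"
    by (intro nn_integral_cong)
       (simp add: * mult.assoc ennreal_mult[symmetric] powr_def ennreal_mult'[symmetric] mult.left_commute[of "ennreal \<bar>c\<bar>"] )
  also have "\<dots> = ennreal \<bar>c\<bar> * (\<integral>\<^sup>+ y. f (exp (0 + c * y)) * ennreal (exp (0 + c * y)) \<partial>lborel)"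
    by (rule nn_integral_cmult) measurable
  also have "\<dots> = (\<integral>\<^sup>+ y. f (exp y) * ennreal (exp y) \<partial>lborel)"
    by (rule nn_integral_real_affine[symmetric]) (use c in measurable)
  also have "\<dots> = (\<integral>\<^sup>+ s\<in>{0<..}. f s \<partial>lborel)"
    by (rule nn_integral_Ioi_exp[symmetric]) measurable
  finally show ?thesis by simp
qed

lemma nn_integral_Ioi_mult:
  fixes f :: "real \<Rightarrow> ennreal" and a :: real
  assumes [measurable]: "f \<in> borel_measurable borel" and a: "0 < a"
  shows "(\<integral>\<^sup>+ s\<in>{0<..}. f s \<partial>lborel) = ennreal a * (\<integral>\<^sup>+ v\<in>{0<..}. f (a * v) \<partial>lborel)"
  by (subst nn_integral_real_affine[where c=a and t=0])
     (use a in \<open>auto simp: zero_less_mult_iff indicator_def intro!: arg_cong[where f="(*) _"] nn_integral_cong\<close>)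

lemma nn_integral_Ioi_divide:
  fixes f :: "real \<Rightarrow> ennreal" and a :: real
  assumes [measurable]: "f \<in> borel_measurable borel" and a: "0 < a"
  shows "(\<integral>\<^sup>+ s\<in>{0<..}. f s \<partial>lborel) = (\<integral>\<^sup>+ l\<in>{0<..}. f (a / l) * ennreal (a / l\<^sup>2) \<partial>lborel)"
proof -
  have "(\<integral>\<^sup>+ s\<in>{0<..}. f s \<partial>lborel) = ennreal a * (\<integral>\<^sup>+ v\<in>{0<..}. f (a * v) \<partial>lborel)"
    by (rule nn_integral_Ioi_mult) (use a in auto)
  also have "\<dots> = ennreal a * (\<integral>\<^sup>+ l\<in>{0<..}. f (a * l powr (-1)) * ennreal (\<bar>-1\<bar> * l powr (-1 - 1)) \<partial>lborel)"
    by (subst nn_integral_Ioi_powr[where c="-1"]) auto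
  also have "\<dots> = (\<integral>\<^sup>+ l. ennreal a * (f (a * l powr (-1)) * ennreal (\<bar>-1\<bar> * l powr (-1 - 1)) * indicator {0<..} l) \<partial>lborel)"
    by (rule nn_integral_cmult[symmetric]) measurable
  also have "\<dots> = (\<integral>\<^sup>+ l\<in>{0<..}. f (a / l) * ennreal (a / l\<^sup>2) \<partial>lborel)"
  proof (intro nn_integral_cong)
    fix l :: real
    show "ennreal a * (f (a * l powr (-1)) * ennreal (\<bar>-1\<bar> * l powr (-1 - 1)) * indicator {0<..} l)
      = f (a / l) * ennreal (a / l\<^sup>2) * indicator {0<..} l"
    proof (cases "l > 0")
      case True
      have "l powr (-1) = inverse l" "l powr (-1-1) = inverse (l\<^sup>2)"
        using True by (simp_all add: powr_minus powr_numeral)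
      then show ?thesis using True a
        by (simp add: divide_inverse ennreal_mult mult_ac)
    qed simp
  qed
  finally show ?thesis .
qed

text \<open>The moment series of the characteristic function converges because the support is bounded.\<close>

lemma real_distribution_eq_moments:
  assumes "real_distribution M" "real_distribution N"
    and M1: "AE x in M. \<bar>x\<bar> \<le> 1" and N1: "AE x in N. \<bar>x\<bar> \<le> 1"
    and eq: "\<And>n::nat. (\<integral>x. x ^ n \<partial>M) = (\<integral>x. x ^ n \<partial>N)"
  shows "M = N"
proof (rule Levy_uniqueness[OF assms(1,2)])
  have char_sums: "(\<lambda>n. (\<i> * t) ^ n / fact n * complex_of_real (\<integral>x. x ^ n \<partial>P)) sums char P t"
    if "real_distribution P" and P1: "AE x in P. \<bar>x\<bar> \<le> 1" for P and t :: real
  proof -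
    interpret P: real_distribution P by fact
    let ?f = "\<lambda>n x. (\<i> * t) ^ n / fact n * complex_of_real (x ^ n)"
    have intp: "integrable P (\<lambda>x. x ^ n)" for n :: nat
      by (rule P.integrable_const_bound[of _ 1]) (use P1 in \<open>auto simp: power_le_one power_abs elim!: eventually_mono\<close>)
    have "(\<lambda>n. integral\<^sup>L P (?f n)) sums (\<integral>x. (\<Sum>n. ?f n x) \<partial>P)"
    proof (rule sums_integral)
      show "integrable P (?f n)" for n
        by (intro integrable_mult_right integrable_of_real intp)
      show "AE x in P. summable (\<lambda>n. norm (?f n x))"
      proof (rule AE_I2)
        fix x :: real
        have "summable (\<lambda>n. norm ((\<i> * t * x) ^ n /\<^sub>R fact n))" by (rule summable_norm_exp)
        then show "summable (\<lambda>n. norm (?f n x))"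
          by (simp add: norm_mult norm_divide norm_power power_mult_distrib norm_inverse divide_inverse mult_ac)
      qed
      show "summable (\<lambda>n. \<integral>x. norm (?f n x) \<partial>P)"
      proof (rule summable_comparison_test')
        show "summable (\<lambda>n. \<bar>t\<bar> ^ n / fact n)"
          using summable_exp[of "\<bar>t\<bar>"] by (simp add: divide_inverse mult.commute)
        show "norm (\<integral>x. norm (?f n x) \<partial>P) \<le> \<bar>t\<bar> ^ n / fact n" for n
        proof -
          have "norm (\<integral>x. norm (?f n x) \<partial>P) \<le> (\<integral>x. \<bar>t\<bar> ^ n / fact n * \<bar>x^n\<bar> \<partial>P)"
            by (simp add: norm_mult norm_divide norm_power power_abs)
          also have "\<dots> \<le> (\<integral>x. \<bar>t\<bar> ^ n / fact n * 1 \<partial>P)"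
            by (intro integral_mono_AE integrable_mult_right integrable_abs intp)
               (use P1 in \<open>auto simp: power_abs elim!: eventually_mono intro!: divide_right_mono mult_left_le power_le_one\<close>)
          also have "\<dots> = \<bar>t\<bar> ^ n / fact n"
            using P.prob_space unfolding P.space_eq_univ by simp
          finally show ?thesis .
        qed
      qed
    qed
    moreover have "(\<Sum>n. ?f n x) = iexp (t * x)" for x
    proof -
      have "(\<lambda>n. (\<i> * t * x) ^ n /\<^sub>R fact n) sums exp (\<i> * t * x)" by (rule exp_converges)
      then have "(\<lambda>n. ?f n x) sums exp (\<i> * (t * x))"
        by (simp add: power_mult_distrib scaleR_conv_of_real divide_inverse mult_ac)
      then show ?thesis by (simp add: sums_iff)
    qed
    moreover have "integral\<^sup>L P (?f n) = (\<i> * t) ^ n / fact n * complex_of_real (\<integral>x. x ^ n \<partial>P)" for n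
      by (simp only: integral_mult_right_zero integral_complex_of_real)
    ultimately show ?thesis unfolding char_def by (simp only:)
  qed
  show "char M = char N"
    using char_sums[OF assms(1) M1] char_sums[OF assms(2) N1] eq
    by (intro ext) (metis (no_types, lifting) ext sums_unique2)
qed

text \<open>Under y = exp (-x) the transform at n becomes a moment of a measure on (0,1], and a law
  with bounded support is determined by its moments. Weighting by exp (-x) / m makes both measures
  probabilities and turns the transform at n + 1 into the n-th moment; so the integers n \<ge> 1
  suffice, and neither function has to be integrable itself.\<close>

lemma Laplace_nn_integral_unique:
  fixes a b :: "real \<Rightarrow> ennreal"
  assumes [measurable]: "a \<in> borel_measurable borel" "b \<in> borel_measurable borel"
    and eq: "\<And>n::nat. 1 \<le> n \<Longrightarrow> (\<integral>\<^sup>+ x\<in>{0<..}. ennreal (exp (- real n * x)) * a x \<partial>lborel)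
                              = (\<integral>\<^sup>+ x\<in>{0<..}. ennreal (exp (- real n * x)) * b x \<partial>lborel)"
    and fin: "(\<integral>\<^sup>+ x\<in>{0<..}. ennreal (exp (- x)) * a x \<partial>lborel) < \<infinity>"
  shows "AE x in lborel. 0 < x \<longrightarrow> a x = b x"
proof -
  define L where "L c n = (\<integral>\<^sup>+ x\<in>{0<..}. ennreal (exp (- real n * x)) * c x \<partial>lborel)"
    for c :: "real \<Rightarrow> ennreal" and n :: nat
  have Leq: "L a (Suc n) = L b (Suc n)" for n
    unfolding L_def using eq[of "Suc n"] by simp
  define m where "m = enn2real (L a 1)"
  have m: "L a 1 = ennreal m" "L b 1 = ennreal m" "0 \<le> m"
    using fin Leq[of 0] by (auto simp: m_def L_def)
  show ?thesis
  proof (cases "m = 0")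
    case True
    have "AE x in lborel. 0 < x \<longrightarrow> c x = 0"
      if [measurable]: "c \<in> borel_measurable borel" and "L c 1 = 0" for c
    proof -
      have "AE x in lborel. ennreal (exp (- real 1 * x)) * c x * indicator {0<..} x = 0"
        using that(2) unfolding L_def by (subst (asm) nn_integral_0_iff_AE) auto
      then show ?thesis by eventually_elim (auto split: split_indicator_asm)
    qed
    from this[of a] this[of b] m True show ?thesis by auto
  next
    case False
    with m(3) have mpos: "0 < m" by simp
    define D where "D c x = ennreal (exp (- x) / m) * c x * indicator {0<..} x"
      for c :: "real \<Rightarrow> ennreal" and x
    have [measurable]: "D c \<in> borel_measurable borel" if "c \<in> borel_measurable borel" for c
      using that unfolding D_def by measurable
    have D_int: "(\<integral>\<^sup>+ x. ennreal (exp (- real n * x)) * D c x \<partial>lborel) = ennreal (1 / m) * L c (Suc n)"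
      if [measurable]: "c \<in> borel_measurable borel" for c n
    proof -
      have *: "ennreal (exp (- real n * x)) * D c x
        = ennreal (1 / m) * (ennreal (exp (- real (Suc n) * x)) * c x * indicator {0<..} x)" for x
      proof -
        have "exp (- real n * x) * (exp (- x) / m) = 1 / m * exp (- real (Suc n) * x)"
          by (simp add: exp_add[symmetric] algebra_simps)
        then have "ennreal (exp (- real n * x)) * ennreal (exp (- x) / m)
            = ennreal (1 / m) * ennreal (exp (- real (Suc n) * x))"
          using mpos by (simp add: ennreal_mult[symmetric] del: of_nat_Suc)
        then show ?thesis by (simp add: D_def mult.assoc[symmetric] del: of_nat_Suc)
      qed
      show ?thesis unfolding * L_def by (rule nn_integral_cmult) measurable
    qed
    define P where "P c = distr (density lborel (D c)) borel (\<lambda>x. exp (- x))" for c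
    have prob: "prob_space (density lborel (D c))"
      if [measurable]: "c \<in> borel_measurable borel" and "L c 1 = ennreal m" for c
    proof
      have "emeasure (density lborel (D c)) UNIV = (\<integral>\<^sup>+ x. ennreal (exp (- real 0 * x)) * D c x \<partial>lborel)"
        by (simp add: emeasure_density)
      also have "\<dots> = 1"
        using D_int[of c 0] that mpos by (simp add: ennreal_mult[symmetric] flip: One_nat_def)
      finally show "emeasure (density lborel (D c)) (space (density lborel (D c))) = 1" by simp
    qed
    have dist: "real_distribution (P c)"
      if [measurable]: "c \<in> borel_measurable borel" and "L c 1 = ennreal m" for c
      unfolding P_def by (intro prob_space.real_distribution_distr prob that) auto
    have le1: "AE x in P c. \<bar>x\<bar> \<le> 1" if [measurable]: "c \<in> borel_measurable borel" for c
      unfolding P_def by (subst AE_distr_iff) (auto simp: AE_density D_def split: split_indicator)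
    have mom: "(\<integral>x. x ^ n \<partial>P c) = enn2real (ennreal (1 / m) * L c (Suc n))"
      if [measurable]: "c \<in> borel_measurable borel" for c n
    proof -
      have "(\<integral>x. x ^ n \<partial>P c) = (\<integral>x. exp (- real n * x) \<partial>density lborel (D c))"
        unfolding P_def by (subst integral_distr) (auto simp: exp_of_nat_mult[symmetric])
      also have "\<dots> = enn2real (\<integral>\<^sup>+x. ennreal (exp (- real n * x)) \<partial>density lborel (D c))"
        by (intro integral_eq_nn_integral) auto
      also have "(\<integral>\<^sup>+x. ennreal (exp (- real n * x)) \<partial>density lborel (D c))
          = (\<integral>\<^sup>+ x. ennreal (exp (- real n * x)) * D c x \<partial>lborel)"
        by (subst nn_integral_density) (auto simp: mult.commute)
      finally show ?thesis by (simp only: D_int[OF that])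
    qed
    have "P a = P b"
      by (rule real_distribution_eq_moments) (auto intro!: dist le1 m simp: mom Leq)
    then have "distr (P a) borel (\<lambda>y. - ln y) = distr (P b) borel (\<lambda>y. - ln y)" by simp
    moreover have "distr (P c) borel (\<lambda>y. - ln y) = density lborel (D c)" for c
      unfolding P_def by (subst distr_distr) (auto simp: comp_def distr_id2)
    ultimately have "density lborel (D a) = density lborel (D b)" by simp
    then have "AE x in lborel. D a x = D b x"
      by (intro sigma_finite_measure.density_unique[OF sigma_finite_lborel]) auto
    then show ?thesis
    proof eventually_elim
      case (elim x)
      show ?case
      proof
        assume "0 < x"
        with elim have "ennreal (exp (- x) / m) * a x = ennreal (exp (- x) / m) * b x"
          by (simp add: D_def)
        then show "a x = b x"
          using mpos by (simp add: ennreal_mult_cancel_left)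
      qed
    qed
  qed
qed

subsection \<open>A convolution identity for the stable subordinator\<close>

lemma nn_integral_Laplace_convolution:
  fixes k b :: "real \<Rightarrow> ennreal"
  assumes [measurable]: "k \<in> borel_measurable borel" "b \<in> borel_measurable borel"
  shows "(\<integral>\<^sup>+ l. ennreal (exp (- p * l)) * (\<integral>\<^sup>+ v. k (l - v) * b v \<partial>lborel) \<partial>lborel)
    = (\<integral>\<^sup>+ u. ennreal (exp (- p * u)) * k u \<partial>lborel) * (\<integral>\<^sup>+ v. ennreal (exp (- p * v)) * b v \<partial>lborel)"
proof -
  have "(\<integral>\<^sup>+ l. ennreal (exp (- p * l)) * (\<integral>\<^sup>+ v. k (l - v) * b v \<partial>lborel) \<partial>lborel)
     = (\<integral>\<^sup>+ l. (\<integral>\<^sup>+ v. ennreal (exp (- p * l)) * (k (l - v) * b v) \<partial>lborel) \<partial>lborel)"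
    by (simp add: nn_integral_cmult)
  also have "\<dots> = (\<integral>\<^sup>+ v. (\<integral>\<^sup>+ l. ennreal (exp (- p * l)) * (k (l - v) * b v) \<partial>lborel) \<partial>lborel)"
    by (rule lborel_pair.Fubini') measurable
  also have "\<dots> = (\<integral>\<^sup>+ v. (\<integral>\<^sup>+ u. ennreal (exp (- p * u)) * k u \<partial>lborel) * (ennreal (exp (- p * v)) * b v) \<partial>lborel)"
  proof (intro nn_integral_cong)
    fix v :: real
    have "(\<integral>\<^sup>+ l. ennreal (exp (- p * l)) * (k (l - v) * b v) \<partial>lborel)
        = (\<integral>\<^sup>+ u. ennreal (exp (- p * (v + 1 * u))) * (k (v + 1 * u - v) * b v) \<partial>lborel)"
      by (subst nn_integral_real_affine[where t=v and c=1]) auto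
    also have "\<dots> = (\<integral>\<^sup>+ u. ennreal (exp (- p * u)) * k u * (ennreal (exp (- p * v)) * b v) \<partial>lborel)"
      by (intro nn_integral_cong)
         (simp add: exp_add ring_distribs ennreal_mult' mult_ac exp_diff exp_minus divide_inverse)
    also have "\<dots> = (\<integral>\<^sup>+ u. ennreal (exp (- p * u)) * k u \<partial>lborel) * (ennreal (exp (- p * v)) * b v)"
      by (rule nn_integral_multc) measurable
    finally show "(\<integral>\<^sup>+ l. ennreal (exp (- p * l)) * (k (l - v) * b v) \<partial>lborel) = \<dots>" .
  qed
  also have "\<dots> = (\<integral>\<^sup>+ u. ennreal (exp (- p * u)) * k u \<partial>lborel) * (\<integral>\<^sup>+ v. ennreal (exp (- p * v)) * b v \<partial>lborel)"
    by (rule nn_integral_cmult) measurable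
  finally show ?thesis .
qed

lemma g_kernel_measurable [measurable]: "g_kernel \<rho> \<in> borel_measurable borel"
  unfolding g_kernel_def by measurable

lemma g_kernel_nonneg: "0 < \<rho> \<Longrightarrow> 0 \<le> g_kernel \<rho> t"
  unfolding g_kernel_def by (simp add: Gamma_real_pos less_imp_le)

lemma nn_integral_Laplace_g_kernel:
  assumes \<rho>: "0 < \<rho>" and p: "0 < p"
  shows "(\<integral>\<^sup>+ u. ennreal (exp (- p * u)) * (ennreal (g_kernel \<rho> u) * indicator {0<..} u) \<partial>lborel)
    = ennreal (p powr (- \<rho>))"
proof -
  have G: "0 < Gamma \<rho>" using \<rho> by (rule Gamma_real_pos)
  have gam: "(\<integral>\<^sup>+ t\<in>{0..}. ennreal (t powr (\<rho> - 1) / exp t) \<partial>lborel) = ennreal (Gamma \<rho>)"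
    unfolding Gamma_conv_nn_integral_real[OF \<rho>]
    by (intro nn_integral_cong) (auto split: split_indicator)
  have "(\<integral>\<^sup>+ u. ennreal (exp (- p * u)) * (ennreal (g_kernel \<rho> u) * indicator {0<..} u) \<partial>lborel)
     = (\<integral>\<^sup>+ u\<in>{0<..}. ennreal (exp (- p * u)) * ennreal (g_kernel \<rho> u) \<partial>lborel)"
    by (simp add: mult.assoc)
  also have "\<dots> = ennreal (1 / p) * (\<integral>\<^sup>+ t\<in>{0<..}. ennreal (exp (- p * (1 / p * t))) * ennreal (g_kernel \<rho> (1 / p * t)) \<partial>lborel)"
    by (rule nn_integral_Ioi_mult) (use p in auto)
  also have "\<dots> = ennreal (1 / p) * (\<integral>\<^sup>+ t. ennreal (p powr (1 - \<rho>) / Gamma \<rho>) * (ennreal (t powr (\<rho> - 1) / exp t) * indicator {0..} t) \<partial>lborel)"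
  proof (intro arg_cong[where f="(*) _"] nn_integral_cong_AE, rule AE_mp[OF AE_lborel_singleton[of 0]], intro AE_I2 impI)
    fix t :: real assume "t \<noteq> 0"
    show "ennreal (exp (- p * (1 / p * t))) * ennreal (g_kernel \<rho> (1 / p * t)) * indicator {0<..} t
      = ennreal (p powr (1 - \<rho>) / Gamma \<rho>) * (ennreal (t powr (\<rho> - 1) / exp t) * indicator {0..} t)"
    proof (cases "0 < t")
      case True
      have "exp (- p * (1 / p * t)) * g_kernel \<rho> (1 / p * t)
          = p powr (1 - \<rho>) / Gamma \<rho> * (t powr (\<rho> - 1) / exp t)"
        using True p G by (simp add: g_kernel_def powr_divide exp_minus powr_diff powr_minus field_simps)
      then show ?thesis using True G \<rho> by (simp add: ennreal_mult[symmetric] g_kernel_nonneg less_imp_le)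
    qed (use \<open>t \<noteq> 0\<close> in auto)
  qed
  also have "\<dots> = ennreal (1 / p) * (ennreal (p powr (1 - \<rho>) / Gamma \<rho>) * ennreal (Gamma \<rho>))"
    by (subst nn_integral_cmult) (auto simp: gam)
  also have "\<dots> = ennreal (p powr (- \<rho>))"
    using p G by (simp add: ennreal_mult[symmetric] powr_diff powr_minus field_simps)
  finally show ?thesis .
qed

text \<open>Differentiation of the transform in p. The quotients \<open>q n\<close> are right
  difference quotients with the sign reversed: being nonnegative on the half-line they are
  admissible \<open>ennreal\<close> integrands, and (2/p) exp (-(p/2) v) dominates them.\<close>

lemma nn_integral_Laplace_derivative:
  fixes \<gamma> :: "real \<Rightarrow> ennreal" and \<alpha> :: real
  assumes [measurable]: "\<gamma> \<in> borel_measurable borel"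
    and zero: "\<And>v. v \<le> 0 \<Longrightarrow> \<gamma> v = 0"
    and L: "\<And>r. 0 \<le> r \<Longrightarrow> (\<integral>\<^sup>+ v. ennreal (exp (- r * v)) * \<gamma> v \<partial>lborel) = ennreal (exp (- (r powr \<alpha>)))"
    and \<alpha>: "0 < \<alpha>" and p: "0 < p"
  shows "(\<integral>\<^sup>+ v. ennreal (exp (- p * v)) * (ennreal v * \<gamma> v) \<partial>lborel)
    = ennreal (\<alpha> * p powr (\<alpha> - 1) * exp (- (p powr \<alpha>)))"
proof -
  define h where "h n = inverse (real (Suc n))" for n
  have h: "0 < h n" for n by (simp add: h_def)
  have h0: "filterlim h (at_right 0) sequentially"
    unfolding h_def filterlim_at by (auto intro!: LIMSEQ_inverse_real_of_nat simp del: of_nat_Suc)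
  define q where "q n v = (exp (- p * v) - exp (- (p + h n) * v)) / h n" for n v
  have [measurable]: "q n \<in> borel_measurable borel" for n
    unfolding q_def by measurable
  \<comment> \<open>Distributing \<gamma> over a difference and passing to the limit in a product
    both need \<gamma> finite; the transform at 0 provides this almost everywhere.\<close>
  have gfin: "AE v in lborel. \<gamma> v \<noteq> \<infinity>"
  proof -
    have "AE v in lborel. ennreal (exp (- 0 * v)) * \<gamma> v \<noteq> \<infinity>"
      using L[of 0] by (intro nn_integral_noteq_infinite) auto
    then show ?thesis by simp
  qed
  have q_bound: "0 \<le> q n v \<and> q n v \<le> exp (- p * v) * v" if "0 < v" for n v
  proof -
    have "q n v = exp (- p * v) * ((1 - exp (- (h n * v))) / h n)"
      by (simp add: q_def exp_add[symmetric] right_diff_distrib algebra_simps)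
    moreover have "(1 - exp (- (h n * v))) / h n \<le> v"
      using exp_ge_add_one_self[of "- (h n * v)"] h[of n] by (simp add: divide_le_eq mult.commute)
    moreover have "0 \<le> (1 - exp (- (h n * v))) / h n"
      using h[of n] that by (simp add: less_imp_le)
    ultimately show ?thesis
      by (metis exp_ge_zero mult_left_mono mult_nonneg_nonneg)
  qed
  have q_lim: "(\<lambda>n. q n v) \<longlonglongrightarrow> exp (- p * v) * v" for v
  proof -
    have "((\<lambda>x. exp (- x * v)) has_real_derivative (exp (- p * v) * (- v))) (at p)"
      by (auto intro!: derivative_eq_intros)
    then have "((\<lambda>y. (exp (- (p + y) * v) - exp (- p * v)) / y) \<longlongrightarrow> exp (- p * v) * (- v)) (at 0)"
      unfolding DERIV_def .
    then have "((\<lambda>y. (exp (- (p + y) * v) - exp (- p * v)) / y) \<longlongrightarrow> exp (- p * v) * (- v)) (at_right 0)"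
      by (rule tendsto_mono[rotated]) (rule at_le, simp)
    from tendsto_minus[OF filterlim_compose[OF this h0]]
    show ?thesis by (simp add: q_def minus_divide_left)
  qed
  have int_q: "(\<integral>\<^sup>+ v. ennreal (q n v) * \<gamma> v \<partial>lborel)
     = ennreal ((exp (- (p powr \<alpha>)) - exp (- ((p + h n) powr \<alpha>))) / h n)" for n
  proof -
    have le: "ennreal (exp (- (p + h n) * v)) * \<gamma> v \<le> ennreal (exp (- p * v)) * \<gamma> v" for v
      using h[of n] by (cases "0 < v") (auto simp: zero algebra_simps intro!: mult_left_mono ennreal_leI)
    have "(\<integral>\<^sup>+ v. ennreal (q n v) * \<gamma> v \<partial>lborel)
      = (\<integral>\<^sup>+ v. ennreal (1 / h n) * (ennreal (exp (- p * v)) * \<gamma> v - ennreal (exp (- (p + h n) * v)) * \<gamma> v) \<partial>lborel)"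
    proof (rule nn_integral_cong_AE, use gfin in eventually_elim)
      fix v :: real assume fin: "\<gamma> v \<noteq> \<infinity>"
      show "ennreal (q n v) * \<gamma> v = ennreal (1 / h n) * (ennreal (exp (- p * v)) * \<gamma> v - ennreal (exp (- (p + h n) * v)) * \<gamma> v)"
      proof (cases "0 < v")
        case True
        have "ennreal (q n v) = ennreal (1 / h n) * (ennreal (exp (- p * v)) - ennreal (exp (- (p + h n) * v)))"
          using h[of n] True by (simp add: q_def ennreal_minus ennreal_mult'[symmetric])
        moreover have "(ennreal (exp (- p * v)) - ennreal (exp (- (p + h n) * v))) * \<gamma> v
           = ennreal (exp (- p * v)) * \<gamma> v - ennreal (exp (- (p + h n) * v)) * \<gamma> v"
          using ennreal_right_diff_distrib[of "\<gamma> v" "ennreal (exp (- p * v))" "ennreal (exp (- (p + h n) * v))"] fin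
          by (simp only: mult.commute[of _ "\<gamma> v"] infinity_ennreal_def simp_thms)
        ultimately show ?thesis
          by (simp only: mult.assoc)
      qed (simp add: zero)
    qed
    also have "\<dots> = ennreal (1 / h n) * (\<integral>\<^sup>+ v. ennreal (exp (- p * v)) * \<gamma> v - ennreal (exp (- (p + h n) * v)) * \<gamma> v \<partial>lborel)"
      by (rule nn_integral_cmult) measurable
    also have "(\<integral>\<^sup>+ v. ennreal (exp (- p * v)) * \<gamma> v - ennreal (exp (- (p + h n) * v)) * \<gamma> v \<partial>lborel)
      = ennreal (exp (- (p powr \<alpha>))) - ennreal (exp (- ((p + h n) powr \<alpha>)))"
      using L[of p] L[of "p + h n"] p h[of n] le by (subst nn_integral_diff) auto
    finally show ?thesis using h[of n] by (simp add: ennreal_minus ennreal_mult'[symmetric])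
  qed
  have "(\<lambda>n. \<integral>\<^sup>+ v. ennreal (q n v) * \<gamma> v \<partial>lborel) \<longlonglongrightarrow> (\<integral>\<^sup>+ v. ennreal (exp (- p * v)) * (ennreal v * \<gamma> v) \<partial>lborel)"
  proof (rule nn_integral_dominated_convergence)
    show "(\<integral>\<^sup>+ v. ennreal (2 / p) * (ennreal (exp (- (p / 2) * v)) * \<gamma> v) \<partial>lborel) < \<infinity>"
      using L[of "p / 2"] p by (subst nn_integral_cmult) (auto simp: ennreal_mult_less_top)
    show "AE v in lborel. ennreal (q n v) * \<gamma> v \<le> ennreal (2 / p) * (ennreal (exp (- (p / 2) * v)) * \<gamma> v)" for n
    proof (rule AE_I2)
      fix v :: real
      show "ennreal (q n v) * \<gamma> v \<le> ennreal (2 / p) * (ennreal (exp (- (p / 2) * v)) * \<gamma> v)"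
      proof (cases "0 < v")
        case True
        \<comment> \<open>Half of the exponential decay is spent on absorbing the factor v.\<close>
        have "p / 2 * v \<le> exp (p / 2 * v)" using exp_ge_add_one_self[of "p / 2 * v"] by linarith
        then have "v \<le> 2 / p * exp (p / 2 * v)" using p by (simp add: field_simps)
        then have "exp (- p * v) * v \<le> exp (- p * v) * (2 / p * exp (p / 2 * v))"
          by (intro mult_left_mono) auto
        also have "\<dots> = 2 / p * exp (- (p / 2) * v)"
          by (simp add: exp_add[symmetric])
        finally have "q n v \<le> 2 / p * exp (- (p / 2) * v)" using q_bound[OF True, of n] by linarith
        then have "ennreal (q n v) \<le> ennreal (2 / p) * ennreal (exp (- (p / 2) * v))"
          using p by (simp add: ennreal_mult[symmetric] ennreal_leI)
        then show ?thesis by (simp add: mult.assoc[symmetric] mult_right_mono)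
      qed (simp add: zero)
    qed
    show "AE v in lborel. (\<lambda>n. ennreal (q n v) * \<gamma> v) \<longlonglongrightarrow> ennreal (exp (- p * v)) * (ennreal v * \<gamma> v)"
      using gfin
    proof eventually_elim
        case (elim v)
        have "(\<lambda>n. ennreal (q n v) * \<gamma> v) \<longlonglongrightarrow> ennreal (exp (- p * v) * v) * \<gamma> v"
          using elim by (intro tendsto_mult_ennreal tendsto_ennrealI q_lim tendsto_const) auto
        then show ?case by (simp add: ennreal_mult' mult.assoc)
      qed
  qed measurable
  moreover have "(\<lambda>n. ennreal ((exp (- (p powr \<alpha>)) - exp (- ((p + h n) powr \<alpha>))) / h n)) \<longlonglongrightarrow>
    ennreal (\<alpha> * p powr (\<alpha> - 1) * exp (- (p powr \<alpha>)))"
  proof (rule tendsto_ennrealI)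
    have "((\<lambda>x. exp (- (x powr \<alpha>))) has_real_derivative (exp (- (p powr \<alpha>)) * (- (\<alpha> * p powr (\<alpha> - 1))))) (at p)"
      using p by (auto intro!: derivative_eq_intros simp: powr_diff)
    then have "((\<lambda>y. (exp (- ((p + y) powr \<alpha>)) - exp (- (p powr \<alpha>))) / y) \<longlongrightarrow> exp (- (p powr \<alpha>)) * (- (\<alpha> * p powr (\<alpha> - 1)))) (at 0)"
      unfolding DERIV_def .
    then have "((\<lambda>y. (exp (- ((p + y) powr \<alpha>)) - exp (- (p powr \<alpha>))) / y) \<longlongrightarrow> exp (- (p powr \<alpha>)) * (- (\<alpha> * p powr (\<alpha> - 1)))) (at_right 0)"
      by (rule tendsto_mono[rotated]) (rule at_le, simp)
    from tendsto_minus[OF filterlim_compose[OF this h0]]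
    show "(\<lambda>n. (exp (- (p powr \<alpha>)) - exp (- ((p + h n) powr \<alpha>))) / h n) \<longlonglongrightarrow> \<alpha> * p powr (\<alpha> - 1) * exp (- (p powr \<alpha>))"
      by (simp add: minus_divide_left mult_ac)
  qed
  ultimately show ?thesis
    unfolding int_q by (rule LIMSEQ_unique)
qed

text \<open>In Laplace variables both sides are \<open>\<alpha> p\<^sup>-\<^sup>1 exp (- p\<^sup>\<alpha>)\<close>.\<close>

lemma subordinator_convolution_identity:
  fixes \<gamma> :: "real \<Rightarrow> ennreal" and \<alpha> :: real
  assumes [measurable]: "\<gamma> \<in> borel_measurable borel"
    and zero: "\<And>v. v \<le> 0 \<Longrightarrow> \<gamma> v = 0"
    and L: "\<And>r. 0 \<le> r \<Longrightarrow> (\<integral>\<^sup>+ v. ennreal (exp (- r * v)) * \<gamma> v \<partial>lborel) = ennreal (exp (- (r powr \<alpha>)))"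
    and \<alpha>: "0 < \<alpha>"
  shows "AE l in lborel. 0 < l \<longrightarrow>
    (\<integral>\<^sup>+ v. ennreal (g_kernel \<alpha> (l - v)) * indicator {0<..} (l - v) * (ennreal v * \<gamma> v) \<partial>lborel)
    = ennreal \<alpha> * (\<integral>\<^sup>+ v. indicator {0<..} (l - v) * \<gamma> v \<partial>lborel)"
proof -
  let ?A = "\<lambda>l. \<integral>\<^sup>+ v. ennreal (g_kernel \<alpha> (l - v)) * indicator {0<..} (l - v) * (ennreal v * \<gamma> v) \<partial>lborel"
  let ?B = "\<lambda>l. \<integral>\<^sup>+ v. ennreal \<alpha> * indicator {0<..} (l - v) * \<gamma> v \<partial>lborel"
  \<comment> \<open>A convolution of functions supported in the half-line vanishes for l \<le> 0, so
    its transform may be taken over the whole line.\<close>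
  have pos: "(\<integral>\<^sup>+ l\<in>{0<..}. ennreal (exp (- p * l)) * (\<integral>\<^sup>+ v. k (l - v) * b v \<partial>lborel) \<partial>lborel)
    = (\<integral>\<^sup>+ l. ennreal (exp (- p * l)) * (\<integral>\<^sup>+ v. k (l - v) * b v \<partial>lborel) \<partial>lborel)"
    if "\<And>v. v \<le> 0 \<Longrightarrow> k v = 0" "\<And>v. v \<le> 0 \<Longrightarrow> b v = 0" for p and k b :: "real \<Rightarrow> ennreal"
  proof (intro nn_integral_cong)
    fix l :: real
    have "k (l - v) * b v = 0" if "l \<le> 0" for v
      using \<open>\<And>v. v \<le> 0 \<Longrightarrow> k v = 0\<close>[of "l - v"] \<open>\<And>v. v \<le> 0 \<Longrightarrow> b v = 0\<close>[of v] that by (cases "v \<le> 0") auto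
    then have "(\<integral>\<^sup>+ v. k (l - v) * b v \<partial>lborel) = 0" if "l \<le> 0"
      using that by (simp only: nn_integral_const mult_zero_left)
    then show "ennreal (exp (- p * l)) * (\<integral>\<^sup>+ v. k (l - v) * b v \<partial>lborel) * indicator {0<..} l
      = ennreal (exp (- p * l)) * (\<integral>\<^sup>+ v. k (l - v) * b v \<partial>lborel)"
      by (cases "0 < l") auto
  qed
  have LA: "(\<integral>\<^sup>+ l\<in>{0<..}. ennreal (exp (- p * l)) * ?A l \<partial>lborel) = ennreal (\<alpha> / p * exp (- (p powr \<alpha>)))"
    if p: "0 < p" for p
  proof -
    let ?k = "\<lambda>u. ennreal (g_kernel \<alpha> u) * indicator {0<..} u" and ?b = "\<lambda>v. ennreal v * \<gamma> v"
    have mk: "?k \<in> borel_measurable borel" and mb: "?b \<in> borel_measurable borel"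
      by measurable
    have k0: "?k v = 0" and b0: "?b v = 0" if "v \<le> 0" for v
      using that by (auto simp: zero)
    have "(\<integral>\<^sup>+ l\<in>{0<..}. ennreal (exp (- p * l)) * ?A l \<partial>lborel)
      = ennreal (p powr (- \<alpha>)) * ennreal (\<alpha> * p powr (\<alpha> - 1) * exp (- (p powr \<alpha>)))"
      by (subst pos[OF k0 b0])
         (simp_all only: nn_integral_Laplace_convolution[OF mk mb]
            nn_integral_Laplace_g_kernel[OF \<alpha> p] nn_integral_Laplace_derivative[OF assms(1) zero L \<alpha> p])
    also have "\<dots> = ennreal (\<alpha> / p * exp (- (p powr \<alpha>)))"
      using p \<alpha> by (simp add: ennreal_mult[symmetric] powr_diff powr_minus field_simps)
    finally show ?thesis .
  qed
  have LB: "(\<integral>\<^sup>+ l\<in>{0<..}. ennreal (exp (- p * l)) * ?B l \<partial>lborel) = ennreal (\<alpha> / p * exp (- (p powr \<alpha>)))"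
    if p: "0 < p" for p
  proof -
    have "(\<integral>\<^sup>+ u. ennreal (exp (- p * u)) * indicator {0<..} u \<partial>lborel) = ennreal (1 / p)"
    proof -
      have "(\<integral>\<^sup>+ u. ennreal (exp (- p * u)) * (ennreal (g_kernel 1 u) * indicator {0<..} u) \<partial>lborel)
         = (\<integral>\<^sup>+ u. ennreal (exp (- p * u)) * indicator {0<..} u \<partial>lborel)"
        by (intro nn_integral_cong) (auto simp: g_kernel_def split: split_indicator)
      then show ?thesis using nn_integral_Laplace_g_kernel[of 1 p] p by (simp add: powr_minus inverse_eq_divide)
    qed
    then have "(\<integral>\<^sup>+ u. ennreal (exp (- p * u)) * (ennreal \<alpha> * indicator {0<..} u) \<partial>lborel) = ennreal (\<alpha> / p)"
      using p \<alpha> by (simp add: mult.left_commute[of _ "ennreal \<alpha>"] nn_integral_cmult ennreal_mult[symmetric])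
    then show ?thesis
      using nn_integral_Laplace_convolution[of "\<lambda>u. ennreal \<alpha> * indicator {0<..} u" \<gamma> p] p \<alpha>
      by (subst pos[of "\<lambda>u. ennreal \<alpha> * indicator {0<..} u" \<gamma> p])
         (auto simp: zero L[of p, simplified] ennreal_mult[symmetric])
  qed
  have "AE l in lborel. 0 < l \<longrightarrow> ?A l = ?B l"
  proof (rule Laplace_nn_integral_unique)
    show "(\<integral>\<^sup>+ x\<in>{0<..}. ennreal (exp (- real n * x)) * ?A x \<partial>lborel)
        = (\<integral>\<^sup>+ x\<in>{0<..}. ennreal (exp (- real n * x)) * ?B x \<partial>lborel)" if "1 \<le> n" for n
      using LA[of "real n"] LB[of "real n"] that by simp
    show "(\<integral>\<^sup>+ x\<in>{0<..}. ennreal (exp (- x)) * ?A x \<partial>lborel) < \<infinity>"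
      using LA[of 1] by simp
  qed measurable
  moreover have "?B l = ennreal \<alpha> * (\<integral>\<^sup>+ v. indicator {0<..} (l - v) * \<gamma> v \<partial>lborel)" for l
    by (subst nn_integral_cmult[symmetric]) (auto simp: mult.assoc)
  ultimately show ?thesis by simp
qed

subsection \<open>Positivity of cosine transforms\<close>

lemma integral_iexp_gaussian_real:
  fixes s t :: real
  assumes s: "0 < s"
  shows "(\<integral>u. iexp (t * u) * complex_of_real (exp (- (s * u)\<^sup>2 / 2)) \<partial>lborel)
    = complex_of_real (sqrt (2 * pi) / s * exp (- (t / s)\<^sup>2 / 2))"
    and "integrable lborel (\<lambda>u. exp (- (s * u)\<^sup>2 / 2))"
proof -
  have "complex_of_real (exp (- (t / s)\<^sup>2 / 2)) = (\<integral>u. iexp (t / s * u) \<partial>std_normal_distribution)"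
    using fun_cong[OF char_std_normal_distribution, of "t / s"] unfolding char_def by (rule sym)
  also have "\<dots> = (\<integral>u. std_normal_density u *\<^sub>R iexp (t / s * u) \<partial>lborel)"
    by (subst integral_density) (auto simp: normal_density_nonneg)
  also have "\<dots> = \<bar>s\<bar> *\<^sub>R (\<integral>u. std_normal_density (0 + s * u) *\<^sub>R iexp (t / s * (0 + s * u)) \<partial>lborel)"
    by (rule lborel_integral_real_affine) (use s in simp)
  also have "\<dots> = s *\<^sub>R (\<integral>u. (1 / sqrt (2 * pi)) *\<^sub>R (iexp (t * u) * complex_of_real (exp (- (s * u)\<^sup>2 / 2))) \<partial>lborel)"
    using s by (simp add: std_normal_density_def scaleR_conv_of_real mult_ac)
  also have "\<dots> = (s / sqrt (2 * pi)) *\<^sub>R (\<integral>u. iexp (t * u) * complex_of_real (exp (- (s * u)\<^sup>2 / 2)) \<partial>lborel)"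
    by (subst integral_scaleR_right) simp
  finally show "(\<integral>u. iexp (t * u) * complex_of_real (exp (- (s * u)\<^sup>2 / 2)) \<partial>lborel)
    = complex_of_real (sqrt (2 * pi) / s * exp (- (t / s)\<^sup>2 / 2))"
    using s by (simp add: scaleR_conv_of_real field_simps)
  have "integrable lborel (\<lambda>u. std_normal_density u)"
    using integrable_std_normal_moment[of 0] by simp
  then have "integrable lborel (\<lambda>u. std_normal_density (0 + s * u))"
    by (rule lborel_integrable_real_affine) (use s in simp)
  from integrable_mult_right[OF this, of "sqrt (2 * pi)"]
  show "integrable lborel (\<lambda>u. exp (- (s * u)\<^sup>2 / 2))"
    by (simp add: std_normal_density_def)
qed

text \<open>A regulariser usable in space and in frequency: its cosine transform is a positive
  multiple of \<open>gaussian (1 / s)\<close>, and it increases to 1 as s decreases to 0.\<close>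

definition gaussian :: "real \<Rightarrow> 'a::euclidean_space \<Rightarrow> real" where
  "gaussian s x = exp (- (s * norm x)\<^sup>2 / 2)"

lemma gaussian_measurable [measurable]: "gaussian s \<in> borel_measurable borel"
  unfolding gaussian_def by measurable

lemma gaussian_pos: "0 < gaussian s x"
  by (simp add: gaussian_def)

lemma gaussian_le_1: "gaussian s x \<le> 1"
  by (simp add: gaussian_def)

lemma gaussian_prod: "gaussian s x = (\<Prod>b\<in>Basis. exp (- (s * (x \<bullet> b))\<^sup>2 / 2))"
proof -
  have "(s * norm x)\<^sup>2 = (\<Sum>b\<in>Basis. (s * (x \<bullet> b))\<^sup>2)"
    unfolding power_mult_distrib power2_norm_eq_inner euclidean_inner[of x x]
    by (simp add: sum_distrib_left power2_eq_square)
  then have "(\<Sum>b\<in>Basis. - (s * (x \<bullet> b))\<^sup>2 / 2) = - (s * norm x)\<^sup>2 / 2"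
    by (simp add: sum_negf flip: sum_divide_distrib)
  then show ?thesis by (simp add: gaussian_def exp_sum[symmetric])
qed

lemma
  fixes x :: "'a::euclidean_space"
  assumes s: "0 < s"
  shows integrable_gaussian: "integrable lborel (gaussian s :: 'a \<Rightarrow> real)"
    and integral_cos_gaussian: "(\<integral>\<xi>. cos (x \<bullet> \<xi>) * gaussian s \<xi> \<partial>lborel)
      = (sqrt (2 * pi) / s) ^ DIM('a) * gaussian (1 / s) x"
proof -
  interpret product_sigma_finite "\<lambda>b::'a. lborel :: real measure" ..
  have D: "(lborel :: 'a measure) = distr (\<Pi>\<^sub>M b\<in>Basis. lborel) borel (\<lambda>f. \<Sum>b\<in>Basis. f b *\<^sub>R b)"
    by (rule lborel_eq)
  have coord: "(\<Sum>c\<in>Basis. f c *\<^sub>R c) \<bullet> b = f b" if "b \<in> Basis" for f and b :: 'a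
    using that by simp
  have gs: "gaussian s (\<Sum>c\<in>Basis. f c *\<^sub>R c) = (\<Prod>b\<in>Basis. exp (- (s * f b)\<^sup>2 / 2))" for f :: "'a \<Rightarrow> real"
    unfolding gaussian_prod by (intro prod.cong refl) (simp add: coord)
  have sum_meas [measurable]: "(\<lambda>f. \<Sum>b\<in>Basis. f b *\<^sub>R b) \<in> (\<Pi>\<^sub>M b\<in>Basis. lborel :: real measure) \<rightarrow>\<^sub>M (borel :: 'a measure)"
    by measurable
  have "integrable (\<Pi>\<^sub>M b\<in>(Basis::'a set). lborel) (\<lambda>f. \<Prod>b\<in>Basis. exp (- (s * f b)\<^sup>2 / 2))"
    by (rule product_integrable_prod[OF finite_Basis integral_iexp_gaussian_real(2)[OF s]])
  then show int: "integrable lborel (gaussian s :: 'a \<Rightarrow> real)"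
    by (subst D) (simp add: integrable_distr_eq gs)
  have "(\<integral>\<xi>. iexp (x \<bullet> \<xi>) * complex_of_real (gaussian s \<xi>) \<partial>lborel)
      = (\<integral>f. iexp (x \<bullet> (\<Sum>b\<in>Basis. f b *\<^sub>R b)) * complex_of_real (gaussian s (\<Sum>b\<in>Basis. f b *\<^sub>R b)) \<partial>(\<Pi>\<^sub>M b\<in>Basis. lborel))"
    by (subst D) (simp add: integral_distr)
  also have "\<dots> = (\<integral>f. (\<Prod>b\<in>Basis. iexp ((x \<bullet> b) * f b) * complex_of_real (exp (- (s * f b)\<^sup>2 / 2))) \<partial>(\<Pi>\<^sub>M b\<in>Basis. lborel))"
    unfolding gs by (simp add: inner_sum_right prod.distrib exp_sum sum_distrib_left mult_ac)
  also have "\<dots> = (\<Prod>b\<in>Basis. complex_of_real (sqrt (2 * pi) / s * exp (- ((x \<bullet> b) / s)\<^sup>2 / 2)))"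
  proof (subst product_integral_prod)
    fix b :: 'a
    show "integrable lborel (\<lambda>u. iexp ((x \<bullet> b) * u) * complex_of_real (exp (- (s * u)\<^sup>2 / 2)))"
      by (rule Bochner_Integration.integrable_bound[OF integral_iexp_gaussian_real(2)[OF s]])
         (auto simp: norm_mult)
  qed (simp_all only: integral_iexp_gaussian_real(1)[OF s] finite_Basis)
  also have "\<dots> = complex_of_real ((sqrt (2 * pi) / s) ^ DIM('a) * gaussian (1 / s) x)"
    unfolding gaussian_prod of_real_prod[symmetric] prod.distrib prod_constant by simp
  finally have *: "(\<integral>\<xi>. iexp (x \<bullet> \<xi>) * complex_of_real (gaussian s \<xi>) \<partial>lborel)
    = complex_of_real ((sqrt (2 * pi) / s) ^ DIM('a) * gaussian (1 / s) x)" .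
  have "integrable lborel (\<lambda>\<xi>. iexp (x \<bullet> \<xi>) * complex_of_real (gaussian s \<xi>))"
    by (rule Bochner_Integration.integrable_bound[OF int]) (auto simp: norm_mult)
  from integral_Re[OF this]
  show "(\<integral>\<xi>. cos (x \<bullet> \<xi>) * gaussian s \<xi> \<partial>lborel) = (sqrt (2 * pi) / s) ^ DIM('a) * gaussian (1 / s) x"
    unfolding * by (simp add: exp_Euler cos_of_real sin_of_real)
qed

text \<open>
  The class of functions \<open>\<gamma>\<close> with nonnegative cosine transform is closed under multiplication by
  \<open>cos (z \<bullet> \<xi>)\<close>, hence under multiplication by the characteristic exponential of a compound Poisson law.
\<close>

lemma cos_transform_compound_Poisson:
  fixes z :: "'b \<Rightarrow> 'a::euclidean_space" and \<gamma> :: "'a \<Rightarrow> real"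
  assumes "finite_measure m" and [measurable]: "z \<in> borel_measurable m"
    and \<gamma>: "integrable lborel \<gamma>" "\<And>\<xi>. 0 \<le> \<gamma> \<xi>"
    and pd: "\<And>x. 0 \<le> (\<integral>\<xi>. cos (x \<bullet> \<xi>) * \<gamma> \<xi> \<partial>lborel)"
  shows "0 \<le> (\<integral>\<xi>. cos (x \<bullet> \<xi>) * (exp (- (\<integral>\<omega>. 1 - cos (z \<omega> \<bullet> \<xi>) \<partial>m)) * \<gamma> \<xi>) \<partial>lborel)"
proof -
  interpret m: finite_measure m by fact
  interpret pair_sigma_finite m "lborel :: 'a measure" ..
  have [measurable]: "\<gamma> \<in> borel_measurable borel" using \<gamma>(1) by auto
  define W where "W = measure m (space m)"
  define M where "M \<xi> = (\<integral>\<omega>. cos (z \<omega> \<bullet> \<xi>) \<partial>m)" for \<xi>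
  have [measurable]: "M \<in> borel_measurable borel"
    unfolding M_def by measurable
  have int_cos: "integrable m (\<lambda>\<omega>. cos (z \<omega> \<bullet> \<xi>))" for \<xi>
    by (rule m.integrable_const_bound[of _ 1]) auto
  have M_le: "\<bar>M \<xi>\<bar> \<le> W" for \<xi>
  proof -
    have "\<bar>M \<xi>\<bar> \<le> (\<integral>\<omega>. \<bar>cos (z \<omega> \<bullet> \<xi>)\<bar> \<partial>m)" unfolding M_def by (rule integral_abs_bound)
    also have "\<dots> \<le> (\<integral>\<omega>. 1 \<partial>m)" by (intro integral_mono integrable_abs int_cos) auto
    finally show ?thesis by (simp add: W_def)
  qed
  have W: "0 \<le> W" by (simp add: W_def)
  have int_j: "integrable lborel (\<lambda>\<xi>. cos (y \<bullet> \<xi>) * (c \<xi> * \<gamma> \<xi>))"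
    if [measurable]: "c \<in> borel_measurable borel" and "\<And>\<xi>. \<bar>c \<xi>\<bar> \<le> B" for y c B
  proof (rule Bochner_Integration.integrable_bound[OF integrable_mult_right[OF \<gamma>(1), of B]])
    have "\<bar>cos (y \<bullet> \<xi>)\<bar> * (\<bar>c \<xi>\<bar> * \<gamma> \<xi>) \<le> 1 * (B * \<gamma> \<xi>)" for \<xi>
      using that(2)[of \<xi>] \<gamma>(2)[of \<xi>] by (intro mult_mono) auto
    then show "AE \<xi> in lborel. norm (cos (y \<bullet> \<xi>) * (c \<xi> * \<gamma> \<xi>)) \<le> norm (B * \<gamma> \<xi>)"
      using \<gamma>(2) that(2)[of 0] by (intro AE_I2) (auto simp: abs_mult)
  qed measurable
  have M_pow: "\<bar>M \<xi> ^ j\<bar> \<le> W ^ j" for \<xi> j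
    using M_le[of \<xi>] by (simp add: power_abs power_mono)
  have step: "0 \<le> (\<integral>\<xi>. cos (y \<bullet> \<xi>) * (M \<xi> ^ j * \<gamma> \<xi>) \<partial>lborel)" for j y
  proof (induction j arbitrary: y)
    case 0
    then show ?case using pd by simp
  next
    case (Suc j)
    let ?f = "\<lambda>\<omega> \<xi>. cos (z \<omega> \<bullet> \<xi>) * (cos (y \<bullet> \<xi>) * (M \<xi> ^ j * \<gamma> \<xi>))"
    \<comment> \<open>The product formula for cosines trades the extra factor for the shifts y + z
      and y - z; this is why the induction is over all y.\<close>
    have f_eq: "?f \<omega> \<xi> = 1/2 * (cos ((y + z \<omega>) \<bullet> \<xi>) * (M \<xi> ^ j * \<gamma> \<xi>)) + 1/2 * (cos ((y - z \<omega>) \<bullet> \<xi>) * (M \<xi> ^ j * \<gamma> \<xi>))" for \<omega> \<xi>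
      by (simp add: inner_add_left inner_diff_left cos_add cos_diff algebra_simps)
    have ij: "integrable lborel (\<lambda>\<xi>. cos (y' \<bullet> \<xi>) * (M \<xi> ^ j * \<gamma> \<xi>))" for y'
      by (rule int_j[where B="W ^ j"]) (use M_pow in auto)
    have if': "integrable lborel (?f \<omega>)" for \<omega>
      unfolding f_eq by (intro Bochner_Integration.integrable_add integrable_mult_right ij)
    have meas: "(\<lambda>(\<omega>, \<xi>). ?f \<omega> \<xi>) \<in> borel_measurable (m \<Otimes>\<^sub>M lborel)"
      by measurable
    have intp: "integrable (m \<Otimes>\<^sub>M lborel) (\<lambda>(\<omega>, \<xi>). ?f \<omega> \<xi>)"
    proof (rule Fubini_integrable[OF meas])
      show "integrable m (\<lambda>\<omega>. \<integral>\<xi>. norm (case (\<omega>, \<xi>) of (\<omega>, \<xi>) \<Rightarrow> ?f \<omega> \<xi>) \<partial>lborel)"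
      proof (rule m.integrable_const_bound[of _ "\<integral>\<xi>. \<bar>cos (y \<bullet> \<xi>) * (M \<xi> ^ j * \<gamma> \<xi>)\<bar> \<partial>lborel"])
        show "AE \<omega> in m. norm (\<integral>\<xi>. norm (case (\<omega>, \<xi>) of (\<omega>, \<xi>) \<Rightarrow> ?f \<omega> \<xi>) \<partial>lborel)
            \<le> (\<integral>\<xi>. \<bar>cos (y \<bullet> \<xi>) * (M \<xi> ^ j * \<gamma> \<xi>)\<bar> \<partial>lborel)"
        proof (rule AE_I2)
          fix \<omega>
          have "(\<integral>\<xi>. \<bar>?f \<omega> \<xi>\<bar> \<partial>lborel) \<le> (\<integral>\<xi>. \<bar>cos (y \<bullet> \<xi>) * (M \<xi> ^ j * \<gamma> \<xi>)\<bar> \<partial>lborel)"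
            by (intro integral_mono integrable_abs if' ij)
               (auto simp: abs_mult[of "cos (z \<omega> \<bullet> _)"] intro!: mult_left_le_one_le)
          then show "norm (\<integral>\<xi>. norm (case (\<omega>, \<xi>) of (\<omega>, \<xi>) \<Rightarrow> ?f \<omega> \<xi>) \<partial>lborel)
            \<le> (\<integral>\<xi>. \<bar>cos (y \<bullet> \<xi>) * (M \<xi> ^ j * \<gamma> \<xi>)\<bar> \<partial>lborel)" by simp
        qed
      qed measurable
      show "AE \<omega> in m. integrable lborel (\<lambda>\<xi>. case (\<omega>, \<xi>) of (\<omega>, \<xi>) \<Rightarrow> ?f \<omega> \<xi>)"
        using if' by simp
    qed
    have "(\<integral>\<xi>. cos (y \<bullet> \<xi>) * (M \<xi> ^ Suc j * \<gamma> \<xi>) \<partial>lborel) = (\<integral>\<xi>. (\<integral>\<omega>. ?f \<omega> \<xi> \<partial>m) \<partial>lborel)"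
      by (intro Bochner_Integration.integral_cong refl) (simp add: M_def mult_ac)
    also have "\<dots> = (\<integral>\<omega>. (\<integral>\<xi>. ?f \<omega> \<xi> \<partial>lborel) \<partial>m)"
      by (rule Fubini_integral) (use intp in simp)
    also have "\<dots> \<ge> 0"
    proof (rule Bochner_Integration.integral_nonneg)
      fix \<omega>
      show "0 \<le> (\<integral>\<xi>. ?f \<omega> \<xi> \<partial>lborel)"
        unfolding f_eq
        by (subst Bochner_Integration.integral_add) (intro integrable_mult_right ij, intro integrable_mult_right ij,
            simp only: integral_mult_right_zero, intro add_nonneg_nonneg mult_nonneg_nonneg Suc, auto)
    qed
    finally show ?case .
  qed
  \<comment> \<open>The exponential series has positive coefficients, so its partial sums in M
    inherit the sign of the transform; the bound exp W allows the limit. The constant exp (- W) is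
    restored at the end.\<close>
  let ?S = "\<lambda>n \<xi>. \<Sum>j<n. M \<xi> ^ j /\<^sub>R fact j"
  have S_le: "\<bar>?S n \<xi>\<bar> \<le> exp W" for n :: nat and \<xi>
  proof -
    have "\<bar>?S n \<xi>\<bar> \<le> (\<Sum>j<n. W ^ j /\<^sub>R fact j)"
      by (rule order_trans[OF sum_abs]) (auto intro!: sum_mono mult_left_mono simp: abs_mult M_pow)
    also have "\<dots> \<le> exp W"
      unfolding exp_def by (rule sum_le_suminf[OF summable_exp_generic]) (use W in auto)
    finally show ?thesis .
  qed
  have lim: "(\<lambda>n. \<integral>\<xi>. cos (x \<bullet> \<xi>) * (?S n \<xi> * \<gamma> \<xi>) \<partial>lborel) \<longlonglongrightarrow> (\<integral>\<xi>. cos (x \<bullet> \<xi>) * (exp (M \<xi>) * \<gamma> \<xi>) \<partial>lborel)"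
  proof (rule integral_dominated_convergence[where w="\<lambda>\<xi>. exp W * \<gamma> \<xi>"])
    show "AE \<xi> in lborel. (\<lambda>n. cos (x \<bullet> \<xi>) * (?S n \<xi> * \<gamma> \<xi>)) \<longlonglongrightarrow> cos (x \<bullet> \<xi>) * (exp (M \<xi>) * \<gamma> \<xi>)"
      using exp_converges[where 'a=real] by (intro AE_I2 tendsto_intros) (simp add: sums_def)
    show "AE \<xi> in lborel. norm (cos (x \<bullet> \<xi>) * (?S n \<xi> * \<gamma> \<xi>)) \<le> exp W * \<gamma> \<xi>" for n
    proof (rule AE_I2)
      fix \<xi>
      have "\<bar>cos (x \<bullet> \<xi>)\<bar> * (\<bar>?S n \<xi>\<bar> * \<gamma> \<xi>) \<le> 1 * (exp W * \<gamma> \<xi>)"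
        by (intro mult_mono mult_right_mono S_le \<gamma>(2) mult_nonneg_nonneg) (auto intro: \<gamma>(2))
      then show "norm (cos (x \<bullet> \<xi>) * (?S n \<xi> * \<gamma> \<xi>)) \<le> exp W * \<gamma> \<xi>"
        using \<gamma>(2)[of \<xi>] by (simp add: abs_mult)
    qed
  qed (use \<gamma>(1) in \<open>auto intro!: integrable_mult_right\<close>)
  have "0 \<le> (\<integral>\<xi>. cos (x \<bullet> \<xi>) * (?S n \<xi> * \<gamma> \<xi>) \<partial>lborel)" for n
  proof -
    have "(\<integral>\<xi>. cos (x \<bullet> \<xi>) * (?S n \<xi> * \<gamma> \<xi>) \<partial>lborel)
       = (\<integral>\<xi>. (\<Sum>j<n. inverse (fact j) * (cos (x \<bullet> \<xi>) * (M \<xi> ^ j * \<gamma> \<xi>))) \<partial>lborel)"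
      by (intro Bochner_Integration.integral_cong refl) (simp add: sum_distrib_left sum_distrib_right mult_ac)
    also have "\<dots> = (\<Sum>j<n. inverse (fact j) * (\<integral>\<xi>. cos (x \<bullet> \<xi>) * (M \<xi> ^ j * \<gamma> \<xi>) \<partial>lborel))"
    proof (subst Bochner_Integration.integral_sum)
      show "integrable lborel (\<lambda>\<xi>. inverse (fact j) * (cos (x \<bullet> \<xi>) * (M \<xi> ^ j * \<gamma> \<xi>)))" for j
        by (intro integrable_mult_right int_j[where B="W ^ j"]) (use M_pow in auto)
    qed simp
    also have "\<dots> \<ge> 0" using step by (intro sum_nonneg mult_nonneg_nonneg) auto
    finally show ?thesis .
  qed
  then have "0 \<le> (\<integral>\<xi>. cos (x \<bullet> \<xi>) * (exp (M \<xi>) * \<gamma> \<xi>) \<partial>lborel)"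
    by (intro LIMSEQ_le_const[OF lim]) auto
  moreover have WM: "(\<integral>\<omega>. 1 - cos (z \<omega> \<bullet> \<xi>) \<partial>m) = W - M \<xi>" for \<xi>
    using int_cos by (simp add: W_def M_def)
  have "(\<integral>\<xi>. cos (x \<bullet> \<xi>) * (exp (- (\<integral>\<omega>. 1 - cos (z \<omega> \<bullet> \<xi>) \<partial>m)) * \<gamma> \<xi>) \<partial>lborel)
    = exp (- W) * (\<integral>\<xi>. cos (x \<bullet> \<xi>) * (exp (M \<xi>) * \<gamma> \<xi>) \<partial>lborel)"
    unfolding WM by (subst integral_mult_right_zero[symmetric])
       (intro Bochner_Integration.integral_cong refl, simp add: exp_diff exp_minus field_simps)
  ultimately show ?thesis by simp
qed

text \<open>Substitute r / |u| for r: the measure r^(-1-\<beta>) dr is homogeneous of degree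
  -\<beta>, which is what produces the power |u|^\<beta>.\<close>

lemma nn_integral_one_minus_cos:
  fixes u \<beta> :: real
  assumes \<beta>: "0 < \<beta>"
  shows "(\<integral>\<^sup>+ r\<in>{0<..}. ennreal ((1 - cos (r * u)) * r powr (- 1 - \<beta>)) \<partial>lborel)
    = ennreal (\<bar>u\<bar> powr \<beta>) * (\<integral>\<^sup>+ r\<in>{0<..}. ennreal ((1 - cos r) * r powr (- 1 - \<beta>)) \<partial>lborel)"
proof (cases "u = 0")
  case False
  define a where "a = 1 / \<bar>u\<bar>"
  have a: "0 < a" using False by (simp add: a_def)
  have "(\<integral>\<^sup>+ r\<in>{0<..}. ennreal ((1 - cos (r * u)) * r powr (- 1 - \<beta>)) \<partial>lborel)
    = ennreal a * (\<integral>\<^sup>+ r\<in>{0<..}. ennreal ((1 - cos (a * r * u)) * (a * r) powr (- 1 - \<beta>)) \<partial>lborel)"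
    by (rule nn_integral_Ioi_mult) (use a in auto)
  also have "\<dots> = ennreal a * (\<integral>\<^sup>+ r. ennreal (a powr (- 1 - \<beta>)) * (ennreal ((1 - cos r) * r powr (- 1 - \<beta>)) * indicator {0<..} r) \<partial>lborel)"
  proof (intro arg_cong[where f="(*) _"] nn_integral_cong)
    fix r :: real
    show "ennreal ((1 - cos (a * r * u)) * (a * r) powr (- 1 - \<beta>)) * indicator {0<..} r
      = ennreal (a powr (- 1 - \<beta>)) * (ennreal ((1 - cos r) * r powr (- 1 - \<beta>)) * indicator {0<..} r)"
    proof (cases "0 < r")
      case True
      have "a * r * u = r \<or> a * r * u = - r"
        using False by (simp add: a_def abs_if)
      then have "cos (a * r * u) = cos r" by (metis cos_minus)
      moreover have "(a * r) powr (- 1 - \<beta>) = a powr (- 1 - \<beta>) * r powr (- 1 - \<beta>)"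
        using True a by (simp add: powr_mult)
      ultimately have "(1 - cos (a * r * u)) * (a * r) powr (- 1 - \<beta>)
          = a powr (- 1 - \<beta>) * ((1 - cos r) * r powr (- 1 - \<beta>))"
        by simp
      then show ?thesis using True by (simp add: ennreal_mult)
    qed simp
  qed
  also have "\<dots> = ennreal a * (ennreal (a powr (- 1 - \<beta>)) * (\<integral>\<^sup>+ r\<in>{0<..}. ennreal ((1 - cos r) * r powr (- 1 - \<beta>)) \<partial>lborel))"
    by (subst nn_integral_cmult) auto
  also have "ennreal a * (ennreal (a powr (- 1 - \<beta>)) * X) = ennreal (\<bar>u\<bar> powr \<beta>) * X" for X
  proof -
    have "a * a powr (- 1 - \<beta>) = a powr (- \<beta>)" using a by (simp add: powr_diff powr_minus field_simps)
    also have "\<dots> = \<bar>u\<bar> powr \<beta>" using False by (simp add: a_def powr_divide powr_minus field_simps)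
    finally show ?thesis using a by (simp add: mult.assoc[symmetric] ennreal_mult[symmetric])
  qed
  finally show ?thesis .
qed simp

text \<open>Convergence at 0 comes from 1 - cos r \<le> r^2 / 2 and \<beta> < 2, convergence at
  infinity from \<beta> > 0. Finiteness and positivity together allow division by this integral when
  the Levy density is normalised.\<close>

lemma nn_integral_one_minus_cos_bounds:
  fixes \<beta> :: real
  assumes \<beta>: "0 < \<beta>" "\<beta> < 2"
  shows "(\<integral>\<^sup>+ r\<in>{0<..}. ennreal ((1 - cos r) * r powr (- 1 - \<beta>)) \<partial>lborel) < \<infinity>" (is "?J < \<infinity>")
    and "0 < (\<integral>\<^sup>+ r\<in>{0<..}. ennreal ((1 - cos r) * r powr (- 1 - \<beta>)) \<partial>lborel)"
proof -
  have i1: "(\<lambda>r. r powr (1 - \<beta>)) integrable_on {0..1}"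
    by (rule integrable_on_powr_from_0) (use \<beta> in auto)
  have i2: "(\<lambda>r. r powr (- 1 - \<beta>)) integrable_on {1..}"
    by (rule has_integral_integrable[OF has_integral_powr_to_inf]) (use \<beta> in auto)
  have cos_le: "1 - cos r \<le> r\<^sup>2 / 2" for r :: real
  proof -
    have "cos r = 1 - 2 * (sin (r / 2))\<^sup>2" using cos_double_sin[of "r / 2"] by simp
    moreover have "(sin (r / 2))\<^sup>2 \<le> (r / 2)\<^sup>2"
      using power_mono[OF abs_sin_x_le_abs_x[of "r / 2"], of 2] by (simp add: power_divide)
    ultimately show ?thesis by (simp add: power_divide)
  qed
  have "?J \<le> (\<integral>\<^sup>+ r. ennreal (indicator {0..1} r * r powr (1 - \<beta>)) + ennreal 2 * ennreal (indicator {1..} r * r powr (- 1 - \<beta>)) \<partial>lborel)"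
  proof (intro nn_integral_mono)
    fix r :: real
    show "ennreal ((1 - cos r) * r powr (- 1 - \<beta>)) * indicator {0<..} r
      \<le> ennreal (indicator {0..1} r * r powr (1 - \<beta>)) + ennreal 2 * ennreal (indicator {1..} r * r powr (- 1 - \<beta>))"
    proof (cases "0 < r")
      case True
      show ?thesis
      proof (cases "r \<le> 1")
        case r1: True
        have "(1 - cos r) * r powr (- 1 - \<beta>) \<le> r\<^sup>2 * r powr (- 1 - \<beta>)"
          by (intro mult_right_mono order_trans[OF cos_le]) auto
        also have "\<dots> = r powr (1 - \<beta>)"
          using True powr_add[of r 2 "- 1 - \<beta>"] by simp
        finally have "ennreal ((1 - cos r) * r powr (- 1 - \<beta>)) \<le> ennreal (r powr (1 - \<beta>))"
          by (rule ennreal_leI)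
        then show ?thesis using True r1 by (simp add: add_increasing2)
      next
        case False
        have "(1 - cos r) * r powr (- 1 - \<beta>) \<le> 2 * r powr (- 1 - \<beta>)"
          using cos_ge_minus_one[of r] by (intro mult_right_mono) auto
        then have "ennreal ((1 - cos r) * r powr (- 1 - \<beta>)) \<le> ennreal 2 * ennreal (r powr (- 1 - \<beta>))"
          by (subst ennreal_mult[symmetric]) (simp_all add: ennreal_leI)
        then show ?thesis using True False by simp
      qed
    qed simp
  qed
  also have "\<dots> = ennreal (integral {0..1} (\<lambda>r. r powr (1 - \<beta>))) + ennreal 2 * ennreal (integral {1..} (\<lambda>r. r powr (- 1 - \<beta>)))"
    using nn_integral_has_integral_lebesgue[OF _ integrable_integral[OF i1]]
      nn_integral_has_integral_lebesgue[OF _ integrable_integral[OF i2]]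
    by (subst nn_integral_add) (auto simp: nn_integral_cmult)
  also have "\<dots> < \<infinity>" by (simp add: ennreal_mult_less_top)
  finally show "?J < \<infinity>" .
  show "0 < ?J"
  proof (rule ccontr)
    assume "\<not> 0 < ?J"
    then have "?J = 0" by simp
    then have "AE r in lborel. ennreal ((1 - cos r) * r powr (- 1 - \<beta>)) * indicator {0<..} r = 0"
      by (subst (asm) nn_integral_0_iff_AE) auto
    then have "AE r in lborel. r \<notin> {0<..<pi::real}"
    proof eventually_elim
      case (elim r)
      show ?case
      proof
        assume r: "r \<in> {0<..<pi}"
        then have "cos r < cos 0" by (intro cos_monotone_0_pi) auto
        then have "0 < (1 - cos r) * r powr (- 1 - \<beta>)" using r by (intro mult_pos_pos) auto
        then show False using elim r by simp
      qed
    qed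
    then have "emeasure lborel {0<..<pi::real} = 0"
      by (subst (asm) AE_iff_measurable[of "{0<..<pi}"]) auto
    then show False using pi_gt_zero by simp
  qed
qed

subsection \<open>The Green function of the stable process\<close>

text \<open>The substitution u = v^(1/\<beta>) turns the half-line integral into a Gamma integral,
  here the Laplace transform of \<open>g_kernel (1 / \<beta>)\<close> at a.\<close>

lemma nn_integral_exp_minus_powr_finite:
  fixes a \<beta> :: real
  assumes a: "0 < a" and \<beta>: "0 < \<beta>"
  shows "(\<integral>\<^sup>+ u. ennreal (exp (- a * \<bar>u\<bar> powr \<beta>)) \<partial>lborel) < \<infinity>"
proof -
  let ?f = "\<lambda>u. ennreal (exp (- a * \<bar>u\<bar> powr \<beta>))"
  have half: "(\<integral>\<^sup>+ u\<in>{0<..}. ?f u \<partial>lborel) < \<infinity>"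
  proof -
    have G: "0 < Gamma (1 / \<beta>)" using \<beta> by (intro Gamma_real_pos) auto
    then have G0: "Gamma (1 / \<beta>) \<noteq> 0" by simp
    have "(\<integral>\<^sup>+ u\<in>{0<..}. ?f u \<partial>lborel)
      = (\<integral>\<^sup>+ v\<in>{0<..}. ?f (v powr (1 / \<beta>)) * ennreal (\<bar>1 / \<beta>\<bar> * v powr (1 / \<beta> - 1)) \<partial>lborel)"
      by (rule nn_integral_Ioi_powr) (use \<beta> in auto)
    also have "\<dots> = (\<integral>\<^sup>+ v. ennreal (Gamma (1 / \<beta>) / \<beta>) * (ennreal (exp (- a * v)) * (ennreal (g_kernel (1 / \<beta>) v) * indicator {0<..} v)) \<partial>lborel)"
      using \<beta> G G0
      by (intro nn_integral_cong)
         (auto simp: powr_powr ennreal_mult[symmetric] g_kernel_def mult_ac split: split_indicator)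
    also have "\<dots> = ennreal (Gamma (1 / \<beta>) / \<beta>) * ennreal (a powr (- (1 / \<beta>)))"
      using nn_integral_Laplace_g_kernel[of "1 / \<beta>" a] a \<beta> by (subst nn_integral_cmult) auto
    finally show ?thesis by (simp add: ennreal_mult_less_top)
  qed
  have "(\<integral>\<^sup>+ u. ?f u \<partial>lborel) = (\<integral>\<^sup>+ u. ?f u * indicator {0<..} u + ?f (0 + (-1) * u) * indicator {0<..} (0 + (-1) * u) \<partial>lborel)"
    by (intro nn_integral_cong_AE, rule AE_mp[OF AE_lborel_singleton[of 0]]) (auto split: split_indicator)
  also have "\<dots> = (\<integral>\<^sup>+ u. ?f u * indicator {0<..} u \<partial>lborel) + (\<integral>\<^sup>+ u. ?f (0 + (-1) * u) * indicator {0<..} (0 + (-1) * u) \<partial>lborel)"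
    by (rule nn_integral_add) auto
  also have "(\<integral>\<^sup>+ u. ?f (0 + (-1) * u) * indicator {0<..} (0 + (-1) * u) \<partial>lborel) = (\<integral>\<^sup>+ u. ?f u * indicator {0<..} u \<partial>lborel)"
    using nn_integral_real_affine[of "\<lambda>u. ?f u * indicator {0<..} u" "-1" 0] by simp
  finally show ?thesis using half by simp
qed

text \<open>Since |\<xi>| dominates every coordinate, a |\<xi>|^\<beta> is at least the sum over b
  of (a/d) |\<xi> \<bullet> b|^\<beta>; the integral is thus bounded by a product of one-dimensional
  ones, without polar coordinates.\<close>

lemma integrable_exp_minus_norm_powr:
  fixes a \<beta> :: real
  assumes a: "0 < a" and \<beta>: "0 < \<beta>"
  shows "integrable lborel (\<lambda>\<xi>::'a::euclidean_space. exp (- a * norm \<xi> powr \<beta>))"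
proof (rule integrableI_bounded)
  define a' where "a' = a / DIM('a)"
  have a': "0 < a'" using a by (simp add: a'_def)
  have le: "exp (- a * norm \<xi> powr \<beta>) \<le> (\<Prod>b\<in>Basis. exp (- a' * \<bar>\<xi> \<bullet> b\<bar> powr \<beta>))" for \<xi> :: 'a
  proof -
    have "(\<Sum>b\<in>Basis. a' * \<bar>\<xi> \<bullet> b\<bar> powr \<beta>) \<le> (\<Sum>b\<in>(Basis::'a set). a' * norm \<xi> powr \<beta>)"
      using a' \<beta> by (intro sum_mono mult_left_mono powr_mono2) (auto simp: Basis_le_norm)
    also have "\<dots> = a * norm \<xi> powr \<beta>" by (simp add: a'_def)
    finally show ?thesis by (simp add: exp_sum[symmetric] sum_negf)
  qed
  have "(\<integral>\<^sup>+ \<xi>. ennreal (norm (exp (- a * norm \<xi> powr \<beta>))) \<partial>(lborel :: 'a measure))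
    \<le> (\<integral>\<^sup>+ \<xi>. ennreal (\<Prod>b\<in>Basis. exp (- a' * \<bar>\<xi> \<bullet> b\<bar> powr \<beta>)) \<partial>(lborel :: 'a measure))"
    using le by (intro nn_integral_mono ennreal_leI) auto
  also have "\<dots> = (\<integral>\<^sup>+ \<xi>. (\<Prod>b\<in>Basis. ennreal (exp (- a' * \<bar>\<xi> \<bullet> b\<bar> powr \<beta>))) \<partial>(lborel :: 'a measure))"
    by (simp add: prod_ennreal)
  also have "\<dots> = (\<Prod>b\<in>(Basis::'a set). (\<integral>\<^sup>+ u. ennreal (exp (- a' * \<bar>u\<bar> powr \<beta>)) \<partial>lborel))"
    by (subst nn_integral_lborel_prod) auto
  also have "\<dots> < \<infinity>"
    using nn_integral_exp_minus_powr_finite[OF a' \<beta>] by (simp add: power_less_top_ennreal)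
  finally show "(\<integral>\<^sup>+ \<xi>. ennreal (norm (exp (- a * norm \<xi> powr \<beta>))) \<partial>(lborel :: 'a measure)) < \<infinity>" .
qed measurable

locale stable_symbol =
  fixes \<beta> :: real and \<nu> :: "'a::euclidean_space measure"
  assumes \<beta>: "0 < \<beta>" "\<beta> < 2" and adm: "admissible_spectral_measure \<beta> \<nu>"
begin

abbreviation "\<psi> \<equiv> psi \<beta> \<nu>"
abbreviation "G \<equiv> G_kernel \<beta> \<nu>"

sublocale \<nu>: finite_measure \<nu>
  using adm by (simp add: admissible_spectral_measure_def)

lemma sets_\<nu> [measurable_cong]: "sets \<nu> = sets (restrict_space borel (sphere 0 1))"
  and space_\<nu>: "space \<nu> = sphere 0 1"
proof -
  obtain h :: "'a \<Rightarrow> real" where "\<nu> = density sphere_measure (\<lambda>\<eta>. ennreal (h \<eta>))"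
    using adm unfolding admissible_spectral_measure_def by blast
  then show "sets \<nu> = sets (restrict_space borel (sphere 0 1))"
    by (simp add: sphere_measure_def)
  then show "space \<nu> = sphere 0 1"
    by (auto dest: sets_eq_imp_space_eq simp: space_restrict_space)
qed

text \<open>\<nu> carries the trace \<sigma>-algebra of the sphere, while the integrands are
  functions on the ambient space; this inclusion makes them measurable.\<close>

lemma id_\<nu>: "(\<lambda>\<eta>. \<eta>) \<in> \<nu> \<rightarrow>\<^sub>M borel"
  by (subst measurable_cong_sets[OF sets_\<nu> refl]) (simp add: measurable_restrict_space1)

lemma abs_inner_\<nu>_le: "\<eta> \<in> space \<nu> \<Longrightarrow> \<bar>\<xi> \<bullet> \<eta>\<bar> \<le> norm \<xi>"
  using Cauchy_Schwarz_ineq2[of \<xi> \<eta>] by (simp add: space_\<nu>)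

lemma integrable_inner_powr: "integrable \<nu> (\<lambda>\<eta>. \<bar>\<xi> \<bullet> \<eta>\<bar> powr \<beta>)"
  by (rule \<nu>.integrable_const_bound[of _ "norm \<xi> powr \<beta>"])
     (use \<beta> id_\<nu>[measurable] in \<open>auto intro!: AE_I2 powr_mono2 abs_inner_\<nu>_le\<close>)

text \<open>Homogeneity absorbs |\<xi>|^\<beta> into the integrand. With the division by the norm
  gone, the origin is no exception, and continuity and scaling can be read off.\<close>

lemma psi_eq: "\<psi> \<xi> = (\<integral>\<eta>. \<bar>\<xi> \<bullet> \<eta>\<bar> powr \<beta> \<partial>\<nu>)"
proof (cases "\<xi> = 0")
  case False
  have "norm \<xi> powr \<beta> * \<bar>sgn \<xi> \<bullet> \<eta>\<bar> powr \<beta> = \<bar>\<xi> \<bullet> \<eta>\<bar> powr \<beta>" for \<eta>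
    using False by (simp add: powr_mult[symmetric] sgn_div_norm abs_mult mult.assoc[symmetric])
  then show ?thesis by (simp add: psi_def omega_def flip: integral_mult_right_zero)
qed (simp add: psi_def)

lemma psi_nonneg: "0 \<le> \<psi> \<xi>"
  unfolding psi_eq by simp

lemma psi_measurable [measurable]: "\<psi> \<in> borel_measurable borel"
proof -
  note id_\<nu>[measurable]
  show ?thesis unfolding psi_eq[abs_def] by measurable
qed

lemma psi_scaleR: "0 \<le> c \<Longrightarrow> \<psi> (c *\<^sub>R \<xi>) = c powr \<beta> * \<psi> \<xi>"
  unfolding psi_eq by (simp add: abs_mult powr_mult)

lemma psi_continuous: "continuous_on UNIV \<psi>"
proof (unfold continuous_on_sequentially, safe, unfold comp_def)
  note id_\<nu>[measurable]
  fix X :: "nat \<Rightarrow> 'a" and x assume X: "X \<longlonglongrightarrow> x"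
  then obtain K where K: "\<And>n. norm (X n) \<le> K"
    using convergent_imp_Bseq[of X] unfolding Bseq_def convergent_def by blast
  show "(\<lambda>n. \<psi> (X n)) \<longlonglongrightarrow> \<psi> x"
    unfolding psi_eq
  proof (rule integral_dominated_convergence[where w="\<lambda>_. K powr \<beta>"])
    show "AE \<eta> in \<nu>. (\<lambda>n. \<bar>X n \<bullet> \<eta>\<bar> powr \<beta>) \<longlonglongrightarrow> \<bar>x \<bullet> \<eta>\<bar> powr \<beta>"
      using \<beta> by (intro AE_I2 tendsto_powr' tendsto_intros X) auto
    show "AE \<eta> in \<nu>. norm (\<bar>X n \<bullet> \<eta>\<bar> powr \<beta>) \<le> K powr \<beta>" for n
      using \<beta> by (auto intro!: AE_I2 powr_mono2 order_trans[OF abs_inner_\<nu>_le K])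
  qed auto
qed

text \<open>The constant is the minimum of \<psi> over the compact unit sphere, positive because
  \<omega> is; homogeneity extends the bound to all \<xi>. It is the source of the integrability of
  exp (- t \<psi>).\<close>

lemma psi_lower_bound:
  obtains c where "0 < c" "\<And>\<xi>. c * norm \<xi> powr \<beta> \<le> \<psi> \<xi>"
proof -
  obtain b :: 'a where b: "b \<in> Basis" using nonempty_Basis by blast
  have "compact (sphere (0::'a) 1)" by simp
  moreover have "sphere (0::'a) 1 \<noteq> {}" using b by (auto simp: sphere_def intro!: exI[of _ b])
  moreover have "continuous_on (sphere 0 1) \<psi>"
    using psi_continuous by (rule continuous_on_subset) simp
  ultimately obtain \<theta> where \<theta>: "\<theta> \<in> sphere 0 1" "\<And>x. x \<in> sphere 0 1 \<Longrightarrow> \<psi> \<theta> \<le> \<psi> x"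
    by (metis continuous_attains_inf)
  have "\<psi> \<theta> = omega \<beta> \<nu> \<theta>" using \<theta>(1) by (simp add: psi_def sgn_div_norm)
  then have pos: "0 < \<psi> \<theta>"
    using adm \<theta>(1) by (simp add: admissible_spectral_measure_def)
  have "\<psi> \<theta> * norm \<xi> powr \<beta> \<le> \<psi> \<xi>" for \<xi>
  proof (cases "\<xi> = 0")
    case False
    have "\<psi> \<xi> = norm \<xi> powr \<beta> * \<psi> (sgn \<xi>)"
      using psi_scaleR[of "norm \<xi>" "sgn \<xi>"] False by (simp add: sgn_div_norm)
    moreover have "\<psi> \<theta> \<le> \<psi> (sgn \<xi>)" using False by (intro \<theta>) (simp add: norm_sgn)
    ultimately show ?thesis by (metis mult.commute mult_left_mono powr_ge_zero)
  qed (simp add: psi_def)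
  with pos that show thesis by blast
qed

lemma integrable_exp_psi: "0 < t \<Longrightarrow> integrable lborel (\<lambda>\<xi>. exp (- t * \<psi> \<xi>))"
proof -
  assume t: "0 < t"
  obtain c where c: "0 < c" "\<And>\<xi>. c * norm \<xi> powr \<beta> \<le> \<psi> \<xi>" by (rule psi_lower_bound) blast
  show ?thesis
  proof (rule Bochner_Integration.integrable_bound)
    show "integrable lborel (\<lambda>\<xi>::'a. exp (- (t * c) * norm \<xi> powr \<beta>))"
      by (rule integrable_exp_minus_norm_powr) (use t c \<beta> in auto)
    show "AE \<xi> in lborel. norm (exp (- t * \<psi> \<xi>)) \<le> norm (exp (- (t * c) * norm \<xi> powr \<beta>))"
      using c(2) t by (intro AE_I2) (simp add: mult.assoc mult_left_mono)
  qed measurable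
qed

lemma integrable_cos_exp_psi: "0 < t \<Longrightarrow> integrable lborel (\<lambda>\<xi>. cos (x \<bullet> \<xi>) * exp (- t * \<psi> \<xi>))"
  by (rule Bochner_Integration.integrable_bound[OF integrable_exp_psi])
     (auto simp: abs_mult intro!: AE_I2 mult_left_le_one_le)

lemma G_eq:
  assumes t: "0 < t"
  shows "G t x = (\<integral>\<xi>. cos (x \<bullet> \<xi>) * exp (- t * \<psi> \<xi>) \<partial>lborel) / (2 * pi) ^ DIM('a)"
proof -
  have "integrable lborel (\<lambda>\<xi>. exp (\<i> * complex_of_real (x \<bullet> \<xi>)) * complex_of_real (exp (- t * \<psi> \<xi>)))"
    by (rule Bochner_Integration.integrable_bound[OF integrable_exp_psi[OF t]]) (auto simp: norm_mult)
  from integral_Re[OF this] show ?thesis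
    unfolding G_kernel_def by (simp add: exp_Euler cos_of_real sin_of_real)
qed

lemma G_measurable [measurable (raw)]:
  assumes [measurable]: "f \<in> borel_measurable M" "g \<in> M \<rightarrow>\<^sub>M borel"
  shows "(\<lambda>y. G (f y) (g y)) \<in> borel_measurable M"
proof -
  have "(\<lambda>(t, x). G t x) \<in> borel_measurable (borel \<Otimes>\<^sub>M borel)"
    unfolding G_kernel_def by measurable
  from measurable_compose[OF measurable_Pair[OF assms] this] show ?thesis by simp
qed

lemma gaussian_tendsto_1: "(\<lambda>n. gaussian (inverse (real (Suc n))) x) \<longlonglongrightarrow> 1"
proof -
  have "(\<lambda>n. exp (- (inverse (real (Suc n)) * norm x)\<^sup>2 / 2)) \<longlonglongrightarrow> exp (- (0 * norm x)\<^sup>2 / 2)"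
    by (intro tendsto_intros LIMSEQ_inverse_real_of_nat) simp
  then show ?thesis by (simp add: gaussian_def)
qed

text \<open>
  \<open>|u|\<close> to the power \<open>\<beta>\<close> is a multiple of the integral of \<open>1 - cos (r u)\<close> against \<open>r\<close> to the power \<open>-1-\<beta>\<close>;
  cutting off small \<open>r\<close> leaves finite Levy measures.
\<close>

lemma psi_Levy_approximation:
  assumes t: "0 < t"
  obtains m :: "nat \<Rightarrow> (real \<times> 'a) measure"
  where "\<And>n. finite_measure (m n)" "\<And>n. (\<lambda>(r, \<eta>). r *\<^sub>R \<eta>) \<in> borel_measurable (m n)"
    "\<And>\<xi>. (\<lambda>n. \<integral>\<omega>. 1 - cos ((case \<omega> of (r, \<eta>) \<Rightarrow> r *\<^sub>R \<eta>) \<bullet> \<xi>) \<partial>m n) \<longlonglongrightarrow> t * \<psi> \<xi>"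
proof -
  note id_\<nu>[measurable]
  define J where "J = enn2real (\<integral>\<^sup>+ r\<in>{0<..}. ennreal ((1 - cos r) * r powr (- 1 - \<beta>)) \<partial>lborel)"
  have J: "(\<integral>\<^sup>+ r\<in>{0<..}. ennreal ((1 - cos r) * r powr (- 1 - \<beta>)) \<partial>lborel) = ennreal J" "0 < J"
    using nn_integral_one_minus_cos_bounds[OF \<beta>] by (auto simp: J_def enn2real_positive_iff)
  define A where "A n = {inverse (real (Suc n))<..}" for n
  \<comment> \<open>The factor t / J is chosen so that integrating 1 - cos (r (\<xi> \<bullet>
    \<eta>)) over all radii gives exactly t |\<xi> \<bullet> \<eta>|^\<beta>.\<close>
  define w where "w n r = ennreal (t / J * r powr (- 1 - \<beta>)) * indicator (A n) r" for n r
  have [measurable]: "w n \<in> borel_measurable borel" for n unfolding w_def A_def by measurable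
  define m where "m n = density (lborel \<Otimes>\<^sub>M \<nu>) (\<lambda>(r, \<eta>). w n r)" for n
  interpret pair_sigma_finite "lborel :: real measure" \<nu> ..
  have A_pos: "0 < r" if "r \<in> A n" for r n
    using that by (auto simp: A_def intro: less_trans[rotated])
  have fin: "finite_measure (m n)" for n
  proof
    let ?i = "inverse (real (Suc n))"
    have "(\<lambda>r. r powr (- 1 - \<beta>)) integrable_on {?i..}"
      by (rule has_integral_integrable[OF has_integral_powr_to_inf]) (use \<beta> in auto)
    from nn_integral_has_integral_lebesgue[OF _ integrable_integral[OF this]]
    have I: "(\<integral>\<^sup>+ r. ennreal (indicator {?i..} r * r powr (- 1 - \<beta>)) \<partial>lborel) < \<infinity>" by simp
    have "emeasure (m n) (space (m n)) = (\<integral>\<^sup>+ x. (case x of (r, \<eta>) \<Rightarrow> w n r) \<partial>(lborel \<Otimes>\<^sub>M \<nu>))"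
      unfolding m_def by (simp add: emeasure_density space_pair_measure cong: nn_integral_cong)
         (intro nn_integral_cong, auto simp: space_pair_measure)
    also have "\<dots> = (\<integral>\<^sup>+ r. w n r * emeasure \<nu> (space \<nu>) \<partial>lborel)"
      by (subst \<nu>.nn_integral_fst[symmetric]) auto
    also have "\<dots> = (\<integral>\<^sup>+ r. w n r \<partial>lborel) * emeasure \<nu> (space \<nu>)"
      by (rule nn_integral_multc) measurable
    also have "(\<integral>\<^sup>+ r. w n r \<partial>lborel) \<le> (\<integral>\<^sup>+ r. ennreal (t / J) * ennreal (indicator {?i..} r * r powr (- 1 - \<beta>)) \<partial>lborel)"
      using t J(2) by (intro nn_integral_mono) (auto simp: w_def A_def ennreal_mult[symmetric] split: split_indicator)
    also have "\<dots> = ennreal (t / J) * (\<integral>\<^sup>+ r. ennreal (indicator {?i..} r * r powr (- 1 - \<beta>)) \<partial>lborel)"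
      by (rule nn_integral_cmult) measurable
    finally show "emeasure (m n) (space (m n)) \<noteq> \<infinity>"
      using I \<nu>.emeasure_finite by (auto simp: ennreal_mult_eq_top_iff top_unique mult_right_mono)
  qed
  have zm: "(\<lambda>(r, \<eta>). r *\<^sub>R \<eta>) \<in> borel_measurable (m n)" for n
    unfolding m_def by measurable
  have lim: "(\<lambda>n. \<integral>\<omega>. 1 - cos ((case \<omega> of (r, \<eta>) \<Rightarrow> r *\<^sub>R \<eta>) \<bullet> \<xi>) \<partial>m n) \<longlonglongrightarrow> t * \<psi> \<xi>" for \<xi>
  proof -
    let ?h = "\<lambda>\<omega>::real \<times> 'a. 1 - cos ((case \<omega> of (r, \<eta>) \<Rightarrow> r *\<^sub>R \<eta>) \<bullet> \<xi>)"
    let ?F = "\<lambda>(r, \<eta>). ennreal (t / J) * ennreal ((1 - cos (r * (\<xi> \<bullet> \<eta>))) * r powr (- 1 - \<beta>))"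
    have eq: "(\<integral>\<omega>. ?h \<omega> \<partial>m n) = enn2real (\<integral>\<^sup>+ \<omega>. ?F \<omega> * indicator (A n) (fst \<omega>) \<partial>(lborel \<Otimes>\<^sub>M \<nu>))" for n
    proof -
      have "(\<integral>\<omega>. ?h \<omega> \<partial>m n) = enn2real (\<integral>\<^sup>+ \<omega>. ennreal (?h \<omega>) \<partial>m n)"
        using zm by (intro integral_eq_nn_integral) auto
      also have "(\<integral>\<^sup>+ \<omega>. ennreal (?h \<omega>) \<partial>m n) = (\<integral>\<^sup>+ \<omega>. (case \<omega> of (r, \<eta>) \<Rightarrow> w n r) * ennreal (?h \<omega>) \<partial>(lborel \<Otimes>\<^sub>M \<nu>))"
        unfolding m_def by (rule nn_integral_density) measurable
      also have "\<dots> = (\<integral>\<^sup>+ \<omega>. ?F \<omega> * indicator (A n) (fst \<omega>) \<partial>(lborel \<Otimes>\<^sub>M \<nu>))"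
        using t J(2)
        by (intro nn_integral_cong)
           (auto simp: w_def ennreal_mult[symmetric] inner_commute mult_ac split: split_indicator)
      finally show ?thesis .
    qed
    have "(\<lambda>n. \<integral>\<^sup>+ \<omega>. ?F \<omega> * indicator (A n) (fst \<omega>) \<partial>(lborel \<Otimes>\<^sub>M \<nu>))
      \<longlonglongrightarrow> (\<integral>\<^sup>+ \<omega>. ?F \<omega> * indicator {0<..} (fst \<omega>) \<partial>(lborel \<Otimes>\<^sub>M \<nu>))"
    proof (rule nn_integral_LIMSEQ)
      show "incseq (\<lambda>n \<omega>. ?F \<omega> * indicator (A n) (fst \<omega>))"
      proof (intro incseq_SucI le_funI mult_left_mono)
        fix n and \<omega> :: "real \<times> 'a"
        have "inverse (real (Suc (Suc n))) \<le> inverse (real (Suc n))" by (intro le_imp_inverse_le) auto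
        then have "fst \<omega> \<in> A n \<Longrightarrow> fst \<omega> \<in> A (Suc n)"
          unfolding A_def greaterThan_iff by (rule le_less_trans)
        then show "indicator (A n) (fst \<omega>) \<le> (indicator (A (Suc n)) (fst \<omega>) :: ennreal)"
          by (auto split: split_indicator)
      qed simp
      show "(\<lambda>\<omega>. ?F \<omega> * indicator (A n) (fst \<omega>)) \<in> borel_measurable (lborel \<Otimes>\<^sub>M \<nu>)" for n
        unfolding A_def by measurable
      show "(\<lambda>n. ?F \<omega> * indicator (A n) (fst \<omega>)) \<longlonglongrightarrow> ?F \<omega> * indicator {0<..} (fst \<omega>)" for \<omega>
      proof (rule tendsto_eventually)
        show "\<forall>\<^sub>F n in sequentially. ?F \<omega> * indicator (A n) (fst \<omega>) = ?F \<omega> * indicator {0<..} (fst \<omega>)"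
        proof (cases "0 < fst \<omega>")
          case True
          then have "\<forall>\<^sub>F n in sequentially. inverse (real (Suc n)) < fst \<omega>"
            using LIMSEQ_inverse_real_of_nat by (rule order_tendstoD(2)[rotated])
          then show ?thesis by eventually_elim (use True in \<open>auto simp: A_def\<close>)
        next
          case False
          then have "fst \<omega> \<notin> A n" for n using A_pos by blast
          then show ?thesis using False by simp
        qed
      qed
    qed
    moreover have "(\<integral>\<^sup>+ \<omega>. ?F \<omega> * indicator {0<..} (fst \<omega>) \<partial>(lborel \<Otimes>\<^sub>M \<nu>)) = ennreal (t * \<psi> \<xi>)"
    proof -
      have "(\<integral>\<^sup>+ \<omega>. ?F \<omega> * indicator {0<..} (fst \<omega>) \<partial>(lborel \<Otimes>\<^sub>M \<nu>))
        = (\<integral>\<^sup>+ \<eta>. (\<integral>\<^sup>+ r. ?F (r, \<eta>) * indicator {0<..} r \<partial>lborel) \<partial>\<nu>)"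
        by (subst nn_integral_snd[symmetric]) auto
      also have "\<dots> = (\<integral>\<^sup>+ \<eta>. ennreal (t * \<bar>\<xi> \<bullet> \<eta>\<bar> powr \<beta>) \<partial>\<nu>)"
      proof (intro nn_integral_cong)
        fix \<eta>
        have "(\<integral>\<^sup>+ r. ?F (r, \<eta>) * indicator {0<..} r \<partial>lborel)
          = ennreal (t / J) * (\<integral>\<^sup>+ r\<in>{0<..}. ennreal ((1 - cos (r * (\<xi> \<bullet> \<eta>))) * r powr (- 1 - \<beta>)) \<partial>lborel)"
          by (subst nn_integral_cmult[symmetric]) (auto simp: mult.assoc)
        also have "\<dots> = ennreal (t / J) * (ennreal (\<bar>\<xi> \<bullet> \<eta>\<bar> powr \<beta>) * ennreal J)"
          by (subst nn_integral_one_minus_cos) (simp_all only: \<beta> J)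
        also have "\<dots> = ennreal (t * \<bar>\<xi> \<bullet> \<eta>\<bar> powr \<beta>)"
          using t J(2) by (simp add: ennreal_mult[symmetric])
        finally show "(\<integral>\<^sup>+ r. ?F (r, \<eta>) * indicator {0<..} r \<partial>lborel) = ennreal (t * \<bar>\<xi> \<bullet> \<eta>\<bar> powr \<beta>)" .
      qed
      also have "\<dots> = ennreal (\<integral>\<eta>. t * \<bar>\<xi> \<bullet> \<eta>\<bar> powr \<beta> \<partial>\<nu>)"
        using t by (intro nn_integral_eq_integral integrable_mult_right integrable_inner_powr) auto
      finally show ?thesis by (simp add: psi_eq)
    qed
    ultimately have "(\<lambda>n. \<integral>\<^sup>+ \<omega>. ?F \<omega> * indicator (A n) (fst \<omega>) \<partial>(lborel \<Otimes>\<^sub>M \<nu>)) \<longlonglongrightarrow> ennreal (t * \<psi> \<xi>)"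
      by simp
    from tendsto_enn2real[OF this] show ?thesis
      unfolding eq using t psi_nonneg[of \<xi>] by simp
  qed
  show thesis by (rule that[of m]) (fact fin zm lim)+
qed

text \<open>Each compound Poisson exponent \<open>L n\<close> is bounded, so exp (- L n) does not
  decay and has no cosine transform of its own. A Gaussian factor supplies integrability while n
  tends to infinity. The limit exp (- t \<psi>) is integrable by itself, so the factor can be
  removed afterwards by letting its parameter tend to 0.\<close>

lemma G_nonneg:
  assumes t: "0 < t"
  shows "0 \<le> G t x"
proof -
  obtain m :: "nat \<Rightarrow> (real \<times> 'a) measure" where m: "\<And>n. finite_measure (m n)"
      "\<And>n. (\<lambda>(r, \<eta>). r *\<^sub>R \<eta>) \<in> borel_measurable (m n)"
    and lim: "\<And>\<xi>. (\<lambda>n. \<integral>\<omega>. 1 - cos ((case \<omega> of (r, \<eta>) \<Rightarrow> r *\<^sub>R \<eta>) \<bullet> \<xi>) \<partial>m n) \<longlonglongrightarrow> t * \<psi> \<xi>"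
    using psi_Levy_approximation[OF t] by blast
  define L where "L n \<xi> = (\<integral>\<omega>. 1 - cos ((case \<omega> of (r, \<eta>) \<Rightarrow> r *\<^sub>R \<eta>) \<bullet> \<xi>) \<partial>m n)" for n and \<xi> :: 'a
  have L_meas [measurable]: "L n \<in> borel_measurable borel" for n
  proof -
    interpret finite_measure "m n" by (rule m)
    note m(2)[measurable]
    show ?thesis unfolding L_def by measurable
  qed
  have L0: "0 \<le> L n \<xi>" for n \<xi> unfolding L_def by (intro Bochner_Integration.integral_nonneg) simp
  have pos_s: "0 \<le> (\<integral>\<xi>. cos (x \<bullet> \<xi>) * (exp (- t * \<psi> \<xi>) * gaussian s \<xi>) \<partial>lborel)" if s: "0 < s" for s
  proof (rule LIMSEQ_le_const)
    show "(\<lambda>n. \<integral>\<xi>. cos (x \<bullet> \<xi>) * (exp (- L n \<xi>) * gaussian s \<xi>) \<partial>lborel)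
       \<longlonglongrightarrow> (\<integral>\<xi>. cos (x \<bullet> \<xi>) * (exp (- t * \<psi> \<xi>) * gaussian s \<xi>) \<partial>lborel)"
    proof (rule integral_dominated_convergence[where w="gaussian s"])
      show "AE \<xi> in lborel. (\<lambda>n. cos (x \<bullet> \<xi>) * (exp (- L n \<xi>) * gaussian s \<xi>)) \<longlonglongrightarrow> cos (x \<bullet> \<xi>) * (exp (- t * \<psi> \<xi>) * gaussian s \<xi>)"
        using lim unfolding L_def[symmetric] by (auto intro!: AE_I2 tendsto_eq_intros)
      show "AE \<xi> in lborel. norm (cos (x \<bullet> \<xi>) * (exp (- L n \<xi>) * gaussian s \<xi>)) \<le> gaussian s \<xi>" for n
      proof (rule AE_I2)
        fix \<xi>
        have "\<bar>cos (x \<bullet> \<xi>)\<bar> * (exp (- L n \<xi>) * gaussian s \<xi>) \<le> 1 * (1 * gaussian s \<xi>)"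
          using L0[of n \<xi>] gaussian_pos[of s \<xi>] by (intro mult_mono) auto
        then show "norm (cos (x \<bullet> \<xi>) * (exp (- L n \<xi>) * gaussian s \<xi>)) \<le> gaussian s \<xi>"
          using gaussian_pos[of s \<xi>] by (simp add: abs_mult)
      qed
    qed (use integrable_gaussian[OF s] in auto)
    show "\<exists>N. \<forall>n\<ge>N. 0 \<le> (\<integral>\<xi>. cos (x \<bullet> \<xi>) * (exp (- L n \<xi>) * gaussian s \<xi>) \<partial>lborel)"
    proof (intro exI allI impI)
      fix n
      show "0 \<le> (\<integral>\<xi>. cos (x \<bullet> \<xi>) * (exp (- L n \<xi>) * gaussian s \<xi>) \<partial>lborel)"
        unfolding L_def
        by (rule cos_transform_compound_Poisson[OF m])
           (auto simp: integrable_gaussian s integral_cos_gaussian gaussian_pos less_imp_le)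
    qed
  qed
  have "0 \<le> (\<integral>\<xi>. cos (x \<bullet> \<xi>) * exp (- t * \<psi> \<xi>) \<partial>lborel)"
  proof (rule LIMSEQ_le_const)
    let ?s = "\<lambda>n. inverse (real (Suc n))"
    show "(\<lambda>n. \<integral>\<xi>. cos (x \<bullet> \<xi>) * (exp (- t * \<psi> \<xi>) * gaussian (?s n) \<xi>) \<partial>lborel)
       \<longlonglongrightarrow> (\<integral>\<xi>. cos (x \<bullet> \<xi>) * exp (- t * \<psi> \<xi>) \<partial>lborel)"
    proof (rule integral_dominated_convergence[where w="\<lambda>\<xi>. exp (- t * \<psi> \<xi>)"])
      show "AE \<xi> in lborel. (\<lambda>n. cos (x \<bullet> \<xi>) * (exp (- t * \<psi> \<xi>) * gaussian (?s n) \<xi>)) \<longlonglongrightarrow> cos (x \<bullet> \<xi>) * exp (- t * \<psi> \<xi>)"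
        by (auto intro!: AE_I2 tendsto_eq_intros gaussian_tendsto_1 simp del: of_nat_Suc)
      show "AE \<xi> in lborel. norm (cos (x \<bullet> \<xi>) * (exp (- t * \<psi> \<xi>) * gaussian (?s n) \<xi>)) \<le> exp (- t * \<psi> \<xi>)" for n
      proof (rule AE_I2)
        fix \<xi>
        have "\<bar>cos (x \<bullet> \<xi>)\<bar> * (exp (- t * \<psi> \<xi>) * gaussian (?s n) \<xi>) \<le> 1 * (exp (- t * \<psi> \<xi>) * 1)"
          using gaussian_le_1[of "?s n" \<xi>] gaussian_pos[of "?s n" \<xi>] by (intro mult_mono) auto
        then show "norm (cos (x \<bullet> \<xi>) * (exp (- t * \<psi> \<xi>) * gaussian (?s n) \<xi>)) \<le> exp (- t * \<psi> \<xi>)"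
          using gaussian_pos[of "?s n" \<xi>] by (simp add: abs_mult)
      qed
    qed (use integrable_exp_psi[OF t] in auto)
    show "\<exists>N. \<forall>n\<ge>N. 0 \<le> (\<integral>\<xi>. cos (x \<bullet> \<xi>) * (exp (- t * \<psi> \<xi>) * gaussian (?s n) \<xi>) \<partial>lborel)"
      by (intro exI allI impI pos_s) simp
  qed
  then show ?thesis by (simp add: G_eq[OF t])
qed

end

section \<open>Mass, scaling and lower bounds of the Green function\<close>

lemma integral_lborel_scaleR:
  fixes f :: "'a::euclidean_space \<Rightarrow> real"
  assumes [measurable]: "f \<in> borel_measurable borel" and c: "0 < c"
  shows "(\<integral>x. f x \<partial>lborel) = c ^ DIM('a) * (\<integral>x. f (c *\<^sub>R x) \<partial>lborel)"
  using c by (subst lborel_affine[of c 0]) (auto simp: integral_density integral_distr)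

lemma lborel_not_AE_False: "\<not> (AE x in (lborel :: 'a::euclidean_space measure). False)"
proof
  assume "AE x in (lborel :: 'a measure). False"
  then have "emeasure (lborel :: 'a measure) UNIV = 0"
    by (subst (asm) AE_iff_measurable[of UNIV]) auto
  then show False by simp
qed

context stable_symbol
begin

lemma integral_exp_psi_pos:
  assumes t: "0 < t"
  shows "0 < (\<integral>\<xi>. exp (- t * \<psi> \<xi>) \<partial>lborel)"
proof (rule ccontr)
  assume "\<not> ?thesis"
  then have "(\<integral>\<xi>. exp (- t * \<psi> \<xi>) \<partial>lborel) = 0"
    by (meson Bochner_Integration.integral_nonneg exp_ge_zero order_antisym not_le)
  then have "AE \<xi> in lborel. exp (- t * \<psi> \<xi>) = 0"
    by (subst (asm) integral_nonneg_eq_0_iff_AE[OF integrable_exp_psi[OF t]]) auto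
  then show False using lborel_not_AE_False[where 'a='a] by simp
qed

lemma G_abs_le:
  assumes t: "0 < t"
  shows "\<bar>G t x\<bar> \<le> (\<integral>\<xi>. exp (- t * \<psi> \<xi>) \<partial>lborel) / (2 * pi) ^ DIM('a)"
proof -
  have "\<bar>\<integral>\<xi>. cos (x \<bullet> \<xi>) * exp (- t * \<psi> \<xi>) \<partial>lborel\<bar> \<le> (\<integral>\<xi>. \<bar>cos (x \<bullet> \<xi>) * exp (- t * \<psi> \<xi>)\<bar> \<partial>lborel)"
    by (rule integral_abs_bound)
  also have "\<dots> \<le> (\<integral>\<xi>. exp (- t * \<psi> \<xi>) \<partial>lborel)"
    by (intro integral_mono integrable_abs integrable_cos_exp_psi integrable_exp_psi t)
       (auto simp: abs_mult intro!: mult_left_le_one_le)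
  finally show ?thesis by (simp add: G_eq[OF t] abs_divide divide_right_mono)
qed

text \<open>Integrating G against a Gaussian and exchanging the integrals leaves exp (- t \<psi>)
  \<le> 1 against the transform of the Gaussian, whose total integral cancels (2 pi)^d. Fatou's
  lemma removes the Gaussian. An upper bound is all that the finiteness of \<open>H\<close>
  requires, which avoids Fourier inversion.\<close>

lemma nn_integral_G_le_1:
  assumes t: "0 < t"
  shows "(\<integral>\<^sup>+ x. ennreal (G t x) \<partial>lborel) \<le> 1"
proof -
  let ?s = "\<lambda>n. inverse (real (Suc n))"
  have gauss: "(\<integral>\<^sup>+ x. ennreal (G t x * gaussian s x) \<partial>lborel) \<le> 1" if s: "0 < s" for s
  proof -
    let ?K = "(\<integral>\<xi>. exp (- t * \<psi> \<xi>) \<partial>lborel)"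
    let ?f = "\<lambda>x \<xi>. cos (x \<bullet> \<xi>) * exp (- t * \<psi> \<xi>) * gaussian s x"
    let ?c = "(2 * pi) ^ DIM('a)"
    have igs: "integrable lborel (\<lambda>x::'a. gaussian s x)" using integrable_gaussian[OF s] .
    have intG: "integrable lborel (\<lambda>x. G t x * gaussian s x)"
    proof (rule Bochner_Integration.integrable_bound[OF integrable_mult_right[OF igs, of "?K / ?c"]])
      show "AE x in lborel. norm (G t x * gaussian s x) \<le> norm (?K / ?c * gaussian s x)"
      proof (rule AE_I2)
        fix x :: 'a
        have "\<bar>G t x\<bar> * gaussian s x \<le> ?K / ?c * gaussian s x"
          using gaussian_pos[of s x] by (intro mult_right_mono G_abs_le t) auto
        then show "norm (G t x * gaussian s x) \<le> norm (?K / ?c * gaussian s x)"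
          using gaussian_pos[of s x] by (simp add: abs_mult)
      qed
    qed measurable
    have if': "integrable lborel (?f x)" for x
      by (intro integrable_mult_left integrable_cos_exp_psi t)
    have intf: "integrable (lborel \<Otimes>\<^sub>M lborel) (\<lambda>(x, \<xi>). ?f x \<xi>)"
    proof (rule lborel_pair.Fubini_integrable)
      show "integrable lborel (\<lambda>x. \<integral>\<xi>. norm (case (x, \<xi>) of (x, \<xi>) \<Rightarrow> ?f x \<xi>) \<partial>lborel)"
      proof (rule Bochner_Integration.integrable_bound[OF integrable_mult_right[OF igs, of ?K]])
        show "AE x in lborel. norm (\<integral>\<xi>. norm (case (x, \<xi>) of (x, \<xi>) \<Rightarrow> ?f x \<xi>) \<partial>lborel) \<le> norm (?K * gaussian s x)"
        proof (rule AE_I2)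
          fix x :: 'a
          have "(\<integral>\<xi>. \<bar>?f x \<xi>\<bar> \<partial>lborel) \<le> (\<integral>\<xi>. exp (- t * \<psi> \<xi>) * gaussian s x \<partial>lborel)"
            using gaussian_pos[of s x]
            by (intro integral_mono integrable_abs if' integrable_mult_left integrable_exp_psi t)
               (auto simp: abs_mult intro!: mult_left_le_one_le)
          then show "norm (\<integral>\<xi>. norm (case (x, \<xi>) of (x, \<xi>) \<Rightarrow> ?f x \<xi>) \<partial>lborel) \<le> norm (?K * gaussian s x)"
            by simp
        qed
      qed measurable
      show "AE x in lborel. integrable lborel (\<lambda>\<xi>. case (x, \<xi>) of (x, \<xi>) \<Rightarrow> ?f x \<xi>)"
        using if' by simp
    qed measurable
    have "(\<integral>x. G t x * gaussian s x \<partial>lborel) = (\<integral>x. (\<integral>\<xi>. ?f x \<xi> \<partial>lborel) / ?c \<partial>lborel)"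
      by (intro Bochner_Integration.integral_cong refl) (simp add: G_eq[OF t])
    also have "\<dots> = (\<integral>x. (\<integral>\<xi>. ?f x \<xi> \<partial>lborel) \<partial>lborel) / ?c"
      by simp
    also have "(\<integral>x. (\<integral>\<xi>. ?f x \<xi> \<partial>lborel) \<partial>lborel) = (\<integral>\<xi>. (\<integral>x. ?f x \<xi> \<partial>lborel) \<partial>lborel)"
      by (rule lborel_pair.Fubini_integral[symmetric]) (rule intf)
    also have "\<dots> = (\<integral>\<xi>. exp (- t * \<psi> \<xi>) * ((sqrt (2 * pi) / s) ^ DIM('a) * gaussian (1 / s) \<xi>) \<partial>lborel)"
    proof (intro Bochner_Integration.integral_cong refl)
      fix \<xi> :: 'a
      have "(\<integral>x. ?f x \<xi> \<partial>lborel) = (\<integral>x. exp (- t * \<psi> \<xi>) * (cos (\<xi> \<bullet> x) * gaussian s x) \<partial>lborel)"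
        by (simp add: mult_ac inner_commute)
      also have "\<dots> = exp (- t * \<psi> \<xi>) * ((sqrt (2 * pi) / s) ^ DIM('a) * gaussian (1 / s) \<xi>)"
        by (simp only: integral_mult_right_zero integral_cos_gaussian[OF s])
      finally show "(\<integral>x. ?f x \<xi> \<partial>lborel) = \<dots>" .
    qed
    also have "\<dots> \<le> (\<integral>\<xi>. (sqrt (2 * pi) / s) ^ DIM('a) * gaussian (1 / s) (\<xi>::'a) \<partial>lborel)"
    proof (rule integral_mono)
      show int1: "integrable lborel (\<lambda>\<xi>::'a. (sqrt (2 * pi) / s) ^ DIM('a) * gaussian (1 / s) \<xi>)"
        using s by (intro integrable_mult_right integrable_gaussian) auto
      have le: "exp (- t * \<psi> \<xi>) * ((sqrt (2 * pi) / s) ^ DIM('a) * gaussian (1 / s) \<xi>)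
        \<le> (sqrt (2 * pi) / s) ^ DIM('a) * gaussian (1 / s) \<xi>" for \<xi>
        using t psi_nonneg[of \<xi>] s gaussian_pos[of "1 / s" \<xi>] by (intro mult_left_le_one_le) auto
      then show "exp (- t * \<psi> \<xi>) * ((sqrt (2 * pi) / s) ^ DIM('a) * gaussian (1 / s) \<xi>)
        \<le> (sqrt (2 * pi) / s) ^ DIM('a) * gaussian (1 / s) \<xi>" for \<xi> .
      show "integrable lborel (\<lambda>\<xi>. exp (- t * \<psi> \<xi>) * ((sqrt (2 * pi) / s) ^ DIM('a) * gaussian (1 / s) \<xi>))"
        by (rule Bochner_Integration.integrable_bound[OF int1])
           (use s gaussian_pos[of "1 / s" "_ :: 'a"] le in \<open>auto simp: abs_mult abs_of_pos\<close>)
    qed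
    also have "\<dots> = (sqrt (2 * pi) / s) ^ DIM('a) * (\<integral>\<xi>. cos (0 \<bullet> \<xi>) * gaussian (1 / s) (\<xi>::'a) \<partial>lborel)"
      by simp
    also have "\<dots> = (sqrt (2 * pi) / s) ^ DIM('a) * (sqrt (2 * pi) * s) ^ DIM('a)"
      using s by (subst integral_cos_gaussian) (auto simp: gaussian_def)
    also have "\<dots> = ?c"
    proof -
      have "sqrt (2 * pi) / s * (sqrt (2 * pi) * s) = 2 * pi" using s by simp
      then show ?thesis unfolding power_mult_distrib[symmetric] by (rule arg_cong)
    qed
    finally have "(\<integral>x. G t x * gaussian s x \<partial>lborel) \<le> 1"
      by (simp add: divide_right_mono)
    moreover have "(\<integral>\<^sup>+ x. ennreal (G t x * gaussian s x) \<partial>lborel) = ennreal (\<integral>x. G t x * gaussian s x \<partial>lborel)"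
      by (intro nn_integral_eq_integral intG AE_I2 mult_nonneg_nonneg G_nonneg t less_imp_le[OF gaussian_pos])
    ultimately show ?thesis by (simp add: ennreal_le_1)
  qed
  have "(\<integral>\<^sup>+ x. ennreal (G t x) \<partial>lborel) = (\<integral>\<^sup>+ x. liminf (\<lambda>n. ennreal (G t x * gaussian (?s n) x)) \<partial>lborel)"
  proof (intro nn_integral_cong)
    fix x :: 'a
    have "(\<lambda>n. ennreal (G t x * gaussian (?s n) x)) \<longlonglongrightarrow> ennreal (G t x * 1)"
      by (intro tendsto_ennrealI tendsto_intros gaussian_tendsto_1)
    then show "ennreal (G t x) = liminf (\<lambda>n. ennreal (G t x * gaussian (?s n) x))"
      by (simp add: lim_imp_Liminf)
  qed
  also have "\<dots> \<le> liminf (\<lambda>n. \<integral>\<^sup>+ x. ennreal (G t x * gaussian (?s n) x) \<partial>lborel)"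
    by (rule nn_integral_liminf) measurable
  also have "\<dots> \<le> liminf (\<lambda>n. 1)"
    by (intro Liminf_mono always_eventually allI gauss) simp
  finally show ?thesis by (simp add: Liminf_const)
qed

lemma G_scaling:
  assumes t: "0 < t"
  shows "G t x = t powr (- real DIM('a) / \<beta>) * G 1 (t powr (- 1 / \<beta>) *\<^sub>R x)"
proof -
  \<comment> \<open>Chosen so that t c^\<beta> = 1, whence t \<psi>(c \<xi>) =
    \<psi>(\<xi>).\<close>
  define c where "c = t powr (- 1 / \<beta>)"
  have c: "0 < c" using t by (simp add: c_def)
  have "c powr \<beta> = t powr (- 1)" unfolding c_def powr_powr using \<beta> by simp
  then have tc: "t * c powr \<beta> = 1" using t by (simp add: powr_minus)
  have "(\<integral>\<xi>. cos (x \<bullet> \<xi>) * exp (- t * \<psi> \<xi>) \<partial>lborel)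
    = c ^ DIM('a) * (\<integral>\<xi>. cos (x \<bullet> (c *\<^sub>R \<xi>)) * exp (- t * \<psi> (c *\<^sub>R \<xi>)) \<partial>lborel)"
    by (rule integral_lborel_scaleR) (use c in measurable)
  also have "(\<lambda>\<xi>. cos (x \<bullet> (c *\<^sub>R \<xi>)) * exp (- t * \<psi> (c *\<^sub>R \<xi>))) = (\<lambda>\<xi>. cos ((c *\<^sub>R x) \<bullet> \<xi>) * exp (- 1 * \<psi> \<xi>))"
    using c tc by (auto simp: psi_scaleR mult.assoc[symmetric] fun_eq_iff)
  also have "c ^ DIM('a) = t powr (- real DIM('a) / \<beta>)"
    using t by (simp add: c_def powr_powr powr_realpow[symmetric] field_simps)
  finally show ?thesis by (simp add: G_eq[OF t] G_eq[OF zero_less_one] c_def)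
qed

text \<open>Uniformity in r comes from monotonicity: the integral of exp (- r \<psi>) is smallest at
  r = b, where it is \<open>I\<close>, and the loss caused by 1 - cos is largest at r = a, where it
  is \<open>\<delta> x\<close>. Continuity of the single function \<open>\<delta>\<close> at 0
  therefore controls all r in [a, b].\<close>

lemma G_lower_bound:
  assumes a: "0 < a" "a \<le> b"
  obtains R c where "0 < R" "0 < c" "\<And>r x. a \<le> r \<Longrightarrow> r \<le> b \<Longrightarrow> norm x \<le> R \<Longrightarrow> c \<le> G r x"
proof -
  define I where "I = (\<integral>\<xi>. exp (- b * \<psi> \<xi>) \<partial>lborel)"
  have I: "0 < I" using integral_exp_psi_pos[of b] a by (simp add: I_def)
  define \<delta> where "\<delta> x = (\<integral>\<xi>. (1 - cos (x \<bullet> \<xi>)) * exp (- a * \<psi> \<xi>) \<partial>lborel)" for x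
  have bound: "norm ((1 - cos (x \<bullet> \<xi>)) * exp (- r * \<psi> \<xi>)) \<le> 2 * exp (- r * \<psi> \<xi>)" for x \<xi> r
    using cos_ge_minus_one[of "x \<bullet> \<xi>"] by (simp add: abs_mult)
  have int1: "integrable lborel (\<lambda>\<xi>. (1 - cos (x \<bullet> \<xi>)) * exp (- r * \<psi> \<xi>))" if "0 < r" for x r
    by (rule Bochner_Integration.integrable_bound[OF integrable_mult_right[OF integrable_exp_psi[OF that], of 2]])
       (use bound[of x _ r] in auto)
  have "continuous_on UNIV \<delta>"
  proof (unfold continuous_on_sequentially, safe, unfold comp_def)
    fix X :: "nat \<Rightarrow> 'a" and x assume X: "X \<longlonglongrightarrow> x"
    show "(\<lambda>n. \<delta> (X n)) \<longlonglongrightarrow> \<delta> x"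
      unfolding \<delta>_def
    proof (rule integral_dominated_convergence[where w="\<lambda>\<xi>. 2 * exp (- a * \<psi> \<xi>)"])
      show "AE \<xi> in lborel. (\<lambda>n. (1 - cos (X n \<bullet> \<xi>)) * exp (- a * \<psi> \<xi>)) \<longlonglongrightarrow> (1 - cos (x \<bullet> \<xi>)) * exp (- a * \<psi> \<xi>)"
        by (intro AE_I2 tendsto_intros X)
    qed (use bound integrable_mult_right[OF integrable_exp_psi[OF a(1)], of 2] in auto)
  qed
  then have "isCont \<delta> 0" by (simp add: continuous_on_eq_continuous_at)
  then obtain d where d: "0 < d" "\<And>x. norm x < d \<Longrightarrow> \<bar>\<delta> x - \<delta> 0\<bar> < I / 2"
    using I unfolding continuous_at_eps_delta dist_norm by (metis diff_zero half_gt_zero real_norm_def)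
  have "\<delta> 0 = 0" by (simp add: \<delta>_def)
  show thesis
  proof
    show "0 < d / 2" "0 < I / 2 / (2 * pi) ^ DIM('a)" using d I by auto
    fix r and x :: 'a assume r: "a \<le> r" "r \<le> b" and x: "norm x \<le> d / 2"
    have r0: "0 < r" using r a by linarith
    have "(\<integral>\<xi>. cos (x \<bullet> \<xi>) * exp (- r * \<psi> \<xi>) \<partial>lborel)
      = (\<integral>\<xi>. exp (- r * \<psi> \<xi>) - (1 - cos (x \<bullet> \<xi>)) * exp (- r * \<psi> \<xi>) \<partial>lborel)"
      by (simp add: algebra_simps)
    also have "\<dots> = (\<integral>\<xi>. exp (- r * \<psi> \<xi>) \<partial>lborel) - (\<integral>\<xi>. (1 - cos (x \<bullet> \<xi>)) * exp (- r * \<psi> \<xi>) \<partial>lborel)"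
      by (intro Bochner_Integration.integral_diff integrable_exp_psi int1 r0)
    also have "\<dots> \<ge> I - \<delta> x"
    proof (rule diff_mono)
      show "I \<le> (\<integral>\<xi>. exp (- r * \<psi> \<xi>) \<partial>lborel)"
        unfolding I_def using r r0 psi_nonneg
        by (intro integral_mono integrable_exp_psi) (auto intro: mult_right_mono)
      show "(\<integral>\<xi>. (1 - cos (x \<bullet> \<xi>)) * exp (- r * \<psi> \<xi>) \<partial>lborel) \<le> \<delta> x"
        unfolding \<delta>_def using r r0 a psi_nonneg
        by (intro integral_mono int1 mult_left_mono) (auto intro: mult_right_mono)
    qed
    moreover have "\<delta> x < I / 2" using d(2)[of x] x d(1) \<open>\<delta> 0 = 0\<close> by linarith
    ultimately have "I / 2 \<le> (\<integral>\<xi>. cos (x \<bullet> \<xi>) * exp (- r * \<psi> \<xi>) \<partial>lborel)" by linarith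
    then show "I / 2 / (2 * pi) ^ DIM('a) \<le> G r x"
      unfolding G_eq[OF r0] by (intro divide_right_mono) auto
  qed
qed

text \<open>By scaling, G is at least c1 r^(-d/\<beta>) on the ball of radius R r^(1/\<beta>), and
  the powers of r cancel against its volume. Because R \<le> 1, the condition r \<le> \<rho>^\<beta>
  places this ball inside the one of radius \<rho>.\<close>

lemma nn_integral_G_cball:
  obtains c where "0 < c"
    "\<And>\<rho> r. 0 < r \<Longrightarrow> 0 < \<rho> \<Longrightarrow> r \<le> \<rho> powr \<beta> \<Longrightarrow>
      ennreal c \<le> (\<integral>\<^sup>+ x\<in>cball 0 \<rho>. ennreal (G r x) \<partial>lborel)"
proof -
  obtain R0 c1 where R0: "0 < R0" and c1: "0 < c1"
    and *: "\<And>r x. 1 \<le> r \<Longrightarrow> r \<le> 1 \<Longrightarrow> norm x \<le> R0 \<Longrightarrow> c1 \<le> G r x"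
    using G_lower_bound[of 1 1] by (metis order_refl zero_less_one)
  define R where "R = min R0 1"
  have R: "0 < R" "R \<le> 1" "R \<le> R0" using R0 by (auto simp: R_def)
  define V where "V = unit_ball_vol (real DIM('a))"
  have V: "0 < V" by (simp add: V_def)
  show thesis
  proof
    show "0 < c1 * V * R ^ DIM('a)" using c1 V R by auto
    fix \<rho> r :: real assume r: "0 < r" "0 < \<rho>" "r \<le> \<rho> powr \<beta>"
    let ?m = "r powr (- real DIM('a) / \<beta>)" and ?w = "r powr (1 / \<beta>)"
    have w: "0 < ?w" using r by simp
    have "?w \<le> (\<rho> powr \<beta>) powr (1 / \<beta>)" using r \<beta> by (intro powr_mono2) auto
    also have "\<dots> = \<rho>" using r \<beta> by (simp add: powr_powr)
    finally have w\<rho>: "R * ?w \<le> \<rho>" using R(1,2) w by (meson mult_left_le_one_le less_imp_le order_trans)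
    have G_ge: "c1 * ?m \<le> G r x" if "norm x \<le> R * ?w" for x
    proof -
      have "r powr (- 1 / \<beta>) * ?w = 1" using r by (simp add: powr_add[symmetric])
      then have "norm (r powr (- 1 / \<beta>) *\<^sub>R x) \<le> R"
        using mult_left_mono[OF that, of "r powr (- 1 / \<beta>)"] by (simp add: mult.left_commute)
      then have "c1 \<le> G 1 (r powr (- 1 / \<beta>) *\<^sub>R x)" using R(3) by (intro *) auto
      then show ?thesis unfolding G_scaling[OF r(1), of x] by (metis mult.commute mult_left_mono powr_ge_zero)
    qed
    have wd: "?m * ?w ^ DIM('a) = 1"
      using r by (simp add: powr_realpow[symmetric] powr_powr powr_add[symmetric] field_simps)
    have "ennreal (c1 * V * R ^ DIM('a)) = ennreal (c1 * ?m) * emeasure lborel (cball (0::'a) (R * ?w))"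
    proof -
      have "c1 * ?m * (V * (R * ?w) ^ DIM('a)) = c1 * V * R ^ DIM('a) * (?m * ?w ^ DIM('a))"
        by (simp add: power_mult_distrib mult_ac)
      then have eq: "c1 * V * R ^ DIM('a) = c1 * ?m * (V * (R * ?w) ^ DIM('a))"
        unfolding wd mult_1_right by (rule sym)
      have "emeasure lborel (cball (0::'a) (R * ?w)) = ennreal (V * (R * ?w) ^ DIM('a))"
        using R w by (simp add: emeasure_cball V_def)
      then show ?thesis
        unfolding eq using c1 V R w by (simp only:) (rule ennreal_mult, auto)
    qed
    also have "\<dots> = (\<integral>\<^sup>+ x\<in>cball 0 (R * ?w). ennreal (c1 * ?m) \<partial>(lborel::'a measure))"
      by (simp add: nn_integral_cmult_indicator)
    also have "\<dots> \<le> (\<integral>\<^sup>+ x\<in>cball 0 \<rho>. ennreal (G r x) \<partial>lborel)"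
      using G_ge w\<rho> by (intro nn_integral_mono) (auto split: split_indicator intro!: ennreal_leI)
    finally show "ennreal (c1 * V * R ^ DIM('a)) \<le> (\<integral>\<^sup>+ x\<in>cball 0 \<rho>. ennreal (G r x) \<partial>lborel)" .
  qed
qed

end

subsection \<open>The kernels Z and Y\<close>

lemma
  fixes f g h :: "'b \<Rightarrow> real"
  assumes [measurable]: "f \<in> borel_measurable M" "g \<in> borel_measurable M" "h \<in> borel_measurable M"
  shows borel_measurable_indicator_greaterThanLessThan [measurable (raw)]:
      "(\<lambda>x. indicator {f x<..<g x} (h x) :: ennreal) \<in> borel_measurable M"
    and borel_measurable_indicator_atLeastLessThan [measurable (raw)]:
      "(\<lambda>x. indicator {f x..<g x} (h x) :: ennreal) \<in> borel_measurable M"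
  unfolding indicator_def greaterThanLessThan_iff atLeastLessThan_iff by measurable

text \<open>The convolution of g_\<alpha> with g_(1-\<alpha>) is g_1 = 1, a Beta integral once (r,
  t) is rescaled to the unit interval. It inverts the equation that defines Y.\<close>

lemma nn_integral_Beta_g_kernel:
  fixes \<alpha> r t :: real
  assumes \<alpha>: "0 < \<alpha>" "\<alpha> < 1" and rt: "r < t"
  shows "(\<integral>\<^sup>+ s\<in>{r<..<t}. ennreal (g_kernel \<alpha> (t - s)) * ennreal (g_kernel (1 - \<alpha>) (s - r)) \<partial>lborel) = 1"
proof -
  define d where "d = t - r"
  have d: "0 < d" using rt by (simp add: d_def)
  have G: "0 < Gamma \<alpha>" "0 < Gamma (1 - \<alpha>)" using \<alpha> by (auto intro: Gamma_real_pos)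
  have B: "Beta (1 - \<alpha>) \<alpha> = Gamma (1 - \<alpha>) * Gamma \<alpha>" by (simp add: Beta_def)
  have beta: "(\<integral>\<^sup>+ u. ennreal (indicator {0..1} u * (u powr (1 - \<alpha> - 1) * (1 - u) powr (\<alpha> - 1))) \<partial>lborel)
    = ennreal (Gamma (1 - \<alpha>) * Gamma \<alpha>)"
    using nn_integral_has_integral_lebesgue[OF _ has_integral_Beta_real[of "1 - \<alpha>" \<alpha>]] \<alpha> by (simp add: B)
  have "(\<integral>\<^sup>+ s\<in>{r<..<t}. ennreal (g_kernel \<alpha> (t - s)) * ennreal (g_kernel (1 - \<alpha>) (s - r)) \<partial>lborel)
    = ennreal \<bar>d\<bar> * (\<integral>\<^sup>+ u. ennreal (g_kernel \<alpha> (t - (r + d * u))) * ennreal (g_kernel (1 - \<alpha>) (r + d * u - r)) * indicator {r<..<t} (r + d * u) \<partial>lborel)"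
    by (rule nn_integral_real_affine) (use d in auto)
  also have "\<dots> = ennreal d * (\<integral>\<^sup>+ u. ennreal (1 / (d * (Gamma (1 - \<alpha>) * Gamma \<alpha>))) *
      ennreal (indicator {0..1} u * (u powr (1 - \<alpha> - 1) * (1 - u) powr (\<alpha> - 1))) \<partial>lborel)"
  proof (intro arg_cong2[where f="(*)"] nn_integral_cong_AE)
    show "AE u in lborel. ennreal (g_kernel \<alpha> (t - (r + d * u))) * ennreal (g_kernel (1 - \<alpha>) (r + d * u - r)) * indicator {r<..<t} (r + d * u)
      = ennreal (1 / (d * (Gamma (1 - \<alpha>) * Gamma \<alpha>))) * ennreal (indicator {0..1} u * (u powr (1 - \<alpha> - 1) * (1 - u) powr (\<alpha> - 1)))"
      using AE_lborel_singleton[of "0::real"] AE_lborel_singleton[of "1::real"]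
    proof eventually_elim
      case (elim u)
      have ind: "r + d * u \<in> {r<..<t} \<longleftrightarrow> 0 < u \<and> u < 1"
        using d by (simp add: d_def zero_less_mult_iff) (smt (verit) mult_less_cancel_left2)
      show ?case
      proof (cases "0 < u \<and> u < 1")
        case True
        have "g_kernel \<alpha> (t - (r + d * u)) * g_kernel (1 - \<alpha>) (r + d * u - r)
          = (d * (1 - u)) powr (\<alpha> - 1) * (d * u) powr (- \<alpha>) / (Gamma (1 - \<alpha>) * Gamma \<alpha>)"
          by (simp add: g_kernel_def d_def algebra_simps)
        also have "\<dots> = (d powr (\<alpha> - 1) * d powr (- \<alpha>)) * (u powr (- \<alpha>) * (1 - u) powr (\<alpha> - 1)) / (Gamma (1 - \<alpha>) * Gamma \<alpha>)"
          using True d by (simp add: powr_mult)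
        also have "d powr (\<alpha> - 1) * d powr (- \<alpha>) = d powr (- 1)"
          by (simp add: powr_add[symmetric])
        also have "\<dots> = 1 / d"
          using d by (rule powr_neg_one)
        finally have "g_kernel \<alpha> (t - (r + d * u)) * g_kernel (1 - \<alpha>) (r + d * u - r)
          = 1 / (d * (Gamma (1 - \<alpha>) * Gamma \<alpha>)) * (u powr (1 - \<alpha> - 1) * (1 - u) powr (\<alpha> - 1))" by simp
        then show ?thesis
          using True ind d G \<alpha> by (simp add: ennreal_mult[symmetric] g_kernel_nonneg)
      next
        case False
        then have "u \<notin> {0..1}" using elim by auto
        then show ?thesis using False ind by simp
      qed
    qed
  qed (use d in simp)
  also have "\<dots> = ennreal d * (ennreal (1 / (d * (Gamma (1 - \<alpha>) * Gamma \<alpha>))) * ennreal (Gamma (1 - \<alpha>) * Gamma \<alpha>))"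
    by (subst nn_integral_cmult) (measurable, simp only: beta)
  also have "\<dots> = 1"
    using d G by (simp add: ennreal_mult[symmetric])
  finally show ?thesis .
qed

text \<open>On 0 < u < t the factor exp (t - u) is at least 1, so exp t times the Laplace transform
  at p = 1 is a bound.\<close>

lemma nn_integral_g_kernel_finite:
  assumes \<rho>: "0 < \<rho>"
  shows "(\<integral>\<^sup>+ s\<in>{0<..<t}. ennreal (g_kernel \<rho> (t - s)) \<partial>lborel) < \<infinity>"
proof -
  have "(\<integral>\<^sup>+ s\<in>{0<..<t}. ennreal (g_kernel \<rho> (t - s)) \<partial>lborel)
    = (\<integral>\<^sup>+ u. ennreal (g_kernel \<rho> (t - (t + (-1) * u))) * indicator {0<..<t} (t + (-1) * u) \<partial>lborel)"
    by (subst nn_integral_real_affine[where t=t and c="-1"]) auto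
  also have "\<dots> \<le> (\<integral>\<^sup>+ u. ennreal (exp t) * (ennreal (exp (- 1 * u)) * (ennreal (g_kernel \<rho> u) * indicator {0<..} u)) \<partial>lborel)"
  proof (intro nn_integral_mono)
    fix u :: real
    show "ennreal (g_kernel \<rho> (t - (t + (-1) * u))) * indicator {0<..<t} (t + (-1) * u)
      \<le> ennreal (exp t) * (ennreal (exp (- 1 * u)) * (ennreal (g_kernel \<rho> u) * indicator {0<..} u))"
    proof (cases "0 < u \<and> u < t")
      case True
      have "1 * g_kernel \<rho> u \<le> exp (t - u) * g_kernel \<rho> u"
        using True g_kernel_nonneg[OF \<rho>, of u] by (intro mult_right_mono) auto
      then have "g_kernel \<rho> u \<le> exp t * (exp (- u) * g_kernel \<rho> u)" by (simp add: exp_diff exp_minus field_simps)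
      then show ?thesis using True g_kernel_nonneg[OF \<rho>, of u]
        by (simp add: ennreal_mult[symmetric] ennreal_leI)
    qed auto
  qed
  also have "\<dots> = ennreal (exp t) * ennreal (1 powr (- \<rho>))"
    using nn_integral_Laplace_g_kernel[OF \<rho> zero_less_one] by (subst nn_integral_cmult) auto
  also have "\<dots> < \<infinity>" by (simp add: ennreal_mult_less_top)
  finally show ?thesis .
qed

locale subdiffusion = stable_symbol \<beta> \<nu> for \<beta> :: real and \<nu> :: "'a::euclidean_space measure" +
  fixes \<alpha> :: real and G\<alpha> :: "real \<Rightarrow> real \<Rightarrow> real" and Y :: "real \<Rightarrow> 'a \<Rightarrow> ennreal"
  assumes \<alpha>: "0 < \<alpha>" "\<alpha> < 1"
    and G\<alpha>: "stable_subordinator_density \<alpha> G\<alpha>"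
    and Y: "Y_kernel_of \<alpha> (Z_kernel \<alpha> \<beta> \<nu> G\<alpha>) Y"
begin

abbreviation "Z \<equiv> Z_kernel \<alpha> \<beta> \<nu> G\<alpha>"

text \<open>The law of the stable subordinator at time 1, extended by zero so that convolutions and
  Tonelli's theorem run over the whole line.\<close>

definition \<gamma> :: "real \<Rightarrow> ennreal" where
  "\<gamma> v = ennreal (indicator {0<..} v * G\<alpha> 1 v)"

lemma \<gamma>_measurable [measurable]: "\<gamma> \<in> borel_measurable borel"
proof -
  have "G\<alpha> 1 \<in> borel_measurable (restrict_space borel {0<..})"
    using G\<alpha> unfolding stable_subordinator_density_def by auto
  then have "(\<lambda>v. indicator {0<..} v * G\<alpha> 1 v) \<in> borel_measurable borel"
    by (subst (asm) borel_measurable_restrict_space_iff) auto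
  then show ?thesis unfolding \<gamma>_def by measurable
qed

lemma \<gamma>_nonpos: "v \<le> 0 \<Longrightarrow> \<gamma> v = 0"
  by (simp add: \<gamma>_def)

lemma \<gamma>_Laplace:
  assumes r: "0 \<le> r"
  shows "(\<integral>\<^sup>+ v. ennreal (exp (- r * v)) * \<gamma> v \<partial>lborel) = ennreal (exp (- (r powr \<alpha>)))"
proof -
  have "(\<integral>\<^sup>+ v. ennreal (exp (- r * v)) * \<gamma> v \<partial>lborel)
    = (\<integral>\<^sup>+ s\<in>{0<..}. ennreal (exp (- r * s) * G\<alpha> 1 s) \<partial>lborel)"
    by (intro nn_integral_cong) (auto simp: \<gamma>_def ennreal_mult' split: split_indicator)
  also have "\<dots> = ennreal (exp (- 1 * r powr \<alpha>))"
    using G\<alpha> r unfolding stable_subordinator_density_def by auto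
  finally show ?thesis by simp
qed

lemma \<gamma>_total: "(\<integral>\<^sup>+ v. \<gamma> v \<partial>lborel) = 1"
  using \<gamma>_Laplace[of 0] by simp

text \<open>No pointwise positivity of the density is at hand, only its total mass 1; exhausting
  (0,\<infinity>) by compact intervals yields one of positive mass. Its distance from 0 and from
  \<infinity> later keeps the quotients t / v in a compact range.\<close>

lemma \<gamma>_interval:
  obtains v0 v1 p where "0 < v0" "v0 < v1" "0 < p" "(\<integral>\<^sup>+ v\<in>{v0..v1}. \<gamma> v \<partial>lborel) = ennreal p"
proof -
  let ?I = "\<lambda>n. {inverse (real (Suc n)) .. real (Suc n) + 1}"
  have ex: "\<exists>n. (\<integral>\<^sup>+ v\<in>?I n. \<gamma> v \<partial>lborel) \<noteq> 0"
  proof (rule ccontr)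
    assume "\<not> ?thesis"
    then have "AE v in lborel. \<gamma> v * indicator (?I n) v = 0" for n
      by (subst nn_integral_0_iff_AE[symmetric]) auto
    then have "AE v in lborel. \<forall>n. \<gamma> v * indicator (?I n) v = 0"
      by (simp only: AE_all_countable simp_thms)
    then have "AE v in lborel. \<gamma> v = 0"
    proof eventually_elim
      case (elim v)
      show ?case
      proof (cases "0 < v")
        case True
        obtain n1 where n1: "inverse (real (Suc n1)) < v" using reals_Archimedean[OF True] by blast
        obtain n2 where n2: "v \<le> real n2" using real_arch_simple by blast
        have "inverse (real (Suc (max n1 n2))) \<le> inverse (real (Suc n1))" by (intro le_imp_inverse_le) auto
        moreover have "real n2 \<le> real (Suc (max n1 n2)) + 1" by simp
        ultimately have "v \<in> ?I (max n1 n2)" using n1 n2 unfolding atLeastAtMost_iff by linarith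
        then show ?thesis using elim by (auto dest!: spec[of _ "max n1 n2"] simp del: of_nat_Suc)
      qed (simp add: \<gamma>_nonpos)
    qed
    then have "(\<integral>\<^sup>+ v. \<gamma> v \<partial>lborel) = 0" by (subst nn_integral_0_iff_AE) auto
    then show False using \<gamma>_total by simp
  qed
  then obtain n where n: "(\<integral>\<^sup>+ v\<in>?I n. \<gamma> v \<partial>lborel) \<noteq> 0" by blast
  have "(\<integral>\<^sup>+ v\<in>?I n. \<gamma> v \<partial>lborel) \<le> (\<integral>\<^sup>+ v. \<gamma> v \<partial>lborel)"
    by (intro nn_integral_mono) (auto split: split_indicator)
  then have "(\<integral>\<^sup>+ v\<in>?I n. \<gamma> v \<partial>lborel) < \<infinity>" unfolding \<gamma>_total by (simp add: order_le_less_trans)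
  then have "(\<integral>\<^sup>+ v\<in>?I n. \<gamma> v \<partial>lborel) = ennreal (enn2real (\<integral>\<^sup>+ v\<in>?I n. \<gamma> v \<partial>lborel))"
    "0 < enn2real (\<integral>\<^sup>+ v\<in>?I n. \<gamma> v \<partial>lborel)"
    using n by (auto simp: enn2real_positive_iff zero_less_iff_neq_zero)
  moreover have "inverse (real (Suc n)) < real (Suc n) + 1"
    by (rule order_le_less_trans[of _ 1]) (auto simp: inverse_le_1_iff)
  ultimately show thesis by (intro that[of "inverse (real (Suc n))" "real (Suc n) + 1"]) auto
qed

text \<open>
  \<open>Z\<close> and \<open>Y\<close> are controlled at positive times only; \<open>Zf\<close> and \<open>Yf\<close> agree with them there and are jointly
  measurable on the whole space.
\<close>

definition Zf :: "real \<Rightarrow> 'a \<Rightarrow> ennreal" where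
  "Zf t x = (\<integral>\<^sup>+ v. ennreal (G ((t / v) powr \<alpha>) x) * \<gamma> v \<partial>lborel)"

lemma Zf_measurable [measurable (raw)]:
  assumes [measurable]: "f \<in> borel_measurable M" "g \<in> M \<rightarrow>\<^sub>M borel"
  shows "(\<lambda>y. Zf (f y) (g y)) \<in> borel_measurable M"
  unfolding Zf_def by measurable

text \<open>Substitute \<open>s = v\<^sup>-\<^sup>\<alpha>\<close>: the time change is \<open>(t / S)\<^sup>\<alpha>\<close> with \<open>S\<close> the subordinator at time \<open>1\<close>.\<close>

lemma Z_eq:
  assumes t: "0 < t"
  shows "Z t x = Zf t x"
proof -
  let ?f = "\<lambda>s. ennreal (G (t powr \<alpha> * s) x * s powr (- 1 - 1 / \<alpha>)) * \<gamma> (s powr (- 1 / \<alpha>))"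
  have "(\<integral>\<^sup>+ s\<in>{0<..}. ennreal (G (t powr \<alpha> * s) x * s powr (- 1 - 1 / \<alpha>) * G\<alpha> 1 (s powr (- 1 / \<alpha>))) \<partial>lborel)
    = (\<integral>\<^sup>+ s\<in>{0<..}. ?f s \<partial>lborel)"
  proof (intro nn_integral_cong)
    fix s :: real
    show "ennreal (G (t powr \<alpha> * s) x * s powr (- 1 - 1 / \<alpha>) * G\<alpha> 1 (s powr (- 1 / \<alpha>))) * indicator {0<..} s = ?f s * indicator {0<..} s"
    proof (cases "0 < s")
      case True
      have "0 \<le> G (t powr \<alpha> * s) x" using True t by (intro G_nonneg) simp
      then show ?thesis using True by (simp add: \<gamma>_def ennreal_mult')
    qed simp
  qed
  also have "\<dots> = (\<integral>\<^sup>+ v\<in>{0<..}. ?f (v powr (- \<alpha>)) * ennreal (\<bar>- \<alpha>\<bar> * v powr (- \<alpha> - 1)) \<partial>lborel)"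
    by (rule nn_integral_Ioi_powr) (use \<alpha> in auto)
  also have "\<dots> = (\<integral>\<^sup>+ v. ennreal \<alpha> * (ennreal (G ((t / v) powr \<alpha>) x) * \<gamma> v) \<partial>lborel)"
  proof (intro nn_integral_cong)
    fix v :: real
    show "?f (v powr (- \<alpha>)) * ennreal (\<bar>- \<alpha>\<bar> * v powr (- \<alpha> - 1)) * indicator {0<..} v
      = ennreal \<alpha> * (ennreal (G ((t / v) powr \<alpha>) x) * \<gamma> v)"
    proof (cases "0 < v")
      case True
      have 1: "(v powr (- \<alpha>)) powr (- 1 / \<alpha>) = v" using True \<alpha> by (simp add: powr_powr)
      have "- \<alpha> * (- 1 - 1 / \<alpha>) = \<alpha> + 1" using \<alpha> by (simp add: field_simps)
      then have 2: "(v powr (- \<alpha>)) powr (- 1 - 1 / \<alpha>) = v powr (\<alpha> + 1)" by (simp only: powr_powr)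
      have 3: "t powr \<alpha> * v powr (- \<alpha>) = (t / v) powr \<alpha>"
        using True t by (simp add: powr_divide powr_minus_divide)
      have 4: "v powr (\<alpha> + 1) * v powr (- \<alpha> - 1) = 1" using True by (simp add: powr_add[symmetric])
      have Gn: "0 \<le> G ((t / v) powr \<alpha>) x" using True t by (intro G_nonneg) simp
      have "?f (v powr (- \<alpha>)) * ennreal (\<bar>- \<alpha>\<bar> * v powr (- \<alpha> - 1))
        = (ennreal (G ((t / v) powr \<alpha>) x * v powr (\<alpha> + 1)) * ennreal (\<alpha> * v powr (- \<alpha> - 1))) * \<gamma> v"
        unfolding 1 2 3 using \<alpha> by (simp add: mult_ac)
      also have "ennreal (G ((t / v) powr \<alpha>) x * v powr (\<alpha> + 1)) * ennreal (\<alpha> * v powr (- \<alpha> - 1))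
        = ennreal (\<alpha> * G ((t / v) powr \<alpha>) x * (v powr (\<alpha> + 1) * v powr (- \<alpha> - 1)))"
        using \<alpha> Gn by (subst ennreal_mult[symmetric]) (auto simp: mult_ac)
      also have "\<dots> = ennreal \<alpha> * ennreal (G ((t / v) powr \<alpha>) x)"
        unfolding 4 using \<alpha> Gn by (simp add: ennreal_mult)
      finally show ?thesis using True by (simp add: mult.assoc)
    qed (simp add: \<gamma>_nonpos)
  qed
  also have "\<dots> = ennreal \<alpha> * Zf t x"
    unfolding Zf_def by (rule nn_integral_cmult) measurable
  finally show ?thesis
    using \<alpha> by (simp add: Z_kernel_def mult.assoc[symmetric] ennreal_mult[symmetric])
qed

lemma nn_integral_Zf_le_1:
  assumes t: "0 < t"
  shows "(\<integral>\<^sup>+ x. Zf t x \<partial>lborel) \<le> 1"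
proof -
  have "(\<integral>\<^sup>+ x. Zf t x \<partial>lborel) = (\<integral>\<^sup>+ v. (\<integral>\<^sup>+ x. ennreal (G ((t / v) powr \<alpha>) x) * \<gamma> v \<partial>lborel) \<partial>lborel)"
    unfolding Zf_def by (rule lborel_pair.Fubini') measurable
  also have "\<dots> \<le> (\<integral>\<^sup>+ v. \<gamma> v \<partial>lborel)"
  proof (intro nn_integral_mono)
    fix v :: real
    have "(\<integral>\<^sup>+ x. ennreal (G ((t / v) powr \<alpha>) x) * \<gamma> v \<partial>lborel)
      = (\<integral>\<^sup>+ x. ennreal (G ((t / v) powr \<alpha>) x) \<partial>lborel) * \<gamma> v"
      by (rule nn_integral_multc) measurable
    also have "\<dots> \<le> 1 * \<gamma> v"
    proof (cases "0 < v")
      case True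
      then show ?thesis using t by (intro mult_right_mono nn_integral_G_le_1) auto
    qed (simp add: \<gamma>_nonpos)
    finally show "(\<integral>\<^sup>+ x. ennreal (G ((t / v) powr \<alpha>) x) * \<gamma> v \<partial>lborel) \<le> \<gamma> v" by simp
  qed
  finally show ?thesis by (simp add: \<gamma>_total)
qed

text \<open>For subordinator values v \<ge> v0 the condition on t gives (t / v)^\<alpha> \<le>
  \<rho>^\<beta>, the range in which G keeps mass at least cG in the ball. The values in [v0, v1]
  have mass p, hence the constant cG p.\<close>

lemma nn_integral_Z_cball:
  obtains c v0 where "0 < c" "0 < v0"
    "\<And>t \<rho>. 0 < t \<Longrightarrow> 0 < \<rho> \<Longrightarrow> t \<le> v0 * \<rho> powr (\<beta> / \<alpha>) \<Longrightarrow> ennreal c \<le> (\<integral>\<^sup>+ z\<in>cball 0 \<rho>. Z t z \<partial>lborel)"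
proof -
  obtain cG where cG: "0 < cG" "\<And>\<rho> r. 0 < r \<Longrightarrow> 0 < \<rho> \<Longrightarrow> r \<le> \<rho> powr \<beta> \<Longrightarrow>
      ennreal cG \<le> (\<integral>\<^sup>+ x\<in>cball 0 \<rho>. ennreal (G r x) \<partial>lborel)"
    using nn_integral_G_cball by blast
  obtain v0 v1 p where v: "0 < v0" "v0 < v1" "0 < p" "(\<integral>\<^sup>+ v\<in>{v0..v1}. \<gamma> v \<partial>lborel) = ennreal p"
    by (rule \<gamma>_interval)
  show thesis
  proof
    show "0 < cG * p" "0 < v0" using cG v by auto
    fix t \<rho> :: real
    have [measurable]: "cball (0::'a) \<rho> \<in> sets borel" by (simp add: borel_closed)
    assume t: "0 < t" and \<rho>: "0 < \<rho>" and le: "t \<le> v0 * \<rho> powr (\<beta> / \<alpha>)"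
    have "ennreal (cG * p) = ennreal cG * (\<integral>\<^sup>+ v\<in>{v0..v1}. \<gamma> v \<partial>lborel)"
      using cG v by (simp add: ennreal_mult)
    also have "\<dots> = (\<integral>\<^sup>+ v\<in>{v0..v1}. ennreal cG * \<gamma> v \<partial>lborel)"
      by (subst nn_integral_cmult[symmetric]) (auto simp: mult.assoc)
    also have "\<dots> \<le> (\<integral>\<^sup>+ v. (\<integral>\<^sup>+ x. ennreal (G ((t / v) powr \<alpha>) x) * \<gamma> v * indicator (cball 0 \<rho>) x \<partial>lborel) \<partial>lborel)"
    proof (intro nn_integral_mono)
      fix v :: real
      show "ennreal cG * \<gamma> v * indicator {v0..v1} v \<le> (\<integral>\<^sup>+ x. ennreal (G ((t / v) powr \<alpha>) x) * \<gamma> v * indicator (cball 0 \<rho>) x \<partial>lborel)"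
      proof (cases "v \<in> {v0..v1}")
        case True
        then have v': "0 < v" "v0 \<le> v" using v(1) by auto
        have "t / v \<le> \<rho> powr (\<beta> / \<alpha>)"
          using le v' by (simp add: divide_le_eq) (smt (verit) mult.commute mult_left_mono powr_ge_zero)
        then have "(t / v) powr \<alpha> \<le> (\<rho> powr (\<beta> / \<alpha>)) powr \<alpha>" using \<alpha> t v' by (intro powr_mono2) auto
        also have "\<dots> = \<rho> powr \<beta>" using \<alpha> by (simp add: powr_powr)
        finally have "ennreal cG \<le> (\<integral>\<^sup>+ x\<in>cball 0 \<rho>. ennreal (G ((t / v) powr \<alpha>) x) \<partial>lborel)"
          using t v' \<rho> by (intro cG) auto
        then have "ennreal cG * \<gamma> v \<le> (\<integral>\<^sup>+ x\<in>cball 0 \<rho>. ennreal (G ((t / v) powr \<alpha>) x) \<partial>lborel) * \<gamma> v"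
          by (rule mult_right_mono) simp
        also have "\<dots> = (\<integral>\<^sup>+ x. ennreal (G ((t / v) powr \<alpha>) x) * indicator (cball 0 \<rho>) x * \<gamma> v \<partial>lborel)"
          by (rule nn_integral_multc[symmetric]) measurable
        also have "\<dots> = (\<integral>\<^sup>+ x. ennreal (G ((t / v) powr \<alpha>) x) * \<gamma> v * indicator (cball 0 \<rho>) x \<partial>lborel)"
          by (intro nn_integral_cong) (simp only: mult_ac)
        finally show ?thesis using True by simp
      qed simp
    qed
    also have "\<dots> = (\<integral>\<^sup>+ x. (\<integral>\<^sup>+ v. ennreal (G ((t / v) powr \<alpha>) x) * \<gamma> v * indicator (cball 0 \<rho>) x \<partial>lborel) \<partial>lborel)"
      by (rule lborel_pair.Fubini'[symmetric]) measurable
    also have "\<dots> = (\<integral>\<^sup>+ z\<in>cball 0 \<rho>. Z t z \<partial>lborel)"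
      unfolding Z_eq[OF t] Zf_def by (intro nn_integral_cong nn_integral_multc) measurable
    finally show "ennreal (cG * p) \<le> (\<integral>\<^sup>+ z\<in>cball 0 \<rho>. Z t z \<partial>lborel)" .
  qed
qed

section \<open>The time integral of Y and its increments\<close>

definition B :: "real \<Rightarrow> ennreal" where
  "B l = (\<integral>\<^sup>+ v. indicator {0<..} (l - v) * \<gamma> v \<partial>lborel)"

lemma B_measurable [measurable]: "B \<in> borel_measurable borel"
  unfolding B_def by measurable

text \<open>The fractional integral of Z of order \<alpha>, a bridge between two formulas:
  \<open>H_eq\<close> computes it from G and the subordinator, and \<open>H_eq_Y\<close> identifies
  it with the integral of Y over (0, t).\<close>

definition H :: "real \<Rightarrow> 'a \<Rightarrow> ennreal" where
  "H t x = (\<integral>\<^sup>+ s\<in>{0<..<t}. ennreal (g_kernel \<alpha> (t - s)) * Z s x \<partial>lborel)"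

lemma H_eq_Zf: "H t x = (\<integral>\<^sup>+ s\<in>{0<..<t}. ennreal (g_kernel \<alpha> (t - s)) * Zf s x \<partial>lborel)"
  unfolding H_def by (intro nn_integral_cong) (auto simp: Z_eq split: split_indicator)

lemma H_measurable [measurable]: "(\<lambda>x. H t x) \<in> borel_measurable borel"
  unfolding H_eq_Zf by measurable

text \<open>Integrated over x, Z has mass at most 1 at every positive time, and a finite integral of
  g_\<alpha> remains. At x = 0 finiteness fails if d \<ge> \<beta> and t > 0, so a null set has to
  be excepted.\<close>

lemma H_finite: "AE x in lborel. H t x < \<infinity>"
proof -
  have "(\<integral>\<^sup>+ x. H t x \<partial>lborel) = (\<integral>\<^sup>+ s. (\<integral>\<^sup>+ x. ennreal (g_kernel \<alpha> (t - s)) * Zf s x * indicator {0<..<t} s \<partial>lborel) \<partial>lborel)"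
    unfolding H_eq_Zf by (rule lborel_pair.Fubini') measurable
  also have "\<dots> \<le> (\<integral>\<^sup>+ s\<in>{0<..<t}. ennreal (g_kernel \<alpha> (t - s)) \<partial>lborel)"
  proof (intro nn_integral_mono)
    fix s :: real
    show "(\<integral>\<^sup>+ x. ennreal (g_kernel \<alpha> (t - s)) * Zf s x * indicator {0<..<t} s \<partial>lborel) \<le> ennreal (g_kernel \<alpha> (t - s)) * indicator {0<..<t} s"
    proof (cases "s \<in> {0<..<t}")
      case True
      then have "(\<integral>\<^sup>+ x. ennreal (g_kernel \<alpha> (t - s)) * Zf s x * indicator {0<..<t} s \<partial>lborel)
        = ennreal (g_kernel \<alpha> (t - s)) * (\<integral>\<^sup>+ x. Zf s x \<partial>lborel)"
        by (simp add: nn_integral_cmult)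
      also have "\<dots> \<le> ennreal (g_kernel \<alpha> (t - s)) * 1"
        using True by (intro mult_left_mono nn_integral_Zf_le_1) auto
      finally show ?thesis using True by simp
    qed simp
  qed
  also have "\<dots> < \<infinity>" by (rule nn_integral_g_kernel_finite) (rule \<alpha>)
  finally have "AE x in lborel. H t x \<noteq> \<infinity>" by (intro nn_integral_noteq_infinite) auto
  then show ?thesis by (simp add: less_top)
qed

text \<open>
  The density of \<open>H\<close> with respect to the operational time \<open>w\<^sup>\<alpha>\<close> is a distribution function in \<open>t / w\<close>;
  this makes its increments in \<open>t\<close> accessible.
\<close>

lemma H_eq:
  assumes t: "0 < t"
  shows "H t x = (\<integral>\<^sup>+ w\<in>{0<..}. ennreal (G (w powr \<alpha>) x * (\<alpha> * w powr (\<alpha> - 1))) * B (t / w) \<partial>lborel)"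
proof -
  let ?K = "\<lambda>l. ennreal (G ((t / l) powr \<alpha>) x * ((t / l) powr (\<alpha> - 1) * (t / l\<^sup>2))) * indicator {0<..} l"
  let ?a = "\<lambda>l v. ennreal (g_kernel \<alpha> (l - v)) * indicator {0<..} (l - v) * (ennreal v * \<gamma> v)"
  have "H t x = (\<integral>\<^sup>+ s. (\<integral>\<^sup>+ v. ennreal (g_kernel \<alpha> (t - s)) * (ennreal (G ((s / v) powr \<alpha>) x) * \<gamma> v) * indicator {0<..<t} s \<partial>lborel) \<partial>lborel)"
    unfolding H_eq_Zf Zf_def
    by (intro nn_integral_cong) (simp add: nn_integral_cmult nn_integral_multc)
  also have "\<dots> = (\<integral>\<^sup>+ v. (\<integral>\<^sup>+ s. ennreal (g_kernel \<alpha> (t - s)) * (ennreal (G ((s / v) powr \<alpha>) x) * \<gamma> v) * indicator {0<..<t} s \<partial>lborel) \<partial>lborel)"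
    by (rule lborel_pair.Fubini') measurable
  also have "\<dots> = (\<integral>\<^sup>+ v. (\<integral>\<^sup>+ l. ?K l * ?a l v \<partial>lborel) \<partial>lborel)"
  proof (rule nn_integral_cong)
    fix v :: real
    show "(\<integral>\<^sup>+ s. ennreal (g_kernel \<alpha> (t - s)) * (ennreal (G ((s / v) powr \<alpha>) x) * \<gamma> v) * indicator {0<..<t} s \<partial>lborel)
      = (\<integral>\<^sup>+ l. ?K l * ?a l v \<partial>lborel)"
    proof (cases "0 < v")
      case v: True
      have "(\<integral>\<^sup>+ s. ennreal (g_kernel \<alpha> (t - s)) * (ennreal (G ((s / v) powr \<alpha>) x) * \<gamma> v) * indicator {0<..<t} s \<partial>lborel)
        = (\<integral>\<^sup>+ s\<in>{0<..}. ennreal (g_kernel \<alpha> (t - s)) * (ennreal (G ((s / v) powr \<alpha>) x) * \<gamma> v) * indicator {..<t} s \<partial>lborel)"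
        by (intro nn_integral_cong) (auto split: split_indicator)
      \<comment> \<open>The substitution s = t v / l makes s / v = t / l independent of v and gives
        t - s = (t / l)(l - v). The power kernel thus splits into a factor in l and a convolution
        kernel in l - v.\<close>
      also have "\<dots> = (\<integral>\<^sup>+ l\<in>{0<..}. ennreal (g_kernel \<alpha> (t - t * v / l)) * (ennreal (G ((t * v / l / v) powr \<alpha>) x) * \<gamma> v) * indicator {..<t} (t * v / l) * ennreal (t * v / l\<^sup>2) \<partial>lborel)"
        by (rule nn_integral_Ioi_divide) (use t v in auto)
      also have "\<dots> = (\<integral>\<^sup>+ l. ?K l * ?a l v \<partial>lborel)"
      proof (intro nn_integral_cong)
        fix l :: real
        show "ennreal (g_kernel \<alpha> (t - t * v / l)) * (ennreal (G ((t * v / l / v) powr \<alpha>) x) * \<gamma> v) * indicator {..<t} (t * v / l) * ennreal (t * v / l\<^sup>2) * indicator {0<..} l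
          = ?K l * ?a l v"
        proof (cases "0 < l \<and> v < l")
          case True
          have l: "0 < l" "v < l" using True by auto
          have i: "t * v / l < t" using l t v by (simp add: divide_less_eq)
          have tl: "t - t * v / l = t / l * (l - v)" using l by (simp add: field_simps)
          have g: "g_kernel \<alpha> (t - t * v / l) = (t / l) powr (\<alpha> - 1) * g_kernel \<alpha> (l - v)"
            unfolding g_kernel_def tl using l t by (subst powr_mult) auto
          have d: "t * v / l / v = t / l" using v by simp
          have Gn: "0 \<le> G ((t / l) powr \<alpha>) x" using t l by (intro G_nonneg) simp
          have A0: "0 \<le> G ((t / l) powr \<alpha>) x * ((t / l) powr (\<alpha> - 1) * (t / l\<^sup>2))"
            using Gn t by simp
          have gn: "0 \<le> g_kernel \<alpha> (l - v)" using \<alpha> by (simp add: g_kernel_nonneg)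
          have "ennreal (g_kernel \<alpha> (t - t * v / l)) * (ennreal (G ((t * v / l / v) powr \<alpha>) x) * \<gamma> v) * ennreal (t * v / l\<^sup>2)
            = (ennreal ((t / l) powr (\<alpha> - 1) * g_kernel \<alpha> (l - v)) * ennreal (G ((t / l) powr \<alpha>) x) * ennreal (t * v / l\<^sup>2)) * \<gamma> v"
            unfolding g d by (simp add: mult_ac)
          also have "ennreal ((t / l) powr (\<alpha> - 1) * g_kernel \<alpha> (l - v)) * ennreal (G ((t / l) powr \<alpha>) x) * ennreal (t * v / l\<^sup>2)
            = ennreal ((G ((t / l) powr \<alpha>) x * ((t / l) powr (\<alpha> - 1) * (t / l\<^sup>2))) * (g_kernel \<alpha> (l - v) * v))"
            using Gn gn t v l by (simp add: ennreal_mult[symmetric] mult_ac)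
          also have "\<dots> = ennreal (G ((t / l) powr \<alpha>) x * ((t / l) powr (\<alpha> - 1) * (t / l\<^sup>2))) * (ennreal (g_kernel \<alpha> (l - v)) * ennreal v)"
            using A0 gn v by (subst ennreal_mult) (simp_all only: ennreal_mult less_imp_le mult_nonneg_nonneg)
          finally show ?thesis using l i by (simp add: mult.assoc)
        next
          case False
          show ?thesis
          proof (cases "0 < l")
            case True
            with False have "l \<le> v" by simp
            then have "\<not> t * v / l < t" using t True by (simp add: divide_less_eq)
            then show ?thesis using \<open>l \<le> v\<close> by simp
          qed simp
        qed
      qed
      finally show ?thesis .
    qed (simp add: \<gamma>_nonpos)
  qed
  also have "\<dots> = (\<integral>\<^sup>+ l. (\<integral>\<^sup>+ v. ?K l * ?a l v \<partial>lborel) \<partial>lborel)"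
    by (rule lborel_pair.Fubini') measurable
  also have "\<dots> = (\<integral>\<^sup>+ l. ?K l * (\<integral>\<^sup>+ v. ?a l v \<partial>lborel) \<partial>lborel)"
    by (intro nn_integral_cong nn_integral_cmult) measurable
  also have "\<dots> = (\<integral>\<^sup>+ l. ?K l * (ennreal \<alpha> * B l) \<partial>lborel)"
  proof (rule nn_integral_cong_AE)
    \<comment> \<open>The inner integral is g_\<alpha> convolved with v \<gamma>(v), which the
      subordinator identity replaces by \<alpha> times a distribution function; its validity for
      almost every l suffices under the outer integral.\<close>
    have conv: "AE l in lborel. 0 < l \<longrightarrow> (\<integral>\<^sup>+ v. ?a l v \<partial>lborel)
        = ennreal \<alpha> * (\<integral>\<^sup>+ v. indicator {0<..} (l - v) * \<gamma> v \<partial>lborel)"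
      by (rule subordinator_convolution_identity) (auto simp only: \<gamma>_measurable \<gamma>_nonpos \<gamma>_Laplace \<alpha>)
    show "AE l in lborel. ?K l * (\<integral>\<^sup>+ v. ?a l v \<partial>lborel) = ?K l * (ennreal \<alpha> * B l)"
      using conv unfolding B_def by eventually_elim (auto split: split_indicator)
  qed
  also have "\<dots> = (\<integral>\<^sup>+ l\<in>{0<..}. ennreal (G ((t / l) powr \<alpha>) x * ((t / l) powr (\<alpha> - 1) * (t / l\<^sup>2))) * (ennreal \<alpha> * B l) \<partial>lborel)"
    by (simp add: mult_ac)
  \<comment> \<open>With l = t / w the variable t survives only in the argument of
    \<open>B\<close>.\<close>
  also have "\<dots> = (\<integral>\<^sup>+ w\<in>{0<..}. ennreal (G ((t / (t / w)) powr \<alpha>) x * ((t / (t / w)) powr (\<alpha> - 1) * (t / (t / w)\<^sup>2))) * (ennreal \<alpha> * B (t / w)) * ennreal (t / w\<^sup>2) \<partial>lborel)"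
    by (rule nn_integral_Ioi_divide) (use t in auto)
  also have "\<dots> = (\<integral>\<^sup>+ w\<in>{0<..}. ennreal (G (w powr \<alpha>) x * (\<alpha> * w powr (\<alpha> - 1))) * B (t / w) \<partial>lborel)"
  proof (intro nn_integral_cong)
    fix w :: real
    show "ennreal (G ((t / (t / w)) powr \<alpha>) x * ((t / (t / w)) powr (\<alpha> - 1) * (t / (t / w)\<^sup>2))) * (ennreal \<alpha> * B (t / w)) * ennreal (t / w\<^sup>2) * indicator {0<..} w
      = ennreal (G (w powr \<alpha>) x * (\<alpha> * w powr (\<alpha> - 1))) * B (t / w) * indicator {0<..} w"
    proof (cases "0 < w")
      case True
      have 1: "t / (t / w) = w" "t / (t / w)\<^sup>2 = w\<^sup>2 / t" using t True by (auto simp: power2_eq_square)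
      have Gn: "0 \<le> G (w powr \<alpha>) x" using True by (intro G_nonneg) simp
      have "ennreal (G (w powr \<alpha>) x * (w powr (\<alpha> - 1) * (w\<^sup>2 / t))) * (ennreal \<alpha> * B (t / w)) * ennreal (t / w\<^sup>2)
        = (ennreal (G (w powr \<alpha>) x * (w powr (\<alpha> - 1) * (w\<^sup>2 / t))) * ennreal \<alpha> * ennreal (t / w\<^sup>2)) * B (t / w)"
        by (simp add: mult_ac)
      also have "ennreal (G (w powr \<alpha>) x * (w powr (\<alpha> - 1) * (w\<^sup>2 / t))) * ennreal \<alpha> * ennreal (t / w\<^sup>2)
        = ennreal ((G (w powr \<alpha>) x * (w powr (\<alpha> - 1) * (w\<^sup>2 / t))) * \<alpha> * (t / w\<^sup>2))"
        using Gn \<alpha> t by (simp add: ennreal_mult[symmetric])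
      also have "(G (w powr \<alpha>) x * (w powr (\<alpha> - 1) * (w\<^sup>2 / t))) * \<alpha> * (t / w\<^sup>2) = G (w powr \<alpha>) x * (\<alpha> * w powr (\<alpha> - 1))"
        using True t by simp
      finally show ?thesis unfolding 1 using True by simp
    qed simp
  qed
  finally show ?thesis .
qed

definition Yf :: "real \<Rightarrow> 'a \<Rightarrow> ennreal" where
  "Yf s x = Y s x * indicator {0<..} s"

lemma Yf_measurable_pair: "(\<lambda>(s, x). Yf s x) \<in> borel_measurable (borel \<Otimes>\<^sub>M borel)"
proof -
  have "(\<lambda>(t, x). Y t x) \<in> borel_measurable (restrict_space borel ({0<..} \<times> UNIV))"
    using Y unfolding Y_kernel_of_def by blast
  then have "(\<lambda>p. (case p of (t, x) \<Rightarrow> Y t x) * indicator ({0<..} \<times> UNIV) p) \<in> borel_measurable borel"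
    by (subst (asm) borel_measurable_restrict_space_iff_ennreal) (auto simp: open_Times intro!: borel_open)
  moreover have "(\<lambda>p. (case p of (t, x) \<Rightarrow> Y t x) * indicator ({0<..} \<times> UNIV) p) = (\<lambda>(s, x). Yf s x)"
    by (auto simp: Yf_def fun_eq_iff split: split_indicator)
  ultimately show ?thesis by (simp add: borel_prod)
qed

lemma Yf_measurable [measurable (raw)]:
  assumes "f \<in> borel_measurable M" "g \<in> M \<rightarrow>\<^sub>M borel"
  shows "(\<lambda>y. Yf (f y) (g y)) \<in> borel_measurable M"
  using measurable_compose[OF measurable_Pair[OF assms] Yf_measurable_pair] by simp

lemma Z_eq_Y:
  assumes t: "0 < t"
  shows "Z t x = (\<integral>\<^sup>+ s\<in>{0<..<t}. ennreal (g_kernel (1 - \<alpha>) (t - s)) * Yf s x \<partial>lborel)"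
proof -
  have "Z t x = (\<integral>\<^sup>+ s\<in>{0<..<t}. ennreal (g_kernel (1 - \<alpha>) (t - s)) * Y s x \<partial>lborel)"
    using Y t unfolding Y_kernel_of_def by blast
  also have "\<dots> = (\<integral>\<^sup>+ s\<in>{0<..<t}. ennreal (g_kernel (1 - \<alpha>) (t - s)) * Yf s x \<partial>lborel)"
    by (intro nn_integral_cong) (auto simp: Yf_def split: split_indicator)
  finally show ?thesis .
qed

text \<open>Insert the equation for Y into the convolution with g_\<alpha> and exchange the
  integrals: for each r < t the inner one is the Beta integral, of value 1.\<close>

lemma H_eq_Y: "H t x = (\<integral>\<^sup>+ s\<in>{0<..<t}. Yf s x \<partial>lborel)"
proof -
  have "H t x = (\<integral>\<^sup>+ s. (\<integral>\<^sup>+ r. ennreal (g_kernel \<alpha> (t - s)) * (ennreal (g_kernel (1 - \<alpha>) (s - r)) * Yf r x * indicator {0<..<s} r) * indicator {0<..<t} s \<partial>lborel) \<partial>lborel)"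
    unfolding H_def
  proof (intro nn_integral_cong)
    fix s :: real
    show "ennreal (g_kernel \<alpha> (t - s)) * Z s x * indicator {0<..<t} s
      = (\<integral>\<^sup>+ r. ennreal (g_kernel \<alpha> (t - s)) * (ennreal (g_kernel (1 - \<alpha>) (s - r)) * Yf r x * indicator {0<..<s} r) * indicator {0<..<t} s \<partial>lborel)"
    proof (cases "s \<in> {0<..<t}")
      case True
      then show ?thesis using Z_eq_Y[of s x] by (simp add: nn_integral_cmult)
    qed simp
  qed
  also have "\<dots> = (\<integral>\<^sup>+ r. (\<integral>\<^sup>+ s. ennreal (g_kernel \<alpha> (t - s)) * (ennreal (g_kernel (1 - \<alpha>) (s - r)) * Yf r x * indicator {0<..<s} r) * indicator {0<..<t} s \<partial>lborel) \<partial>lborel)"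
    by (rule lborel_pair.Fubini') measurable
  also have "\<dots> = (\<integral>\<^sup>+ r\<in>{0<..<t}. Yf r x \<partial>lborel)"
  proof (intro nn_integral_cong)
    fix r :: real
    show "(\<integral>\<^sup>+ s. ennreal (g_kernel \<alpha> (t - s)) * (ennreal (g_kernel (1 - \<alpha>) (s - r)) * Yf r x * indicator {0<..<s} r) * indicator {0<..<t} s \<partial>lborel)
      = Yf r x * indicator {0<..<t} r"
    proof (cases "r \<in> {0<..<t}")
      case True
      have "(\<integral>\<^sup>+ s. ennreal (g_kernel \<alpha> (t - s)) * (ennreal (g_kernel (1 - \<alpha>) (s - r)) * Yf r x * indicator {0<..<s} r) * indicator {0<..<t} s \<partial>lborel)
        = (\<integral>\<^sup>+ s. (ennreal (g_kernel \<alpha> (t - s)) * ennreal (g_kernel (1 - \<alpha>) (s - r)) * indicator {r<..<t} s) * Yf r x \<partial>lborel)"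
        using True by (intro nn_integral_cong) (auto simp: mult_ac split: split_indicator)
      also have "\<dots> = Yf r x"
        using nn_integral_Beta_g_kernel[OF \<alpha>, of r t] True by (subst nn_integral_multc) auto
      finally show ?thesis using True by simp
    next
      case False
      then have "(\<lambda>s. ennreal (g_kernel \<alpha> (t - s)) * (ennreal (g_kernel (1 - \<alpha>) (s - r)) * Yf r x * indicator {0<..<s} r) * indicator {0<..<t} s) = (\<lambda>s. 0)"
        by (auto simp: fun_eq_iff split: split_indicator)
      then show ?thesis using False by simp
    qed
  qed
  finally show ?thesis .
qed

text \<open>By \<open>H_eq_Y\<close> the function H is nondecreasing in t, so the countably many
  null sets belonging to integer times serve all real times at once.\<close>

lemma H_finite_all: "AE x in lborel. \<forall>t. H t x < \<infinity>"
proof -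
  have "AE x in lborel. \<forall>n. H (real n) x < \<infinity>"
    unfolding AE_all_countable using H_finite by blast
  then show ?thesis
  proof eventually_elim
    case (elim x)
    show ?case
    proof
      fix t :: real
      obtain n where n: "t \<le> real n" using real_arch_simple by blast
      have "H t x \<le> H (real n) x"
        unfolding H_eq_Y using n by (intro nn_integral_mono) (auto split: split_indicator)
      also have "\<dots> < \<infinity>" using elim by blast
      finally show "H t x < \<infinity>" .
    qed
  qed
qed

text \<open>In \<open>H_eq\<close> only \<open>B (t / w)\<close> depends on t, so the increment of H
  from t - \<tau> to t integrates the subordinator mass of [(t - \<tau>) / w, t / w). Read the other
  way round, a fixed v in [v0, v1] collects w over an interval of length \<tau> / v \<ge> \<tau> /
  v1, on which the weight is bounded below. The resulting bound is linear in \<tau> although nothing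
  is known about Y at any single time.\<close>

lemma Y_window_lower_bound:
  assumes t: "0 < t"
  obtains R c where "0 < R" "0 < c"
    "\<And>x \<tau>. norm x \<le> R \<Longrightarrow> \<forall>t. H t x < \<infinity> \<Longrightarrow> 0 < \<tau> \<Longrightarrow> \<tau> \<le> t / 2 \<Longrightarrow>
      ennreal (c * \<tau>) \<le> (\<integral>\<^sup>+ s\<in>{t - \<tau><..<t}. Yf s x \<partial>lborel)"
proof -
  obtain v0 v1 p where v: "0 < v0" "v0 < v1" "0 < p" and p: "(\<integral>\<^sup>+ v\<in>{v0..v1}. \<gamma> v \<partial>lborel) = ennreal p"
    by (rule \<gamma>_interval)
  \<comment> \<open>For v in [v0, v1] and \<tau> \<le> t / 2 all relevant w lie between (t / 2) / v1
    and t / v0.\<close>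
  define w0 where "w0 = t / (2 * v1)"
  define w1 where "w1 = t / v0"
  have w0: "0 < w0" "w0 \<le> w1" using v t by (auto simp: w0_def w1_def intro!: divide_left_mono)
  obtain R c0 where R: "0 < R" "0 < c0"
    and c0: "\<And>r x. w0 powr \<alpha> \<le> r \<Longrightarrow> r \<le> w1 powr \<alpha> \<Longrightarrow> norm x \<le> R \<Longrightarrow> c0 \<le> G r x"
    using G_lower_bound[of "w0 powr \<alpha>" "w1 powr \<alpha>"] w0 \<alpha> by (smt (verit) powr_mono2 powr_gt_zero)
  define c1 where "c1 = c0 * (\<alpha> * w1 powr (\<alpha> - 1))"
  have c1: "0 < c1" using R \<alpha> w0 by (simp add: c1_def)
  show thesis
  proof
    show "0 < R" "0 < c1 * p / v1" using R c1 v by auto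
    fix x :: 'a and \<tau> assume x: "norm x \<le> R" and fin: "\<forall>t. H t x < \<infinity>" and \<tau>: "0 < \<tau>" "\<tau> \<le> t / 2"
    define k where "k w = ennreal (G (w powr \<alpha>) x * (\<alpha> * w powr (\<alpha> - 1))) * indicator {0<..} w" for w
    have [measurable]: "k \<in> borel_measurable borel" unfolding k_def by measurable
    let ?D = "\<lambda>w v. indicator {(t - \<tau>) / w ..< t / w} v * \<gamma> v"
    have t\<tau>: "0 < t - \<tau>" using \<tau> t by simp
    have Hk: "H s x = (\<integral>\<^sup>+ w. k w * B (s / w) \<partial>lborel)" if "0 < s" for s
      unfolding H_eq[OF that] k_def by (simp add: mult_ac)
    have B_split: "k w * B (t / w) = k w * B ((t - \<tau>) / w) + k w * (\<integral>\<^sup>+ v. ?D w v \<partial>lborel)" for w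
    proof (cases "0 < w")
      case True
      have le: "(t - \<tau>) / w \<le> t / w" using True \<tau> by (intro divide_right_mono) auto
      have "B (t / w) = (\<integral>\<^sup>+ v. indicator {0<..} ((t - \<tau>) / w - v) * \<gamma> v + ?D w v \<partial>lborel)"
        unfolding B_def using le by (intro nn_integral_cong) (auto split: split_indicator)
      also have "\<dots> = B ((t - \<tau>) / w) + (\<integral>\<^sup>+ v. ?D w v \<partial>lborel)"
        unfolding B_def by (rule nn_integral_add) measurable
      finally show ?thesis by (simp add: ring_distribs)
    qed (simp add: k_def)
    have "H t x = (\<integral>\<^sup>+ w. k w * B ((t - \<tau>) / w) + k w * (\<integral>\<^sup>+ v. ?D w v \<partial>lborel) \<partial>lborel)"
      by (simp only: Hk[OF t] B_split)
    also have "\<dots> = H (t - \<tau>) x + (\<integral>\<^sup>+ w. k w * (\<integral>\<^sup>+ v. ?D w v \<partial>lborel) \<partial>lborel)"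
      unfolding Hk[OF t\<tau>] by (rule nn_integral_add) measurable
    finally have H1: "H t x = H (t - \<tau>) x + (\<integral>\<^sup>+ w. k w * (\<integral>\<^sup>+ v. ?D w v \<partial>lborel) \<partial>lborel)" .
    have "H t x = (\<integral>\<^sup>+ s. Yf s x * indicator {0<..<t - \<tau>} s + Yf s x * indicator {t - \<tau><..<t} s \<partial>lborel)"
      unfolding H_eq_Y using \<tau> t\<tau>
      by (intro nn_integral_cong_AE, use AE_lborel_singleton[of "t - \<tau>"] in eventually_elim)
         (auto split: split_indicator)
    also have "\<dots> = H (t - \<tau>) x + (\<integral>\<^sup>+ s\<in>{t - \<tau><..<t}. Yf s x \<partial>lborel)"
      unfolding H_eq_Y by (rule nn_integral_add) measurable
    finally have H2: "H t x = H (t - \<tau>) x + (\<integral>\<^sup>+ s\<in>{t - \<tau><..<t}. Yf s x \<partial>lborel)" .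
    \<comment> \<open>Both decompositions of H t x contain H (t - \<tau>) x; cancelling it in
      \<open>ennreal\<close> requires its finiteness.\<close>
    have "(\<integral>\<^sup>+ s\<in>{t - \<tau><..<t}. Yf s x \<partial>lborel) = (\<integral>\<^sup>+ w. k w * (\<integral>\<^sup>+ v. ?D w v \<partial>lborel) \<partial>lborel)"
      using H1 fin[rule_format, of "t - \<tau>"] unfolding H2 ennreal_add_left_cancel by auto
    also have "\<dots> = (\<integral>\<^sup>+ w. (\<integral>\<^sup>+ v. k w * ?D w v \<partial>lborel) \<partial>lborel)"
      by (intro nn_integral_cong nn_integral_cmult[symmetric]) measurable
    also have "\<dots> = (\<integral>\<^sup>+ v. (\<integral>\<^sup>+ w. k w * ?D w v \<partial>lborel) \<partial>lborel)"
      by (rule lborel_pair.Fubini') measurable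
    also have "\<dots> \<ge> (\<integral>\<^sup>+ v. ennreal (c1 * \<tau> / v1) * (\<gamma> v * indicator {v0..v1} v) \<partial>lborel)"
    proof (intro nn_integral_mono)
      fix v :: real
      show "ennreal (c1 * \<tau> / v1) * (\<gamma> v * indicator {v0..v1} v) \<le> (\<integral>\<^sup>+ w. k w * ?D w v \<partial>lborel)"
      proof (cases "v \<in> {v0..v1}")
        case True
        then have v': "0 < v" "v0 \<le> v" "v \<le> v1" using v by auto
        have "ennreal (c1 * \<tau> / v1) * \<gamma> v \<le> ennreal (c1 * (\<tau> / v)) * \<gamma> v"
          using v' c1 \<tau> by (intro mult_right_mono ennreal_leI) (auto intro!: divide_left_mono)
        also have "ennreal (c1 * (\<tau> / v)) = (\<integral>\<^sup>+ w. ennreal c1 * indicator {(t - \<tau>) / v<..<t / v} w \<partial>lborel)"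
        proof -
          have "emeasure lborel {(t - \<tau>) / v<..<t / v} = ennreal (\<tau> / v)"
            using v' \<tau> by (subst emeasure_lborel_Ioo) (auto simp: diff_divide_distrib)
          moreover have "ennreal (c1 * (\<tau> / v)) = ennreal c1 * ennreal (\<tau> / v)"
            using c1 \<tau> v' by (intro ennreal_mult) auto
          ultimately show ?thesis by (subst nn_integral_cmult_indicator) auto
        qed
        also have "\<dots> * \<gamma> v = (\<integral>\<^sup>+ w. ennreal c1 * indicator {(t - \<tau>) / v<..<t / v} w * \<gamma> v \<partial>lborel)"
          by (rule nn_integral_multc[symmetric]) measurable
        also have "\<dots> \<le> (\<integral>\<^sup>+ w. k w * ?D w v \<partial>lborel)"
        proof (intro nn_integral_mono)
          fix w :: real
          show "ennreal c1 * indicator {(t - \<tau>) / v<..<t / v} w * \<gamma> v \<le> k w * ?D w v"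
          proof (cases "w \<in> {(t - \<tau>) / v<..<t / v}")
            case w: True
            have wpos: "0 < w" using w t\<tau> v' by (auto intro: less_trans[rotated])
            have D1: "(t - \<tau>) / w \<le> v" "v < t / w"
              using w wpos v' by (auto simp: field_simps)
            have "w0 \<le> (t / 2) / v"
              unfolding w0_def using v' v t by (simp add: field_simps)
            also have "\<dots> \<le> (t - \<tau>) / v" using \<tau> v' by (intro divide_right_mono) auto
            finally have w0w: "w0 \<le> w" using w by auto
            have "t / v \<le> w1" unfolding w1_def using v' v t by (intro divide_left_mono) auto
            then have ww1: "w \<le> w1" using w by auto
            have "c0 \<le> G (w powr \<alpha>) x"
              using w0w ww1 w0 wpos \<alpha> x by (intro c0 powr_mono2) auto
            moreover have "w1 powr (\<alpha> - 1) \<le> w powr (\<alpha> - 1)"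
              using ww1 wpos \<alpha> by (intro powr_mono2') auto
            ultimately have "c1 \<le> G (w powr \<alpha>) x * (\<alpha> * w powr (\<alpha> - 1))"
              unfolding c1_def using R(2) \<alpha> by (intro mult_mono) auto
            then show ?thesis using w wpos D1 by (auto simp: k_def intro!: mult_right_mono ennreal_leI)
          qed simp
        qed
        finally show ?thesis using True by simp
      qed simp
    qed
    finally have "(\<integral>\<^sup>+ v. ennreal (c1 * \<tau> / v1) * (\<gamma> v * indicator {v0..v1} v) \<partial>lborel) \<le> (\<integral>\<^sup>+ s\<in>{t - \<tau><..<t}. Yf s x \<partial>lborel)" .
    moreover have "(\<integral>\<^sup>+ v. ennreal (c1 * \<tau> / v1) * (\<gamma> v * indicator {v0..v1} v) \<partial>lborel) = ennreal (c1 * p / v1 * \<tau>)"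
      using c1 \<tau> v by (subst nn_integral_cmult) (auto simp: p ennreal_mult[symmetric] mult_ac)
    ultimately show "ennreal (c1 * p / v1 * \<tau>) \<le> (\<integral>\<^sup>+ s\<in>{t - \<tau><..<t}. Yf s x \<partial>lborel)" by simp
  qed
qed

end

subsection \<open>Blow-up\<close>

lemma lborel_distr_reflect: "distr lborel borel ((-) x) = (lborel :: 'a::euclidean_space measure)"
  using lborel_affine[of "-1" x] by (simp add: density_1)

lemma nn_integral_lborel_reflect:
  fixes g :: "'a::euclidean_space \<Rightarrow> ennreal"
  assumes [measurable]: "g \<in> borel_measurable borel"
  shows "(\<integral>\<^sup>+ y. g (x - y) \<partial>lborel) = (\<integral>\<^sup>+ y. g y \<partial>lborel)"
  by (subst (2) lborel_distr_reflect[of x, symmetric]) (simp add: nn_integral_distr)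

text \<open>The condition on \<phi>0 makes \<phi>_(i+1) = \<phi>_i \<phi>_i^(k-1) at least 2
  \<phi>_i. Hence \<phi>_i belongs to the plateau [\<phi>_i, \<phi>_(i+1) / 2] that starts there,
  whose value \<phi>_(i+1) - \<phi>_i is at least \<phi>_i^k / 2. Doubling also gives 2^i \<le>
  \<phi>_i.\<close>

lemma osgood_type_sequence:
  assumes "osgood_type k f"
  obtains \<phi> :: "nat \<Rightarrow> real" and c where "0 < c" "\<And>i. 2 ^ i \<le> \<phi> i" "\<And>i. c * \<phi> i powr k \<le> f (\<phi> i)"
proof -
  obtain \<phi>0 F c C where k: "1 < k" and \<phi>0: "2 powr (1 / (k - 1)) < \<phi>0"
    and F: "is_osgood_model k \<phi>0 F" and c: "0 < c" and cF: "\<And>s. 0 \<le> s \<Longrightarrow> c * F s \<le> f s"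
    using assms unfolding osgood_type_def by auto
  define \<phi> where "\<phi> = osgood_phi k \<phi>0"
  have two: "2 \<le> x powr (k - 1)" if "\<phi>0 \<le> x" for x
  proof -
    have "(2 powr (1 / (k - 1))) powr (k - 1) \<le> x powr (k - 1)"
      using \<phi>0 that k by (intro powr_mono2) auto
    then show ?thesis using k by (simp add: powr_powr)
  qed
  have "1 \<le> (2::real) powr (1 / (k - 1))" using k by (intro ge_one_powr_ge_zero) auto
  then have \<phi>0_1: "1 \<le> \<phi>0" using \<phi>0 by linarith
  have phi_Suc: "\<phi> (Suc i) = \<phi> i * \<phi> i powr (k - 1)" if "1 \<le> \<phi> i" for i
    using that by (simp add: \<phi>_def powr_diff)
  have ge: "\<phi>0 \<le> \<phi> i \<and> 2 ^ i \<le> \<phi> i" for i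
  proof (induction i)
    case 0
    then show ?case using \<phi>0_1 by (simp add: \<phi>_def)
  next
    case (Suc i)
    then have 1: "1 \<le> \<phi> i" using \<phi>0_1 by linarith
    have "\<phi> i * 2 \<le> \<phi> (Suc i)"
      unfolding phi_Suc[OF 1] using 1 Suc.IH by (intro mult_left_mono two) auto
    then show ?case using Suc.IH 1 by auto
  qed
  have step: "\<phi> i * 2 \<le> \<phi> (Suc i)" for i
    using ge[of i] \<phi>0_1 by (subst phi_Suc) (auto intro!: mult_left_mono two)
  show thesis
  proof
    show "0 < c / 2" using c by simp
    show "2 ^ i \<le> \<phi> i" for i using ge by blast
    show "c / 2 * \<phi> i powr k \<le> f (\<phi> i)" for i
    proof -
      have p: "\<phi> (Suc i) = \<phi> i powr k" by (simp add: \<phi>_def)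
      have "\<forall>i\<ge>1. \<forall>s\<in>{\<phi> (i - 1)..\<phi> i / 2}. F s = \<phi> i - \<phi> (i - 1)"
        using F unfolding is_osgood_model_def Let_def \<phi>_def by blast
      from this[rule_format, of "Suc i" "\<phi> i"] have "F (\<phi> i) = \<phi> (Suc i) - \<phi> i"
        using step[of i] by simp
      then have "\<phi> i powr k / 2 \<le> F (\<phi> i)" using step[of i] by (simp add: p)
      then have "c * (\<phi> i powr k / 2) \<le> c * F (\<phi> i)" using c by (intro mult_left_mono) auto
      also have "\<dots> \<le> f (\<phi> i)" using ge[of i] \<phi>0_1 by (intro cF) linarith
      finally show ?thesis by simp
    qed
  qed
qed

text \<open>Monotonicity carried over to w = \<infinity>, where the value is a limit; it is
  \<infinity> because f is monotone and unbounded.\<close>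

lemma ext_at_top_ge:
  assumes mono: "mono_on {0..} f" and unb: "\<And>b. \<exists>s\<ge>0. b \<le> f s"
    and a: "0 \<le> a" and w: "ennreal a \<le> w"
  shows "ennreal (f a) \<le> ext_at_top f w"
proof (cases "w = \<infinity>")
  case True
  have "((\<lambda>s. ennreal (f s)) \<longlongrightarrow> \<infinity>) at_top"
  proof (rule order_tendstoI)
    fix y :: ennreal assume y: "y < \<infinity>"
    then obtain b where b: "0 \<le> b" "y = ennreal b" by (cases y) auto
    obtain s0 where s0: "0 \<le> s0" "b + 1 \<le> f s0" using unb by blast
    have "y < ennreal (f s)" if "s0 \<le> s" for s
    proof -
      have "f s0 \<le> f s" using mono s0 that by (auto simp: mono_on_def)
      then show ?thesis using b s0 by (simp add: ennreal_less_iff)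
    qed
    then show "\<forall>\<^sub>F s in at_top. y < ennreal (f s)"
      by (rule eventually_at_top_linorderI)
  qed simp
  then have "Lim at_top (\<lambda>s. ennreal (f s)) = \<infinity>"
    by (intro tendsto_Lim) auto
  then show ?thesis using True by (simp add: ext_at_top_def)
next
  case False
  then have "a \<le> enn2real w"
    using w a by (metis enn2real_ennreal enn2real_mono infinity_ennreal_def less_top)
  then have "f a \<le> f (enn2real w)" using mono a by (auto simp: mono_on_def)
  then show ?thesis using False by (simp add: ext_at_top_def ennreal_leI)
qed

context subdiffusion
begin

text \<open>If |x| \<le> \<rho> and |x - y| \<le> \<rho>, then |y| \<le> 2 \<rho>; this is the
  origin of the radius 2 \<rho> on which the datum is large.\<close>

lemma Z_convolution_lower_bound:
  assumes [measurable]: "u0 \<in> borel_measurable borel" and t: "0 < t" and \<rho>: "0 < \<rho>" and x: "norm x \<le> \<rho>"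
    and u0: "AE y in lborel. norm y \<le> 2 * \<rho> \<longrightarrow> a \<le> u0 y"
  shows "ennreal a * (\<integral>\<^sup>+ z\<in>cball 0 \<rho>. Z t z \<partial>lborel) \<le> (\<integral>\<^sup>+ y. Z t (x - y) * ennreal (u0 y) \<partial>lebesgue)"
proof -
  have [measurable]: "cball (0::'a) \<rho> \<in> sets borel" by (simp add: borel_closed)
  have "ennreal a * (\<integral>\<^sup>+ z\<in>cball 0 \<rho>. Z t z \<partial>lborel) = ennreal a * (\<integral>\<^sup>+ z. Zf t z * indicator (cball 0 \<rho>) z \<partial>lborel)"
    by (simp only: Z_eq[OF t])
  also have "\<dots> = (\<integral>\<^sup>+ z. ennreal a * (Zf t z * indicator (cball 0 \<rho>) z) \<partial>lborel)"
    by (rule nn_integral_cmult[symmetric]) measurable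
  also have "\<dots> = (\<integral>\<^sup>+ y. ennreal a * (Zf t (x - y) * indicator (cball 0 \<rho>) (x - y)) \<partial>lborel)"
    by (rule nn_integral_lborel_reflect[symmetric]) measurable
  also have "\<dots> \<le> (\<integral>\<^sup>+ y. Zf t (x - y) * ennreal (u0 y) \<partial>lborel)"
  proof (rule nn_integral_mono_AE)
    show "AE y in lborel. ennreal a * (Zf t (x - y) * indicator (cball 0 \<rho>) (x - y)) \<le> Zf t (x - y) * ennreal (u0 y)"
      using u0
    proof eventually_elim
      case (elim y)
      show ?case
      proof (cases "norm (x - y) \<le> \<rho>")
        case True
        have "norm y \<le> norm x + norm (x - y)" by (metis norm_minus_commute norm_triangle_sub)
        then have "a \<le> u0 y" using elim True x by auto
        then have "ennreal a * Zf t (x - y) \<le> ennreal (u0 y) * Zf t (x - y)"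
          by (intro mult_right_mono ennreal_leI) auto
        then show ?thesis using True by (simp add: mult.commute)
      qed simp
    qed
  qed
  also have "\<dots> = (\<integral>\<^sup>+ y. Z t (x - y) * ennreal (u0 y) \<partial>lebesgue)"
    unfolding Z_eq[OF t] by (rule nn_integral_completion[symmetric])
  finally show ?thesis .
qed

text \<open>Only the part 0 < s < \<tau>, |y| \<le> \<rho> of the double integral is kept. As Y is
  controlled through time integrals alone, the s-integral is estimated for fixed y, where t - s runs
  through the window (t - \<tau>, t). The window bound is available for almost every y, namely when
  H is finite at x - y.\<close>

lemma Duhamel_lower_bound:
  assumes t: "0 < t" and \<tau>: "0 < \<tau>" "\<tau> \<le> t / 2" and \<rho>: "0 < \<rho>" and x: "norm x + \<rho> \<le> R"
    and c: "0 \<le> c"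
    and Ylow: "\<And>x. norm x \<le> R \<Longrightarrow> \<forall>t. H t x < \<infinity> \<Longrightarrow>
      ennreal (c * \<tau>) \<le> (\<integral>\<^sup>+ s\<in>{t - \<tau><..<t}. Yf s x \<partial>lborel)"
    and C: "0 \<le> C"
    and h: "AE s in lborel. 0 < s \<and> s < \<tau> \<longrightarrow> (AE y in lborel. norm y \<le> \<rho> \<longrightarrow> ennreal C \<le> h s y)"
  shows "ennreal (C * c * unit_ball_vol (real DIM('a)) * (\<tau> * \<rho> ^ DIM('a)))
    \<le> (\<integral>\<^sup>+ s\<in>{0<..<t}. (\<integral>\<^sup>+ y. Y (t - s) (x - y) * h s y \<partial>lebesgue) \<partial>lebesgue)"
proof -
  have [measurable]: "cball (0::'a) \<rho> \<in> sets borel" by (simp add: borel_closed)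
  let ?f = "\<lambda>s y. ennreal C * (Yf (t - s) (x - y) * indicator {0<..<\<tau>} s * indicator (cball 0 \<rho>) y)"
  have em: "emeasure lborel (cball (0::'a) \<rho>) = ennreal (unit_ball_vol (real DIM('a)) * \<rho> ^ DIM('a))"
    using \<rho> by (simp add: emeasure_cball)
  have "ennreal (C * c * unit_ball_vol (real DIM('a)) * (\<tau> * \<rho> ^ DIM('a)))
    = ennreal ((C * (c * \<tau>)) * (unit_ball_vol (real DIM('a)) * \<rho> ^ DIM('a)))"
    by (simp add: mult_ac)
  also have "\<dots> = ennreal (C * (c * \<tau>)) * emeasure lborel (cball (0::'a) \<rho>)"
    unfolding em using C c \<tau> \<rho> by (intro ennreal_mult) auto
  also have "\<dots> = (\<integral>\<^sup>+ y. ennreal (C * (c * \<tau>)) * indicator (cball (0::'a) \<rho>) y \<partial>lborel)"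
    by (simp add: nn_integral_cmult_indicator)
  also have "\<dots> \<le> (\<integral>\<^sup>+ y. (\<integral>\<^sup>+ s. ?f s y \<partial>lborel) \<partial>lborel)"
  proof (rule nn_integral_mono_AE)
    have "AE y in lborel. \<forall>t. H t (x - y) < \<infinity>"
    proof -
      have "AE y in distr lborel borel ((-) x). \<forall>t. H t y < \<infinity>"
        unfolding lborel_distr_reflect by (rule H_finite_all)
      from AE_distrD[OF _ this] show ?thesis by simp
    qed
    then show "AE y in lborel. ennreal (C * (c * \<tau>)) * indicator (cball 0 \<rho>) y \<le> (\<integral>\<^sup>+ s. ?f s y \<partial>lborel)"
    proof eventually_elim
      case (elim y)
      show ?case
      proof (cases "norm y \<le> \<rho>")
        case True
        have "norm (x - y) \<le> norm x + norm y" by (rule norm_triangle_ineq4)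
        then have "norm (x - y) \<le> R" using x True by linarith
        from Ylow[OF this elim]
        have "ennreal (c * \<tau>) \<le> (\<integral>\<^sup>+ s\<in>{t - \<tau><..<t}. Yf s (x - y) \<partial>lborel)" .
        also have "\<dots> = (\<integral>\<^sup>+ s. Yf (t + (-1) * s) (x - y) * indicator {t - \<tau><..<t} (t + (-1) * s) \<partial>lborel)"
          by (subst nn_integral_real_affine[where t=t and c="-1"]) auto
        also have "\<dots> = (\<integral>\<^sup>+ s. Yf (t - s) (x - y) * indicator {0<..<\<tau>} s \<partial>lborel)"
          by (intro nn_integral_cong) (auto split: split_indicator)
        finally have "ennreal C * ennreal (c * \<tau>) \<le> ennreal C * (\<integral>\<^sup>+ s. Yf (t - s) (x - y) * indicator {0<..<\<tau>} s \<partial>lborel)"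
          by (rule mult_left_mono) simp
        also have "\<dots> = (\<integral>\<^sup>+ s. ?f s y \<partial>lborel)"
          using True by (subst nn_integral_cmult[symmetric]) auto
        finally show ?thesis using True C c \<tau> by (simp add: ennreal_mult)
      qed simp
    qed
  qed
  also have "\<dots> = (\<integral>\<^sup>+ s. (\<integral>\<^sup>+ y. ?f s y \<partial>lborel) \<partial>lborel)"
    by (rule lborel_pair.Fubini') measurable
  also have "\<dots> = (\<integral>\<^sup>+ s. (\<integral>\<^sup>+ y. ?f s y \<partial>lebesgue) \<partial>lebesgue)"
    by (simp only: nn_integral_completion)
  \<comment> \<open>\<open>h\<close> enters only here, by monotonicity of the iterated integrals;
    Tonelli was applied to the minorant with the constant C, since no joint measurability of
    \<open>h\<close> is assumed.\<close>
  also have "\<dots> \<le> (\<integral>\<^sup>+ s\<in>{0<..<t}. (\<integral>\<^sup>+ y. Y (t - s) (x - y) * h s y \<partial>lebesgue) \<partial>lebesgue)"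
  proof (rule nn_integral_mono_AE)
    show "AE s in lebesgue. (\<integral>\<^sup>+ y. ?f s y \<partial>lebesgue) \<le> (\<integral>\<^sup>+ y. Y (t - s) (x - y) * h s y \<partial>lebesgue) * indicator {0<..<t} s"
      using h unfolding AE_completion_iff
    proof eventually_elim
      case (elim s)
      show ?case
      proof (cases "0 < s \<and> s < \<tau>")
        case True
        then have st: "s < t" using \<tau> t by linarith
        have "AE y in lebesgue. norm y \<le> \<rho> \<longrightarrow> ennreal C \<le> h s y"
          using elim True unfolding AE_completion_iff by blast
        then have "AE y in lebesgue. ?f s y \<le> Y (t - s) (x - y) * h s y"
        proof eventually_elim
          case (elim y)
          show ?case
          proof (cases "norm y \<le> \<rho>")
            case True
            then have "ennreal C * Y (t - s) (x - y) \<le> h s y * Y (t - s) (x - y)"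
              using elim by (intro mult_right_mono) auto
            then show ?thesis using True \<open>0 < s \<and> s < \<tau>\<close> st by (simp add: Yf_def mult.commute)
          qed simp
        qed
        then show ?thesis using True st by (simp add: nn_integral_mono_AE)
      qed auto
    qed
  qed
  finally show ?thesis .
qed

end

text \<open>u0^q is a sum of multiples of indicators of balls, so its integral is a series with
  terms of order \<phi>_i^q \<rho>_i^d = \<phi>_i^(-\<epsilon>) \<le> 2^(-\<epsilon> i), and each
  single term bounds u0 from below on its own ball. The heights \<phi>_i / c0 make up for the
  constant lost in \<open>nn_integral_Z_cball\<close>.\<close>

lemma blow_up_datum:
  fixes \<phi> :: "nat \<Rightarrow> real" and q e \<epsilon> c0 :: real
  assumes q: "1 \<le> q" and \<epsilon>: "0 < \<epsilon>" and c0: "0 < c0" and \<phi>: "\<And>i. 2 ^ i \<le> \<phi> i"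
    and e: "e = (q + \<epsilon>) / real DIM('a::euclidean_space)"
  obtains u0 :: "'a::euclidean_space \<Rightarrow> real" where "\<And>x. 0 \<le> u0 x" "u0 \<in> borel_measurable borel" "in_Lq q u0"
    "\<And>i. AE x in lborel. norm x \<le> 2 * \<phi> i powr (- e) \<longrightarrow> \<phi> i / c0 \<le> u0 x"
proof -
  have \<phi>1: "1 \<le> \<phi> i" for i using \<phi>[of i] one_le_power[of "2::real" i] by linarith
  have \<phi>pos: "0 < \<phi> i" for i using \<phi>1[of i] by linarith
  define \<rho> where "\<rho> i = \<phi> i powr (- e)" for i
  have \<rho>: "0 < \<rho> i" for i using \<phi>pos[of i] by (simp add: \<rho>_def)
  have [measurable]: "cball (0::'a) r \<in> sets borel" for r by (simp add: borel_closed)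
  define V where "V = unit_ball_vol (real DIM('a))"
  have V: "0 < V" by (simp add: V_def)
  define w :: "'a \<Rightarrow> ennreal" where
    "w x = (\<Sum>i. ennreal ((\<phi> i / c0) powr q) * indicator (cball 0 (2 * \<rho> i)) x)" for x
  have [measurable]: "w \<in> borel_measurable borel" unfolding w_def by measurable
  have w_term: "(\<integral>\<^sup>+ x. ennreal ((\<phi> i / c0) powr q) * indicator (cball 0 (2 * \<rho> i)) x \<partial>(lborel :: 'a measure))
    \<le> ennreal (V * 2 ^ DIM('a) * c0 powr (- q) * (2 powr (- \<epsilon>)) ^ i)" for i
  proof -
    have "(\<integral>\<^sup>+ x. ennreal ((\<phi> i / c0) powr q) * indicator (cball 0 (2 * \<rho> i)) x \<partial>(lborel :: 'a measure))
      = ennreal ((\<phi> i / c0) powr q) * ennreal (V * (2 * \<rho> i) ^ DIM('a))"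
      using \<rho>[of i] by (simp add: nn_integral_cmult_indicator emeasure_cball V_def)
    also have "\<dots> = ennreal ((\<phi> i / c0) powr q * (V * (2 * \<rho> i) ^ DIM('a)))"
      using V \<rho>[of i] by (simp add: ennreal_mult)
    also have "\<rho> i ^ DIM('a) = \<phi> i powr (- (q + \<epsilon>))"
      using \<rho>[of i] \<phi>pos[of i] by (simp add: \<rho>_def e powr_realpow[symmetric] powr_powr)
    then have "(\<phi> i / c0) powr q * (V * (2 * \<rho> i) ^ DIM('a)) = V * 2 ^ DIM('a) * c0 powr (- q) * (\<phi> i powr q * \<phi> i powr (- (q + \<epsilon>)))"
      using \<phi>pos[of i] c0 by (simp add: power_mult_distrib powr_divide powr_minus_divide)
    also have "\<phi> i powr q * \<phi> i powr (- (q + \<epsilon>)) = \<phi> i powr (- \<epsilon>)"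
      by (simp add: powr_add[symmetric])
    also have "ennreal (V * 2 ^ DIM('a) * c0 powr (- q) * \<phi> i powr (- \<epsilon>)) \<le> ennreal (V * 2 ^ DIM('a) * c0 powr (- q) * (2 powr (- \<epsilon>)) ^ i)"
    proof (intro ennreal_leI mult_left_mono)
      have "\<phi> i powr (- \<epsilon>) \<le> (2 ^ i) powr (- \<epsilon>)" using \<phi>[of i] \<epsilon> by (intro powr_mono2') auto
      also have "\<dots> = (2 powr (- \<epsilon>)) ^ i"
        by (simp add: powr_realpow[symmetric] powr_powr mult.commute)
      finally show "\<phi> i powr (- \<epsilon>) \<le> (2 powr (- \<epsilon>)) ^ i" .
    qed (use V in auto)
    finally show ?thesis .
  qed
  have "(\<integral>\<^sup>+ x. w x \<partial>lborel) = (\<Sum>i. \<integral>\<^sup>+ x. ennreal ((\<phi> i / c0) powr q) * indicator (cball 0 (2 * \<rho> i)) x \<partial>(lborel :: 'a measure))"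
    unfolding w_def by (rule nn_integral_suminf) measurable
  also have "\<dots> \<le> (\<Sum>i. ennreal (V * 2 ^ DIM('a) * c0 powr (- q) * (2 powr (- \<epsilon>)) ^ i))"
    by (intro suminf_le w_term) auto
  also have "\<dots> < \<infinity>"
  proof -
    have "(2::real) powr (- \<epsilon>) < 2 powr 0" using \<epsilon> by (intro powr_less_mono) auto
    then have "summable (\<lambda>i. V * 2 ^ DIM('a) * c0 powr (- q) * (2 powr (- \<epsilon>)) ^ i)"
      by (intro summable_mult summable_geometric) auto
    then have "(\<Sum>i. ennreal (V * 2 ^ DIM('a) * c0 powr (- q) * (2 powr (- \<epsilon>)) ^ i))
      = ennreal (\<Sum>i. V * 2 ^ DIM('a) * c0 powr (- q) * (2 powr (- \<epsilon>)) ^ i)"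
      using V by (intro suminf_ennreal2) auto
    then show ?thesis by simp
  qed
  finally have w_int: "(\<integral>\<^sup>+ x. w x \<partial>lborel) < \<infinity>" .
  then have w_fin: "AE x in lborel. w x \<noteq> \<infinity>" by (intro nn_integral_noteq_infinite) auto
  \<comment> \<open>\<open>enn2real\<close> sends \<infinity> to 0, so the lower bounds can hold
    only off the null set where the series diverges; the origin, common to all balls, belongs to
    it.\<close>
  define u0 where "u0 x = enn2real (w x) powr (1 / q)" for x
  have u0_q: "\<bar>u0 x\<bar> powr q = enn2real (w x)" for x
    using q by (simp add: u0_def powr_powr)
  show thesis
  proof
    show "0 \<le> u0 x" for x by (simp add: u0_def)
    show meas: "u0 \<in> borel_measurable borel" unfolding u0_def by measurable
    have "integrable lborel (\<lambda>x. enn2real (w x))"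
    proof (rule integrableI_bounded)
      have "(\<integral>\<^sup>+ x. ennreal (norm (enn2real (w x))) \<partial>lborel) \<le> (\<integral>\<^sup>+ x. w x \<partial>lborel)"
        by (intro nn_integral_mono) (auto simp: ennreal_enn2real_if)
      then show "(\<integral>\<^sup>+ x. ennreal (norm (enn2real (w x))) \<partial>lborel) < \<infinity>" using w_int by (rule le_less_trans)
    qed measurable
    then show "in_Lq q u0"
      unfolding in_Lq_def u0_q using meas by (auto intro!: integrable_completion[THEN iffD2] measurable_completion)
    show "AE x in lborel. norm x \<le> 2 * \<phi> i powr (- e) \<longrightarrow> \<phi> i / c0 \<le> u0 x" for i
      using w_fin
    proof eventually_elim
      case (elim x)
      show ?case
      proof
        assume x: "norm x \<le> 2 * \<phi> i powr (- e)"
        have "ennreal ((\<phi> i / c0) powr q) = (\<Sum>j\<in>{i}. ennreal ((\<phi> j / c0) powr q) * indicator (cball 0 (2 * \<rho> j)) x)"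
          using x by (simp add: \<rho>_def)
        also have "\<dots> \<le> w x" unfolding w_def by (rule sum_le_suminf) auto
        finally have "enn2real (ennreal ((\<phi> i / c0) powr q)) \<le> enn2real (w x)"
          using elim by (intro enn2real_mono) (auto simp: less_top)
        then have "((\<phi> i / c0) powr q) powr (1 / q) \<le> u0 x"
          unfolding u0_def using q by (intro powr_mono2) auto
        then show "\<phi> i / c0 \<le> u0 x" using q \<phi>pos[of i] c0 by (simp add: powr_powr)
      qed
    qed
  qed
qed

lemma filterlim_powr_at_top:
  fixes \<delta> :: real
  assumes \<delta>: "0 < \<delta>"
  shows "filterlim (\<lambda>x. x powr \<delta>) at_top at_top"
  unfolding filterlim_at_top
proof
  fix b :: real
  have "b \<le> x powr \<delta>" if "\<bar>b\<bar> powr (1 / \<delta>) \<le> x" for x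
  proof -
    have "b \<le> (\<bar>b\<bar> powr (1 / \<delta>)) powr \<delta>" using \<delta> by (simp add: powr_powr)
    also have "\<dots> \<le> x powr \<delta>" using that \<delta> by (intro powr_mono2) auto
    finally show ?thesis .
  qed
  then show "\<forall>\<^sub>F x in at_top. b \<le> x powr \<delta>"
    by (rule eventually_at_top_linorderI)
qed

lemma filterlim_at_top_ge_power2:
  fixes \<phi> :: "nat \<Rightarrow> real"
  assumes "\<And>i. 2 ^ i \<le> \<phi> i"
  shows "filterlim \<phi> at_top sequentially"
proof (rule filterlim_at_top_mono[OF filterlim_real_sequentially], intro always_eventually allI)
  show "real i \<le> \<phi> i" for i
    using of_nat_less_two_power[of i, where 'a=real] assms[of i] by linarith
qed

section \<open>Infinite right-hand side near the origin\<close>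

context subdiffusion
begin

text \<open>The equation is assumed for almost every s and almost every y, which both notions of
  solution provide. The conclusion concerns every t in (0, T) and a whole ball of points x, so it
  contradicts finiteness almost everywhere as well as local integrability.\<close>

lemma mild_rhs_blow_up:
  assumes q: "1 \<le> q" and f_mono: "mono_on {0..} f" and f_osgood: "osgood_type k f"
    and k: "q * (1 + \<beta> / (\<alpha> * real DIM('a))) < k"
  obtains u0 :: "'a \<Rightarrow> real" where "\<And>x. 0 \<le> u0 x" "in_Lq q u0"
    "\<And>T u t. AE s in lborel. 0 < s \<and> s < T \<longrightarrow> (AE y in lborel. u s y = mild_rhs Z Y f u0 u s y) \<Longrightarrow>
      0 < t \<Longrightarrow> t < T \<Longrightarrow> \<exists>R>0. \<forall>x. norm x \<le> R \<longrightarrow> mild_rhs Z Y f u0 u t x = \<infinity>"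
proof -
  obtain \<phi> cf where cf: "0 < cf" and \<phi>: "\<And>i. 2 ^ i \<le> \<phi> i" and f_\<phi>: "\<And>i. cf * \<phi> i powr k \<le> f (\<phi> i)"
    by (rule osgood_type_sequence[OF f_osgood]) (rule that)
  have k1: "1 < k" using f_osgood by (simp add: osgood_type_def)
  have \<phi>1: "1 \<le> \<phi> i" for i using \<phi>[of i] one_le_power[of "2::real" i] by linarith
  have \<phi>pos: "0 < \<phi> i" for i using \<phi>1[of i] by linarith
  have \<phi>lim: "filterlim \<phi> at_top sequentially" by (rule filterlim_at_top_ge_power2[OF \<phi>])
  obtain c0 v0 where c0: "0 < c0" "0 < v0"
    and Zc: "\<And>t \<rho>. 0 < t \<Longrightarrow> 0 < \<rho> \<Longrightarrow> t \<le> v0 * \<rho> powr (\<beta> / \<alpha>) \<Longrightarrow> ennreal c0 \<le> (\<integral>\<^sup>+ z\<in>cball 0 \<rho>. Z t z \<partial>lborel)"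
    by (rule nn_integral_Z_cball) (rule that)
  let ?d = "real DIM('a)"
  define m where "m = 1 + \<beta> / (\<alpha> * ?d)"
  have m: "0 < m" using \<alpha> \<beta> by (simp add: m_def add_pos_nonneg)
  \<comment> \<open>As m = (d + \<beta>/\<alpha>) / d, the product \<tau>_i \<rho>_i^d will have
    order \<phi>_i^(-(q+\<epsilon>) m). Putting q + \<epsilon> midway between q and k / m leaves k -
    (q + \<epsilon>) m positive.\<close>
  define \<kappa> where "\<kappa> = k / m"
  define \<epsilon> where "\<epsilon> = (\<kappa> - q) / 2"
  have qm: "q < \<kappa>" using k m unfolding m_def[symmetric] \<kappa>_def by (simp add: pos_less_divide_eq)
  then have \<epsilon>: "0 < \<epsilon>" by (simp add: \<epsilon>_def)
  have "q + \<epsilon> < \<kappa>" using qm unfolding \<epsilon>_def by (simp add: field_simps)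
  then have \<delta>: "0 < k - (q + \<epsilon>) * m" using m by (simp add: \<kappa>_def pos_less_divide_eq)
  define e where "e = (q + \<epsilon>) / ?d"
  have e: "0 < e" using q \<epsilon> by (simp add: e_def)
  have ed: "e * ?d + e * (\<beta> / \<alpha>) = (q + \<epsilon>) * m"
    using \<alpha> by (simp add: e_def m_def field_simps)
  obtain u0 :: "'a \<Rightarrow> real" where u0: "\<And>x. 0 \<le> u0 x" and u0m: "u0 \<in> borel_measurable borel" and Lq: "in_Lq q u0"
    and u0_ge: "\<And>i. AE x in lborel. norm x \<le> 2 * \<phi> i powr (- e) \<longrightarrow> \<phi> i / c0 \<le> u0 x"
    by (rule blow_up_datum[OF q \<epsilon> c0(1) \<phi> e_def]) (rule that)
  define \<rho> where "\<rho> i = \<phi> i powr (- e)" for i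
  have \<rho>: "0 < \<rho> i" for i using \<phi>pos[of i] by (simp add: \<rho>_def)
  \<comment> \<open>The longest time for which \<open>nn_integral_Z_cball\<close> applies at radius
    \<rho>_i.\<close>
  define \<tau> where "\<tau> i = v0 * \<rho> i powr (\<beta> / \<alpha>)" for i
  have \<tau>: "0 < \<tau> i" for i using \<rho>[of i] c0 by (simp add: \<tau>_def)
  have \<rho>lim: "\<rho> \<longlonglongrightarrow> 0"
    unfolding \<rho>_def using e by (intro tendsto_neg_powr \<phi>lim) auto
  have "(\<lambda>i. \<rho> i powr (\<beta> / \<alpha>)) \<longlonglongrightarrow> 0 powr (\<beta> / \<alpha>)"
    using \<rho>lim \<alpha> \<beta> \<rho> by (intro tendsto_powr') (auto intro!: always_eventually less_imp_le)
  then have \<tau>lim: "\<tau> \<longlonglongrightarrow> 0"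
    unfolding \<tau>_def using tendsto_mult_right[of _ 0 _ v0] \<alpha> \<beta> by (auto intro: tendsto_mult_right_zero)
  \<comment> \<open>Serves the points where u = \<infinity>, at which f(u) is read as a
    limit.\<close>
  have unb: "\<exists>s\<ge>0. b \<le> f s" for b
  proof -
    have "\<forall>\<^sub>F i in sequentially. b / cf \<le> \<phi> i" using \<phi>lim by (simp add: filterlim_at_top)
    then obtain i where i: "b / cf \<le> \<phi> i" by (meson eventually_sequentially le_refl)
    have "\<phi> i = \<phi> i powr 1" using \<phi>pos[of i] by simp
    also have "\<dots> \<le> \<phi> i powr k" using \<phi>1[of i] k1 by (intro powr_mono) auto
    finally have "cf * \<phi> i \<le> f (\<phi> i)"
      using f_\<phi>[of i] cf by (meson mult_left_mono less_imp_le order_trans)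
    moreover have "b \<le> cf * \<phi> i" using i cf by (simp add: divide_le_eq mult.commute)
    ultimately show ?thesis using \<phi>pos[of i] by (intro exI[of _ "\<phi> i"]) auto
  qed
  \<comment> \<open>The linear part alone gives this bound, whatever u is, because the Duhamel term
    is nonnegative.\<close>
  have rhs_ge: "ennreal (\<phi> i) \<le> mild_rhs Z Y f u0 u s y" if "0 < s" "s \<le> \<tau> i" "norm y \<le> \<rho> i" for i u s y
  proof -
    have "ennreal (\<phi> i) = ennreal (\<phi> i / c0) * ennreal c0"
      using c0 \<phi>pos[of i] by (simp add: ennreal_mult[symmetric])
    also have "\<dots> \<le> ennreal (\<phi> i / c0) * (\<integral>\<^sup>+ z\<in>cball 0 (\<rho> i). Z s z \<partial>lborel)"
      using that \<rho>[of i] by (intro mult_left_mono Zc) (auto simp: \<tau>_def)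
    also have "\<dots> \<le> (\<integral>\<^sup>+ y'. Z s (y - y') * ennreal (u0 y') \<partial>lebesgue)"
      using that u0_ge[of i] by (intro Z_convolution_lower_bound u0m \<rho>) (auto simp: \<rho>_def)
    also have "\<dots> \<le> mild_rhs Z Y f u0 u s y"
      unfolding mild_rhs_def by simp
    finally show ?thesis .
  qed
  show thesis
  proof (rule that[OF u0 Lq])
    fix T t :: real and u :: "real \<Rightarrow> 'a \<Rightarrow> ennreal"
    assume sol: "AE s in lborel. 0 < s \<and> s < T \<longrightarrow> (AE y in lborel. u s y = mild_rhs Z Y f u0 u s y)"
      and t: "0 < t" "t < T"
    obtain R c where R: "0 < R" and c: "0 < c"
      and Ylow: "\<And>x \<tau>. norm x \<le> R \<Longrightarrow> \<forall>t. H t x < \<infinity> \<Longrightarrow> 0 < \<tau> \<Longrightarrow> \<tau> \<le> t / 2 \<Longrightarrow>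
      ennreal (c * \<tau>) \<le> (\<integral>\<^sup>+ s\<in>{t - \<tau><..<t}. Yf s x \<partial>lborel)"
      by (rule Y_window_lower_bound[OF t(1)]) (rule that)
    let ?V = "unit_ball_vol ?d"
    \<comment> \<open>With |x| \<le> R / 2 and |y| \<le> \<rho>_i < R / 2 the difference x - y stays
      in the ball of radius R, where the window bound for Y holds.\<close>
    have "mild_rhs Z Y f u0 u t x = \<infinity>" if x: "norm x \<le> R / 2" for x
    proof -
      have low: "ennreal (cf * \<phi> i powr k * c * ?V * (\<tau> i * \<rho> i ^ DIM('a))) \<le> mild_rhs Z Y f u0 u t x"
        if i: "\<tau> i < t / 2" "\<rho> i < R / 2" for i
      proof -
        have h: "AE s in lborel. 0 < s \<and> s < \<tau> i \<longrightarrow> (AE y in lborel. norm y \<le> \<rho> i \<longrightarrow> ennreal (cf * \<phi> i powr k) \<le> ext_at_top f (u s y))"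
          using sol
        proof eventually_elim
          case (elim s)
          show ?case
          proof
            assume s: "0 < s \<and> s < \<tau> i"
            then have "AE y in lborel. u s y = mild_rhs Z Y f u0 u s y" using elim i t by auto
            then show "AE y in lborel. norm y \<le> \<rho> i \<longrightarrow> ennreal (cf * \<phi> i powr k) \<le> ext_at_top f (u s y)"
            proof eventually_elim
              case (elim y)
              show ?case
              proof
                assume "norm y \<le> \<rho> i"
                then have "ennreal (\<phi> i) \<le> u s y" using rhs_ge[of s i y u] s elim by simp
                then have "ennreal (f (\<phi> i)) \<le> ext_at_top f (u s y)"
                  using \<phi>pos[of i] by (intro ext_at_top_ge f_mono unb) auto
                then show "ennreal (cf * \<phi> i powr k) \<le> ext_at_top f (u s y)"
                  using ennreal_leI[OF f_\<phi>[of i]] by (rule order_trans[rotated])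
              qed
            qed
          qed
        qed
        have "ennreal (cf * \<phi> i powr k * c * ?V * (\<tau> i * \<rho> i ^ DIM('a)))
          \<le> (\<integral>\<^sup>+ s\<in>{0<..<t}. (\<integral>\<^sup>+ y. Y (t - s) (x - y) * ext_at_top f (u s y) \<partial>lebesgue) \<partial>lebesgue)"
          by (rule Duhamel_lower_bound[where R=R])
             (use t \<tau>[of i] i \<rho>[of i] x c cf h Ylow in auto)
        also have "\<dots> \<le> mild_rhs Z Y f u0 u t x" unfolding mild_rhs_def by simp
        finally show ?thesis .
      qed
      define K where "K = cf * c * ?V * v0"
      have K: "0 < K" using cf c c0 by (simp add: K_def)
      have val: "cf * \<phi> i powr k * c * ?V * (\<tau> i * \<rho> i ^ DIM('a)) = K * \<phi> i powr (k - (q + \<epsilon>) * m)" for i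
      proof -
        have "\<tau> i * \<rho> i ^ DIM('a) = v0 * (\<phi> i powr (- e * (\<beta> / \<alpha>)) * \<phi> i powr (- e * ?d))"
          using \<rho>[of i] by (simp add: \<tau>_def powr_realpow[symmetric]) (simp add: \<rho>_def powr_powr)
        also have "\<dots> = v0 * \<phi> i powr (- ((q + \<epsilon>) * m))"
          unfolding ed[symmetric] by (simp add: powr_add[symmetric] algebra_simps)
        finally have "cf * \<phi> i powr k * c * ?V * (\<tau> i * \<rho> i ^ DIM('a)) = K * (\<phi> i powr k * \<phi> i powr (- ((q + \<epsilon>) * m)))"
          by (simp add: K_def mult_ac)
        then show ?thesis by (simp add: powr_add[symmetric])
      qed
      have all: "ennreal b \<le> mild_rhs Z Y f u0 u t x" for b
      proof -
        have "filterlim (\<lambda>i. K * \<phi> i powr (k - (q + \<epsilon>) * m)) at_top sequentially"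
          using K \<delta> by (intro filterlim_tendsto_pos_mult_at_top[OF tendsto_const] filterlim_compose[OF filterlim_powr_at_top \<phi>lim]) auto
        then have "\<forall>\<^sub>F i in sequentially. b \<le> K * \<phi> i powr (k - (q + \<epsilon>) * m)" by (simp add: filterlim_at_top)
        moreover have "\<forall>\<^sub>F i in sequentially. \<tau> i < t / 2" using order_tendstoD(2)[OF \<tau>lim, of "t / 2"] t by simp
        moreover have "\<forall>\<^sub>F i in sequentially. \<rho> i < R / 2" using order_tendstoD(2)[OF \<rho>lim, of "R / 2"] R by simp
        ultimately have "\<forall>\<^sub>F i in sequentially. ennreal b \<le> mild_rhs Z Y f u0 u t x"
        proof eventually_elim
          case (elim i)
          have "ennreal b \<le> ennreal (K * \<phi> i powr (k - (q + \<epsilon>) * m))" using elim by (intro ennreal_leI)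
          also have "\<dots> \<le> mild_rhs Z Y f u0 u t x" using low[of i] elim unfolding val by simp
          finally show ?case .
        qed
        then show ?thesis by simp
      qed
      show ?thesis
      proof (rule ccontr)
        assume "mild_rhs Z Y f u0 u t x \<noteq> \<infinity>"
        then obtain b where "0 \<le> b" "mild_rhs Z Y f u0 u t x = ennreal b" by (cases "mild_rhs Z Y f u0 u t x") auto
        with all[of "b + 1"] show False by (simp add: ennreal_le_iff)
      qed
    qed
    then show "\<exists>R>0. \<forall>x. norm x \<le> R \<longrightarrow> mild_rhs Z Y f u0 u t x = \<infinity>"
      using R by (intro exI[of _ "R / 2"]) auto
  qed
qed

end

section \<open>From time slices to the two nonexistence statements\<close>

lemma AE_cball_False:
  assumes "AE x in lborel. norm (x :: 'a::euclidean_space) \<le> R \<longrightarrow> False"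
  shows "R \<le> 0"
proof (rule ccontr)
  assume "\<not> R \<le> 0"
  then have R: "0 < R" by simp
  have "emeasure lborel (cball (0::'a) R) = 0"
    using assms by (subst (asm) AE_iff_measurable[of "cball 0 R"]) (auto simp: borel_closed)
  moreover have "emeasure lborel (cball (0::'a) R) = ennreal (unit_ball_vol (real DIM('a)) * R ^ DIM('a))"
    using R by (simp add: emeasure_cball)
  moreover have "0 < unit_ball_vol (real DIM('a)) * R ^ DIM('a)" using R by simp
  ultimately show False by (simp add: ennreal_eq_0_iff)
qed

text \<open>\<open>lebesgue\<close> and \<open>lborel\<close> admit the same almost-everywhere
  statements, and \<open>lborel\<close> on pairs is a product measure, so exceptional sets can be
  sliced in time.\<close>

lemma AE_lebesgue_on_Times:
  fixes P :: "real \<Rightarrow> 'a::euclidean_space \<Rightarrow> bool"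
  assumes A: "A \<in> sets borel" and "AE (t, x) in lebesgue_on (A \<times> UNIV). P t x"
  shows "AE t in lborel. t \<in> A \<longrightarrow> (AE x in lborel. P t x)"
proof -
  have "A \<times> (UNIV :: 'a set) \<in> sets (borel \<Otimes>\<^sub>M borel)"
    using A by (intro pair_measureI) auto
  then have "A \<times> (UNIV :: 'a set) \<in> sets lebesgue"
    by (intro sets_completionI_sets) (simp only: borel_prod sets_lborel)
  then have "AE p in lebesgue. p \<in> A \<times> UNIV \<longrightarrow> (case p of (t, x) \<Rightarrow> P t x)"
    using assms(2) by (subst (asm) AE_restrict_space_iff) auto
  then have "AE p in lborel \<Otimes>\<^sub>M lborel. p \<in> A \<times> UNIV \<longrightarrow> (case p of (t, x) \<Rightarrow> P t x)"
    unfolding AE_completion_iff lborel_prod .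
  then have "AE t in lborel. AE x in lborel. (t, x) \<in> A \<times> (UNIV :: 'a set) \<longrightarrow> (case (t, x) of (t, x) \<Rightarrow> P t x)"
    by (rule lborel_pair.AE_pair)
  then show ?thesis by eventually_elim auto
qed

theorem theorem3p1:
  fixes \<alpha> \<beta> q k :: real
    and \<nu> :: "'a::euclidean_space measure"
    and G\<alpha> :: "real \<Rightarrow> real \<Rightarrow> real"
    and Z Y :: "real \<Rightarrow> 'a \<Rightarrow> ennreal"
    and f :: "real \<Rightarrow> real"
  assumes \<alpha>: "0 < \<alpha>" "\<alpha> < 1"
    and \<beta>: "0 < \<beta>" "\<beta> < 2"
    and \<nu>: "admissible_spectral_measure \<beta> \<nu>"
    and G\<alpha>: "stable_subordinator_density \<alpha> G\<alpha>"
    and Z: "Z = Z_kernel \<alpha> \<beta> \<nu> G\<alpha>"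
    and Y: "Y_kernel_of \<alpha> Z Y"
    and q: "1 \<le> q"
    and f_nonneg: "\<And>s. 0 \<le> s \<Longrightarrow> 0 \<le> f s"
    and f_lipschitz: "local_lipschitz (UNIV :: real set) {0..} (\<lambda>_. f)"
    and f_mono: "mono_on {0..} f"
    and f_zero: "f 0 = 0"
    and f_pos: "\<And>s. 0 < s \<Longrightarrow> 0 < f s"
    and f_osgood: "osgood_type k f"
    and k: "q * (1 + \<beta> / (\<alpha> * real DIM('a))) < k"
  shows "\<exists>u0 :: 'a \<Rightarrow> real. (\<forall>x. 0 \<le> u0 x) \<and> in_Lq q u0 \<and>
           (\<forall>T>0. \<not> (\<exists>u. integral_solution Z Y f u0 T u)) \<and>
           (\<forall>T>0. \<forall>u. measurable_upto T u \<and>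
              (\<forall>t\<in>{0<..<T}. AE x in lebesgue. u t x = mild_rhs Z Y f u0 u t x) \<longrightarrow>
              (\<forall>t\<in>{0<..<T}. \<not> in_L1_loc (u t)))"
proof -
  interpret subdiffusion \<beta> \<nu> \<alpha> G\<alpha> Y
    by unfold_locales (use \<alpha> \<beta> \<nu> G\<alpha> Y in \<open>auto simp: Z\<close>)
  obtain u0 :: "'a \<Rightarrow> real" where u0: "\<And>x. 0 \<le> u0 x" "in_Lq q u0"
    and blow: "\<And>T u t. AE s in lborel. 0 < s \<and> s < T \<longrightarrow> (AE y in lborel. u s y = mild_rhs Z Y f u0 u s y) \<Longrightarrow>
      0 < t \<Longrightarrow> t < T \<Longrightarrow> \<exists>R>0. \<forall>x. norm x \<le> R \<longrightarrow> mild_rhs Z Y f u0 u t x = \<infinity>"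
    using mild_rhs_blow_up[OF q f_mono f_osgood k] unfolding Z by blast
  have "\<not> integral_solution Z Y f u0 T u" if T: "0 < T" for T u
  proof
    assume sol: "integral_solution Z Y f u0 T u"
    have "AE (t, x) in lebesgue_on ({0<..<T} \<times> UNIV). u t x = mild_rhs Z Y f u0 u t x"
      using sol by (simp add: integral_solution_def)
    from AE_lebesgue_on_Times[OF _ this]
    have mild: "AE t in lborel. 0 < t \<and> t < T \<longrightarrow> (AE x in lborel. u t x = mild_rhs Z Y f u0 u t x)"
      by simp
    have "AE (t, x) in lebesgue_on ({0..<T} \<times> UNIV). u t x < \<infinity>"
      using sol by (simp add: integral_solution_def)
    from AE_lebesgue_on_Times[OF _ this]
    have "AE t in lborel. 0 \<le> t \<and> t < T \<longrightarrow> (AE x in lborel. u t x < \<infinity>)"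
      by simp
    \<comment> \<open>At a time where both properties hold, u would be finite almost everywhere and
      yet infinite on a ball. Hence every t in (0, T) is exceptional, and (0, T) would be a null
      set.\<close>
    then have "AE t in lborel. t \<notin> {0<..<T}"
      using mild
    proof eventually_elim
      case (elim t)
      show ?case
      proof
        assume t: "t \<in> {0<..<T}"
        then obtain R where R: "0 < R" "\<And>x. norm x \<le> R \<Longrightarrow> mild_rhs Z Y f u0 u t x = \<infinity>"
          using blow[OF mild, of t] by auto
        have "AE x in lborel. u t x < \<infinity>" "AE x in lborel. u t x = mild_rhs Z Y f u0 u t x"
          using elim t by auto
        then have "AE x in lborel. norm (x::'a) \<le> R \<longrightarrow> False"
          by eventually_elim (use R(2) in force)
        then show False using AE_cball_False R(1) by force
      qed
    qed
    then have "emeasure lborel {0<..<T} = 0"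
      by (subst (asm) AE_iff_measurable[of "{0<..<T}"]) auto
    then show False using T by simp
  qed
  moreover have "\<not> in_L1_loc (u t)"
    if T: "0 < T" and sol: "\<forall>t\<in>{0<..<T}. AE x in lebesgue. u t x = mild_rhs Z Y f u0 u t x"
      and t: "t \<in> {0<..<T}" for T u t
  proof
    assume L1: "in_L1_loc (u t)"
    have mild: "AE x in lborel. u t x = mild_rhs Z Y f u0 u t x" if "t \<in> {0<..<T}" for t
      using sol that unfolding AE_completion_iff by blast
    then have "AE t in lborel. 0 < t \<and> t < T \<longrightarrow> (AE x in lborel. u t x = mild_rhs Z Y f u0 u t x)"
      by (intro AE_I2) auto
    from blow[OF this, of t] t obtain R where R: "0 < R" "\<And>x. norm x \<le> R \<Longrightarrow> mild_rhs Z Y f u0 u t x = \<infinity>"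
      by auto
    \<comment> \<open>Local integrability over the compact ball forces u t to be finite almost
      everywhere on it, against the blow-up.\<close>
    have "(\<integral>\<^sup>+ x\<in>cball 0 R. u t x \<partial>lebesgue) < \<infinity>"
      using L1 by (auto simp: in_L1_loc_def)
    moreover have "(\<lambda>x. u t x * indicator (cball 0 R) x) \<in> borel_measurable lebesgue"
      using L1 by (intro borel_measurable_times_ennreal borel_measurable_indicator) (auto simp: in_L1_loc_def)
    ultimately have "AE x in lebesgue. u t x * indicator (cball 0 R) x \<noteq> \<infinity>"
      by (intro nn_integral_noteq_infinite) auto
    then have "AE x in lborel. u t x * indicator (cball 0 R) x \<noteq> \<infinity>"
      unfolding AE_completion_iff .
    then have "AE x in lborel. norm (x::'a) \<le> R \<longrightarrow> False"
      using mild[OF t] by eventually_elim (use R(2) in auto)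
    then show False using AE_cball_False R(1) by force
  qed
  ultimately show ?thesis using u0 by (intro exI[of _ u0]) blast
qed

end
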